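(* Let $F:H\to H$ satisfy $\|F(u_1)-F(u_2)\|_H\le L\|u_1-u_2\|_H$ for all $u_1,u_2\in H$ and $F(0)=0$. Let $\varepsilon>0$ and $N\in\mathbb N$ be such that $\lambda_{N+1}-\lambda_N>2L$ and $3\lambda_{N+1}+\lambda_N\le\frac1\varepsilon$. Let $M_\varepsilon$ and $M_0$ be the maps (defined in the context) generating the inertial manifolds $\mathcal M_\varepsilon=M_\varepsilon(P_NH)$ and $\mathcal M_0=M_0(P_NH)$ which correspond to the parameter values $\varepsilon$ and $0$. Then, for all $p\in P_NH$, $$\|M_\varepsilon(p)-M_0(p)\|_{\mathcal E_\varepsilon}\le C\varepsilon\|p\|_H,$$ where the constant $C$ is independent of $\varepsilon$ and $p$.
   Context: $H$ is a Hilbert space with inner product $(\cdot,\cdot)$; $A:D(A)\to H$ is a positive self-adjoint operator with compact inverse, eigenvalues $\lambda_1\le\lambda_2\le\cdots$ and complete orthonormal eigenvectors $\{e_n\}$; $P_Nu=\sum_{n=1}^N(u,e_n)e_n$; $H^s=D(A^{s/2})$, $\|u\|_{H^s}^2=\sum_n\lambda_n^s(u,e_n)^2$. The data $A,F,L,N$ are fixed. For $\varepsilon>0$: $\mathcal E_\varepsilon=H^1\times H$ with norm $\|(u,v)\|^2_{\mathcal E_\varepsilon}=\varepsilon\|v\|_H^2+\|v\|_{H^{-1}}^2+\|u\|_{H^1}^2$. Weighted space: $\|u\|^2_{L^2_{e^{\theta t}}(\mathbb R_-,H)}=\int_{-\infty}^0e^{2\theta t}\|u(t)\|_H^2\,dt$.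 For $\varepsilon>0$ set $$\widehat{\mathcal P}_Nu=\sum_{n=1}^N\frac{\varepsilon}{\sqrt{1-4\varepsilon\lambda_n}}(u,e_n)e_n,\qquad \mathcal P_Nu=\sum_{n=1}^N\frac{1+\sqrt{1-4\varepsilon\lambda_n}}{2\sqrt{1-4\varepsilon\lambda_n}}(u,e_n)e_n,$$ and let $\theta_\varepsilon$ be the smallest root of $2\theta(\varepsilon\theta-1)+\lambda_{N+1}+\lambda_N=0$. Under the stated conditions, for every $p\in P_NH$ the problem $$\varepsilon\partial_t^2u+\partial_tu+Au=F(u),\ t\le0,\qquad \widehat{\mathcal P}_N\partial_tu(0)+\mathcal P_Nu(0)=p,$$ has a unique solution $u=U_\varepsilon(p)\in L^2_{e^{\theta_\varepsilon t}}(\mathbb R_-,H)$, and $M_\varepsilon(p):=\big(u(0),\partial_tu(0)\big)\in\mathcal E_\varepsilon$. For $\varepsilon=0$: $\theta_0=\frac{\lambda_{N+1}+\lambda_N}2$; for every $p\in P_NH$ the problem $\partial_tu+Au=F(u)$, $t\le0$, $P_Nu(0)=p$, has a unique solution $u=U_0(p)\in L^2_{e^{\theta_0t}}(\mathbb R_-,H)$, and $M_0(p):=\big(u(0),\partial_tu(0)\big)=\big(u(0),F(u(0))-Au(0)\big)$. *)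

theory Defs
  imports "HOL-Analysis.Analysis"
begin

text \<open>
  \<open>H\<close> is a real Hilbert space, given as a type of sort \<open>{real_inner, complete_space}\<close>.
  An unbounded operator is a pair of a domain \<open>D\<close> and a function \<open>A\<close> whose values
  outside \<open>D\<close> are irrelevant.  The eigenvalues \<open>lam n\<close> and eigenvectors \<open>e n\<close> are
  indexed by \<open>n \<ge> 1\<close>; \<open>lam 0\<close> and \<open>e 0\<close> are never used.
\<close>

text \<open>The equivalence below says that the graph of \<open>A\<close> is the graph of its adjoint.\<close>

definition self_adjoint_op :: "'a::real_inner set \<Rightarrow> ('a \<Rightarrow> 'a) \<Rightarrow> bool" where
  "self_adjoint_op D A \<longleftrightarrow>
     subspace D \<and> closure D = UNIV \<and>
     (\<forall>x\<in>D. \<forall>y\<in>D. A (x + y) = A x + A y) \<and>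
     (\<forall>c. \<forall>x\<in>D. A (c *\<^sub>R x) = c *\<^sub>R A x) \<and>
     (\<forall>y z. (\<forall>x\<in>D. A x \<bullet> y = x \<bullet> z) \<longleftrightarrow> (y \<in> D \<and> z = A y))"

definition positive_op :: "'a::real_inner set \<Rightarrow> ('a \<Rightarrow> 'a) \<Rightarrow> bool" where
  "positive_op D A \<longleftrightarrow> (\<forall>x\<in>D. x \<noteq> 0 \<longrightarrow> 0 < A x \<bullet> x)"

definition has_compact_inverse :: "'a::real_inner set \<Rightarrow> ('a \<Rightarrow> 'a) \<Rightarrow> bool" where
  "has_compact_inverse D A \<longleftrightarrow>
     bij_betw A D UNIV \<and>
     (\<forall>B. bounded B \<longrightarrow> compact (closure (inv_into D A ` B)))"

definition eigenbasis ::
  "'a::real_inner set \<Rightarrow> ('a \<Rightarrow> 'a) \<Rightarrow> (nat \<Rightarrow> real) \<Rightarrow> (nat \<Rightarrow> 'a) \<Rightarrow> bool" where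
  "eigenbasis D A lam e \<longleftrightarrow>
     (\<forall>n\<ge>1. e n \<in> D \<and> A (e n) = lam n *\<^sub>R e n) \<and>
     mono_on {1..} lam \<and>
     (\<forall>m\<ge>1. \<forall>n\<ge>1. e m \<bullet> e n = (if m = n then 1 else 0)) \<and>
     closure (span (e ` {1..})) = UNIV"

definition spectral_setting ::
  "'a::real_inner set \<Rightarrow> ('a \<Rightarrow> 'a) \<Rightarrow> (nat \<Rightarrow> real) \<Rightarrow> (nat \<Rightarrow> 'a) \<Rightarrow> bool" where
  "spectral_setting D A lam e \<longleftrightarrow>
     self_adjoint_op D A \<and> positive_op D A \<and> has_compact_inverse D A \<and> eigenbasis D A lam e"

definition spectral_proj :: "(nat \<Rightarrow> 'a::real_inner) \<Rightarrow> nat \<Rightarrow> 'a \<Rightarrow> 'a" where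
  "spectral_proj e N u = (\<Sum>n=1..N. (u \<bullet> e n) *\<^sub>R e n)"

text \<open>
  The scale \<open>H\<^sup>s\<close>.  For \<open>s < 0\<close> the space is a completion of \<open>H\<close>; only its norm on
  elements of \<open>H\<close> is needed, and there the series converges.
\<close>

definition Hs_norm :: "(nat \<Rightarrow> real) \<Rightarrow> (nat \<Rightarrow> 'a::real_inner) \<Rightarrow> real \<Rightarrow> 'a \<Rightarrow> real" where
  "Hs_norm lam e s u = sqrt (\<Sum>n. lam (Suc n) powr s * (u \<bullet> e (Suc n))\<^sup>2)"

definition Hs_space :: "(nat \<Rightarrow> real) \<Rightarrow> (nat \<Rightarrow> 'a::real_inner) \<Rightarrow> real \<Rightarrow> 'a set" where
  "Hs_space lam e s = {u. summable (\<lambda>n. lam (Suc n) powr s * (u \<bullet> e (Suc n))\<^sup>2)}"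

definition energy_space :: "(nat \<Rightarrow> real) \<Rightarrow> (nat \<Rightarrow> 'a::real_inner) \<Rightarrow> ('a \<times> 'a) set" where
  "energy_space lam e = Hs_space lam e 1 \<times> UNIV"

definition energy_norm ::
  "(nat \<Rightarrow> real) \<Rightarrow> (nat \<Rightarrow> 'a::real_inner) \<Rightarrow> real \<Rightarrow> 'a \<times> 'a \<Rightarrow> real" where
  "energy_norm lam e eps w =
     sqrt (eps * (norm (snd w))\<^sup>2 + (Hs_norm lam e (-1) (snd w))\<^sup>2 + (Hs_norm lam e 1 (fst w))\<^sup>2)"

text \<open>
  Finiteness of the norm of \<open>L\<^sup>2\<close> over \<open>{..0}\<close> with weight \<open>exp (theta * t)\<close>.  It is only
  applied to functions continuous on \<open>{..0}\<close>, so no separate measurability clause is needed.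
\<close>

definition in_weighted_L2 :: "real \<Rightarrow> (real \<Rightarrow> 'a::real_normed_vector) \<Rightarrow> bool" where
  "in_weighted_L2 theta u \<longleftrightarrow>
     set_integrable lborel {..0} (\<lambda>t. exp (2 * theta * t) * (norm (u t))\<^sup>2)"

definition hat_proj ::
  "(nat \<Rightarrow> real) \<Rightarrow> (nat \<Rightarrow> 'a::real_inner) \<Rightarrow> nat \<Rightarrow> real \<Rightarrow> 'a \<Rightarrow> 'a" where
  "hat_proj lam e N eps u =
     (\<Sum>n=1..N. (eps / sqrt (1 - 4 * eps * lam n) * (u \<bullet> e n)) *\<^sub>R e n)"

definition cal_proj ::
  "(nat \<Rightarrow> real) \<Rightarrow> (nat \<Rightarrow> 'a::real_inner) \<Rightarrow> nat \<Rightarrow> real \<Rightarrow> 'a \<Rightarrow> 'a" where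
  "cal_proj lam e N eps u =
     (\<Sum>n=1..N. ((1 + sqrt (1 - 4 * eps * lam n)) / (2 * sqrt (1 - 4 * eps * lam n)) * (u \<bullet> e n)) *\<^sub>R e n)"

definition theta_eps :: "(nat \<Rightarrow> real) \<Rightarrow> nat \<Rightarrow> real \<Rightarrow> real" where
  "theta_eps lam N eps =
     (LEAST theta. 2 * theta * (eps * theta - 1) + lam (N + 1) + lam N = 0)"

definition theta_zero :: "(nat \<Rightarrow> real) \<Rightarrow> nat \<Rightarrow> real" where
  "theta_zero lam N = (lam (N + 1) + lam N) / 2"

text \<open>
  Solutions of the damped wave equation on \<open>{..0}\<close> in the energy class: \<open>(u, v)\<close> with
  \<open>v\<close> the time derivative of \<open>u\<close> is continuous with values in \<open>H\<^sup>1 \<times> H\<close>.  The equation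
  holds weakly, i.e. tested with every \<open>\<phi>\<close> in the domain of \<open>A\<close>, where by self-adjointness
  \<open>A\<close> is moved to \<open>\<phi>\<close>.  Functions on the half-line are represented by members of
  \<open>extensional {..0}\<close>, so that uniqueness is uniqueness on \<open>{..0}\<close>.
\<close>

definition solves_hyperbolic ::
  "'a::real_inner set \<Rightarrow> ('a \<Rightarrow> 'a) \<Rightarrow> (nat \<Rightarrow> real) \<Rightarrow> (nat \<Rightarrow> 'a) \<Rightarrow> ('a \<Rightarrow> 'a) \<Rightarrow> nat \<Rightarrow>
   real \<Rightarrow> 'a \<Rightarrow> (real \<Rightarrow> 'a) \<Rightarrow> bool" where
  "solves_hyperbolic D A lam e F N eps p u \<longleftrightarrow>
     u \<in> extensional {..0} \<and>
     (\<exists>v. (\<forall>t\<le>0. u t \<in> Hs_space lam e 1 \<and>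
                 ((\<lambda>s. Hs_norm lam e 1 (u s - u t)) \<longlongrightarrow> 0) (at t within {..0})) \<and>
          continuous_on {..0} v \<and>
          (\<forall>t\<le>0. (u has_vector_derivative v t) (at t within {..0})) \<and>
          (\<forall>t\<le>0. \<forall>\<phi>\<in>D. ((\<lambda>s. eps * (v s \<bullet> \<phi>)) has_real_derivative
                            F (u t) \<bullet> \<phi> - v t \<bullet> \<phi> - u t \<bullet> A \<phi>) (at t within {..0})) \<and>
          hat_proj lam e N eps (v 0) + cal_proj lam e N eps (u 0) = p) \<and>
     in_weighted_L2 (theta_eps lam N eps) u"

definition U_eps ::
  "'a::real_inner set \<Rightarrow> ('a \<Rightarrow> 'a) \<Rightarrow> (nat \<Rightarrow> real) \<Rightarrow> (nat \<Rightarrow> 'a) \<Rightarrow> ('a \<Rightarrow> 'a) \<Rightarrow> nat \<Rightarrow>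
   real \<Rightarrow> 'a \<Rightarrow> real \<Rightarrow> 'a" where
  "U_eps D A lam e F N eps p = (THE u. solves_hyperbolic D A lam e F N eps p u)"

definition M_eps ::
  "'a::real_inner set \<Rightarrow> ('a \<Rightarrow> 'a) \<Rightarrow> (nat \<Rightarrow> real) \<Rightarrow> (nat \<Rightarrow> 'a) \<Rightarrow> ('a \<Rightarrow> 'a) \<Rightarrow> nat \<Rightarrow>
   real \<Rightarrow> 'a \<Rightarrow> 'a \<times> 'a" where
  "M_eps D A lam e F N eps p =
     (let u = U_eps D A lam e F N eps p
      in (u 0, vector_derivative u (at 0 within {..0})))"

definition solves_parabolic ::
  "'a::real_inner set \<Rightarrow> ('a \<Rightarrow> 'a) \<Rightarrow> (nat \<Rightarrow> real) \<Rightarrow> (nat \<Rightarrow> 'a) \<Rightarrow> ('a \<Rightarrow> 'a) \<Rightarrow> nat \<Rightarrow>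
   'a \<Rightarrow> (real \<Rightarrow> 'a) \<Rightarrow> bool" where
  "solves_parabolic D A lam e F N p u \<longleftrightarrow>
     u \<in> extensional {..0} \<and>
     (\<forall>t\<le>0. u t \<in> D \<and>
            (u has_vector_derivative F (u t) - A (u t)) (at t within {..0})) \<and>
     spectral_proj e N (u 0) = p \<and>
     in_weighted_L2 (theta_zero lam N) u"

definition U_zero ::
  "'a::real_inner set \<Rightarrow> ('a \<Rightarrow> 'a) \<Rightarrow> (nat \<Rightarrow> real) \<Rightarrow> (nat \<Rightarrow> 'a) \<Rightarrow> ('a \<Rightarrow> 'a) \<Rightarrow> nat \<Rightarrow>
   'a \<Rightarrow> real \<Rightarrow> 'a" where
  "U_zero D A lam e F N p = (THE u. solves_parabolic D A lam e F N p u)"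

definition M_zero ::
  "'a::real_inner set \<Rightarrow> ('a \<Rightarrow> 'a) \<Rightarrow> (nat \<Rightarrow> real) \<Rightarrow> (nat \<Rightarrow> 'a) \<Rightarrow> ('a \<Rightarrow> 'a) \<Rightarrow> nat \<Rightarrow>
   'a \<Rightarrow> 'a \<times> 'a" where
  "M_zero D A lam e F N p =
     (let u = U_zero D A lam e F N p
      in (u 0, F (u 0) - A (u 0)))"

end

theory Submission
  imports Defs
begin

text \<open>
  Write \<open>\<mu> = (\<lambda>\<^sub>N + \<lambda>\<^bsub>N+1\<^esub>) / 2\<close>, \<open>\<delta> = (\<lambda>\<^bsub>N+1\<^esub> - \<lambda>\<^sub>N) / 2 > L\<close> and \<open>\<alpha> = 1 - 2\<epsilon>\<theta>\<close>.  In the weighted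
  variable \<open>y = e\<^bsup>\<theta>t\<^esup>u\<close> each eigenmode of the wave equation is the scalar problem
  \<open>\<epsilon>y'' + \<alpha>y' + (\<lambda>\<^sub>n - \<mu>)y = g\<close> on \<open>t \<le> 0\<close>, and for \<open>\<epsilon> = 0\<close> it is \<open>y' + (\<lambda>\<^sub>n - \<mu>)y = g\<close>.
  The whole argument rests on one sharp bound for these scalar problems: for the homogeneous
  boundary condition \<open>\<delta> \<parallel>y\<parallel> \<le> \<parallel>g\<parallel>\<close> in \<open>L\<^sup>2\<close> of the half-line (\<open>high_mode_L2\<close>, \<open>low_mode_L2\<close>,
  \<open>first_order_mode_L2\<close>).  For the high modes of the wave equation this is where
  \<open>3\<lambda>\<^bsub>N+1\<^esub> + \<lambda>\<^sub>N \<le> 1/\<epsilon>\<close>, that is \<open>2\<epsilon>\<delta> \<le> \<alpha>\<^sup>2\<close>, enters.  All such bounds are proved by integrating a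
  differential inequality \<open>\<Phi>' \<le> \<psi>\<close> over the half-line for a quadratic form \<open>\<Phi>\<close> in \<open>(y, y')\<close>
  (\<open>half_integral_ge_of_derivative_le\<close>).

  Since \<open>L < \<delta>\<close>, the bound makes the solution operator composed with the nonlinearity a contraction
  of \<open>L\<^sup>2(\<real>\<^sub>-, H)\<close>.  A Picard iteration (locale \<open>modal_problem\<close>) therefore gives existence and
  uniqueness for both problems, and the \<open>L\<^sup>2\<close> estimates do not depend on \<open>\<epsilon>\<close>.  Regularity is
  read off from the modes: coefficients whose tails are uniformly square summable define continuous
  functions (\<open>continuous_from_coefficients\<close>), and a function with the right coefficient derivatives
  is differentiable (\<open>vector_derivative_from_modes\<close>).

  For the comparison, let \<open>u\<close> and \<open>U\<close> be the solutions for \<open>\<epsilon>\<close> and \<open>0\<close>.  Formally \<open>U\<close> solves the wave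
  equation with the defect \<open>\<epsilon>U''\<close>, but \<open>U''\<close> need not exist because the nonlinearity is only Lipschitz.
  So \<open>U\<close> is replaced by its average \<open>z\<close> over \<open>[t - h, t]\<close>.  Then \<open>z'\<close> is the difference quotient \<open>q\<close> of
  \<open>U\<close>, which solves the parabolic equation with the difference quotient of \<open>F(U)\<close> as its right-hand side.
  That right-hand side is again bounded by \<open>L \<parallel>q\<parallel>\<close>, so the same contraction argument bounds \<open>q\<close>, and
  maximal regularity bounds \<open>z'' = q'\<close> in \<open>L\<^sup>2\<close>, uniformly in \<open>h\<close> (\<open>difference_quotient_bounds\<close>,
  \<open>r2_sum\<close>).  Now \<open>u - z\<close> solves the wave equation up to errors that are \<open>O(\<epsilon>)\<close> plus terms vanishing with
  \<open>h\<close>, both in the equation and in the boundary condition.  The contraction estimate transfers this size to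
  \<open>u - U\<close> in the weighted \<open>L\<^sup>2\<close> space (\<open>W_bound\<close>), the energy identity upgrades it to \<open>\<epsilon>\<^bsup>1/2\<^esup> \<parallel>u' - z'\<parallel>\<close> and the \<open>H\<^sup>1\<close> norm pointwise in time (\<open>energy_bound\<close>), and
  the equation \<open>\<epsilon>\<omega>' + \<omega> = f - A(u - z)\<close> for \<open>\<omega> = u' - z'\<close>, read in \<open>H\<^bsup>-1\<^esup>\<close>, bounds \<open>\<omega>(0)\<close> there
  (\<open>velocity_bound\<close>).  For fixed \<open>\<epsilon>\<close> the limit \<open>h \<rightarrow> 0\<close>, taken mode by mode, finishes the proof.
\<close>

section \<open>Functions on the half-line\<close>

abbreviation half_integrable :: "(real \<Rightarrow> 'b::{banach, second_countable_topology}) \<Rightarrow> bool" where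
  "half_integrable f \<equiv> set_integrable lborel {..0} f"

abbreviation half_integral :: "(real \<Rightarrow> 'b::{banach, second_countable_topology}) \<Rightarrow> 'b" where
  "half_integral f \<equiv> set_lebesgue_integral lborel {..0} f"

text \<open>
  Continuity is part of the notion.  It supplies measurability and makes values at single times
  meaningful.
\<close>

definition half_L2 :: "(real \<Rightarrow> 'b::real_normed_vector) \<Rightarrow> bool" where
  "half_L2 y \<longleftrightarrow> continuous_on {..0} y \<and> half_integrable (\<lambda>t. (norm (y t))\<^sup>2)"

abbreviation sqn :: "(real \<Rightarrow> 'b::real_normed_vector) \<Rightarrow> real" where
  "sqn y \<equiv> half_integral (\<lambda>t. (norm (y t))\<^sup>2)"

lemma half_integrable_bound:
  fixes f :: "real \<Rightarrow> 'b::{banach, second_countable_topology}" and g :: "real \<Rightarrow> real"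
  assumes "continuous_on {..0} f" "half_integrable g" "\<And>t. t \<le> 0 \<Longrightarrow> norm (f t) \<le> g t"
  shows "half_integrable f"
proof (rule set_integrable_bound[OF assms(2)])
  show "set_borel_measurable lborel {..0} f"
    unfolding set_borel_measurable_def
    using borel_measurable_continuous_on_indicator[OF _ assms(1)] by simp
  show "AE x in lborel. x \<in> {..0} \<longrightarrow> norm (f x) \<le> norm (g x)"
    using assms(3) by (intro AE_I2) (force intro: order_trans)
qed

lemma half_integral_mono:
  fixes f g :: "real \<Rightarrow> real"
  assumes "half_integrable f" "half_integrable g" "\<And>t. t \<le> 0 \<Longrightarrow> f t \<le> g t"
  shows "half_integral f \<le> half_integral g"
  using set_integral_mono[OF assms(1,2)] assms(3) by auto

lemma half_integral_nonneg:
  fixes f :: "real \<Rightarrow> real"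
  assumes "\<And>t. t \<le> 0 \<Longrightarrow> 0 \<le> f t"
  shows "0 \<le> half_integral f"
  unfolding set_lebesgue_integral_def
  by (rule integral_nonneg_AE) (use assms in \<open>auto simp: indicator_def\<close>)

lemma half_integrable_Icc:
  fixes f :: "real \<Rightarrow> real"
  assumes "half_integrable f" "b \<le> 0"
  shows "set_integrable lborel {a..b} f" "f integrable_on {a..b}"
    "set_lebesgue_integral lborel {a..b} f = integral {a..b} f"
proof -
  show *: "set_integrable lborel {a..b} f"
    by (rule set_integrable_subset[OF assms(1)]) (use assms(2) in auto)
  show "f integrable_on {a..b}" "set_lebesgue_integral lborel {a..b} f = integral {a..b} f"
    using set_borel_integral_eq_integral[OF *] by auto
qed

lemma half_integrable_not_bounded_below:
  fixes f :: "real \<Rightarrow> real"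
  assumes f: "half_integrable f" and c: "c > 0" and lb: "\<And>t. t \<le> T \<Longrightarrow> c \<le> f t"
  shows False
proof -
  define T0 where "T0 = min T 0"
  define I where "I = half_integral (\<lambda>t. \<bar>f t\<bar>)"
  have fa: "half_integrable (\<lambda>t. \<bar>f t\<bar>)" using f by (rule set_integrable_abs)
  have bound: "c * real n \<le> I" for n
  proof -
    have i: "set_integrable lborel {T0 - n..T0} (\<lambda>t. \<bar>f t\<bar>)"
      by (rule half_integrable_Icc[OF fa]) (simp add: T0_def)
    have "c * real n = integral {T0 - n..T0} (\<lambda>t. c)" by simp
    also have "\<dots> \<le> integral {T0 - n..T0} (\<lambda>t. \<bar>f t\<bar>)"
      by (rule integral_le) (use half_integrable_Icc[OF fa] lb in \<open>force simp: T0_def\<close>)+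
    also have "\<dots> = set_lebesgue_integral lborel {T0 - n..T0} (\<lambda>t. \<bar>f t\<bar>)"
      by (rule half_integrable_Icc(3)[OF fa, symmetric]) (simp add: T0_def)
    also have "\<dots> \<le> I"
      unfolding I_def set_lebesgue_integral_def
      by (rule integral_mono)
        (use i fa in \<open>auto simp: set_integrable_def indicator_def T0_def\<close>)
    finally show ?thesis .
  qed
  obtain n :: nat where "I / c < n" using reals_Archimedean2 by blast
  with bound[of n] c show False by (simp add: field_simps)
qed

text \<open>
  A nonnegative function dominated by the derivative of a function that is bounded below has integrals
  over \<open>[-n, 0]\<close> that stay bounded, so monotone convergence applies.
\<close>

lemma half_integral_le_of_derivative_ge:
  fixes \<psi> \<Phi> \<phi> :: "real \<Rightarrow> real"
  assumes D: "\<And>t. t \<le> 0 \<Longrightarrow> (\<Phi> has_real_derivative \<phi> t) (at t within {..0})"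
    and cont: "continuous_on {..0} \<psi>"
    and nn: "\<And>t. t \<le> 0 \<Longrightarrow> 0 \<le> \<psi> t" and le: "\<And>t. t \<le> 0 \<Longrightarrow> \<psi> t \<le> \<phi> t"
    and bd: "\<And>t. t \<le> 0 \<Longrightarrow> - B \<le> \<Phi> t"
  shows "half_integrable \<psi>" "half_integral \<psi> \<le> \<Phi> 0 + B"
proof -
  define h where "h n t = indicator {- real n..0} t * \<psi> t" for n t
  define J where "J n = integral\<^sup>L lborel (h n)" for n
  have si: "set_integrable lborel {- real n..0} \<psi>" for n
    by (rule borel_integrable_atLeastAtMost') (use cont in \<open>auto intro: continuous_on_subset\<close>)
  have ih: "integrable lborel (h n)" for n
    using si[of n] unfolding set_integrable_def h_def by simp
  have Jle: "J n \<le> \<Phi> 0 + B" for n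
  proof -
    have fi: "(\<phi> has_integral (\<Phi> 0 - \<Phi> (- real n))) {- real n..0}"
      by (rule fundamental_theorem_of_calculus)
        (auto simp: has_real_derivative_iff_has_vector_derivative[symmetric]
          intro!: DERIV_subset[OF D])
    have "J n = set_lebesgue_integral lborel {- real n..0} \<psi>"
      unfolding J_def h_def set_lebesgue_integral_def by simp
    also have "\<dots> = integral {- real n..0} \<psi>"
      by (rule set_borel_integral_eq_integral[OF si])
    also have "\<dots> \<le> \<Phi> 0 - \<Phi> (- real n)"
      by (rule has_integral_le[OF integrable_integral fi])
        (use set_borel_integral_eq_integral[OF si] le in auto)
    also have "\<dots> \<le> \<Phi> 0 + B" using bd[of "- real n"] by simp
    finally show ?thesis .
  qed
  have inc: "incseq (\<lambda>n. h n t)" for t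
    by (rule incseq_SucI) (use nn in \<open>auto simp: h_def indicator_def\<close>)
  have lim: "(\<lambda>n. h n t) \<longlonglongrightarrow> indicator {..0} t * \<psi> t" for t
  proof -
    obtain k :: nat where "- t \<le> k" using real_arch_simple by blast
    hence "eventually (\<lambda>n. h n t = indicator {..0} t * \<psi> t) sequentially"
      by (intro eventually_sequentiallyI[of k]) (auto simp: h_def indicator_def)
    thus ?thesis by (rule tendsto_eventually)
  qed
  have "incseq J"
    unfolding incseq_def J_def
    by (intro allI impI integral_mono ih) (use inc in \<open>auto simp: incseq_def\<close>)
  then obtain l where l: "J \<longlonglongrightarrow> l" 
    using incseq_convergent[of J "\<Phi> 0 + B"] Jle by metis
  have m: "(\<lambda>t. indicator {..0} t * \<psi> t) \<in> borel_measurable lborel"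
    using borel_measurable_continuous_on_indicator[OF _ cont] by simp
  have hb: "has_bochner_integral lborel (\<lambda>t. indicator {..0} t * \<psi> t) l"
    by (rule has_bochner_integral_monotone_convergence[where f = h])
      (use ih inc lim m l[unfolded J_def] in auto)
  show "half_integrable \<psi>"
    using hb unfolding set_integrable_def has_bochner_integral_iff by simp
  have "half_integral \<psi> = l"
    using hb unfolding set_lebesgue_integral_def has_bochner_integral_iff by simp
  also have "\<dots> \<le> \<Phi> 0 + B" using LIMSEQ_le_const2[OF l] Jle by blast
  finally show "half_integral \<psi> \<le> \<Phi> 0 + B" .
qed

text \<open>
  The energy principle behind all a priori estimates.  If \<open>\<Phi> 0 > \<integral>\<psi>\<close>, then integration over \<open>[t, 0]\<close>
  shows that \<open>\<Phi>\<close> stays above a positive constant near \<open>-\<infinity>\<close>, which contradicts its integrability.  No decay of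
  \<open>\<Phi>\<close> at \<open>-\<infinity>\<close> has to be known beforehand.
\<close>

lemma half_integral_ge_of_derivative_le:
  fixes \<psi> \<Phi> \<phi> :: "real \<Rightarrow> real"
  assumes D: "\<And>t. t \<le> 0 \<Longrightarrow> (\<Phi> has_real_derivative \<phi> t) (at t within {..0})"
    and \<Phi>: "half_integrable \<Phi>" and \<psi>: "half_integrable \<psi>"
    and le: "\<And>t. t \<le> 0 \<Longrightarrow> \<phi> t \<le> \<psi> t"
  shows "\<Phi> 0 \<le> half_integral \<psi>"
proof (rule ccontr)
  assume neg: "\<not> ?thesis"
  define l where "l = \<Phi> 0 - half_integral \<psi>"
  have l: "l > 0" using neg by (simp add: l_def)
  have "((\<lambda>a. set_lebesgue_integral lborel {a..0} \<psi>) \<longlongrightarrow> half_integral \<psi>) at_bot"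
    by (rule tendsto_set_lebesgue_integral_at_bot) (use \<psi> in auto)
  hence "eventually (\<lambda>a. set_lebesgue_integral lborel {a..0} \<psi> < half_integral \<psi> + l / 2) at_bot"
    by (rule order_tendstoD) (use l in auto)
  then obtain T where T: "\<And>a. a \<le> T \<Longrightarrow> set_lebesgue_integral lborel {a..0} \<psi> < half_integral \<psi> + l / 2"
    unfolding eventually_at_bot_linorder by blast
  have "l / 2 \<le> \<Phi> t" if "t \<le> min T 0" for t
  proof -
    have fi: "(\<phi> has_integral (\<Phi> 0 - \<Phi> t)) {t..0}"
      by (rule fundamental_theorem_of_calculus)
        (use that in \<open>auto simp: has_real_derivative_iff_has_vector_derivative[symmetric]
          intro!: DERIV_subset[OF D]\<close>)
    have "\<Phi> 0 - \<Phi> t \<le> integral {t..0} \<psi>"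
      by (rule has_integral_le[OF fi integrable_integral])
        (use half_integrable_Icc[OF \<psi>] le in auto)
    also have "\<dots> = set_lebesgue_integral lborel {t..0} \<psi>"
      using half_integrable_Icc(3)[OF \<psi>] by simp
    also have "\<dots> < half_integral \<psi> + l / 2" using T that by simp
    finally show ?thesis by (simp add: l_def field_simps)
  qed
  thus False using half_integrable_not_bounded_below[OF \<Phi>, of "l / 2" "min T 0"] l by auto
qed

lemma half_L2_cont: "half_L2 y \<Longrightarrow> continuous_on {..0} y"
  and half_L2_int: "half_L2 y \<Longrightarrow> half_integrable (\<lambda>t. (norm (y t))\<^sup>2)"
  by (simp_all add: half_L2_def)

lemma half_L2_bound:
  fixes y :: "real \<Rightarrow> 'b::real_normed_vector"
  assumes "continuous_on {..0} y" "half_integrable g" "\<And>t. t \<le> 0 \<Longrightarrow> (norm (y t))\<^sup>2 \<le> g t"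
  shows "half_L2 y" "sqn y \<le> half_integral g"
proof -
  have *: "half_integrable (\<lambda>t. (norm (y t))\<^sup>2)"
    by (rule half_integrable_bound[OF _ assms(2)]) (use assms in \<open>auto intro!: continuous_intros\<close>)
  show "half_L2 y" using assms(1) * by (simp add: half_L2_def)
  show "sqn y \<le> half_integral g" by (rule half_integral_mono[OF * assms(2)]) (use assms(3) in auto)
qed

lemma half_L2_cong:
  assumes y: "half_L2 y" and eq: "\<And>t. t \<le> 0 \<Longrightarrow> y t = y' t"
  shows "half_L2 y'"
proof (rule half_L2_bound(1)[OF _ half_L2_int[OF y]])
  show "continuous_on {..0} y'" by (rule continuous_on_eq[OF half_L2_cont[OF y]]) (simp add: eq)
qed (simp add: eq)

lemma half_L2_scale:
  fixes y :: "real \<Rightarrow> 'b::real_normed_vector"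
  assumes "half_L2 y" shows "half_L2 (\<lambda>t. c *\<^sub>R y t)" "sqn (\<lambda>t. c *\<^sub>R y t) = c\<^sup>2 * sqn y"
  using assms by (auto simp: half_L2_def power_mult_distrib intro!: continuous_intros)

lemma norm_add_sq_le_weighted:
  assumes \<eta>: "\<eta> > 0"
  shows "(norm (x + y :: 'b::real_normed_vector))\<^sup>2 \<le> (1 + \<eta>) * (norm x)\<^sup>2 + (1 + 1 / \<eta>) * (norm y)\<^sup>2"
proof -
  have "(norm (x + y))\<^sup>2 \<le> (norm x + norm y)\<^sup>2" by (simp add: norm_triangle_ineq power_mono)
  also have "(norm x + norm y)\<^sup>2 = (1 + \<eta>) * (norm x)\<^sup>2 + (1 + 1 / \<eta>) * (norm y)\<^sup>2 - (\<eta> * norm x - norm y)\<^sup>2 / \<eta>"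
    using \<eta> by (simp add: power2_eq_square field_simps)
  also have "\<dots> \<le> (1 + \<eta>) * (norm x)\<^sup>2 + (1 + 1 / \<eta>) * (norm y)\<^sup>2" using \<eta> by simp
  finally show ?thesis .
qed

lemma norm_add_sq_le: "(norm (x + y :: 'b::real_normed_vector))\<^sup>2 \<le> 2 * (norm x)\<^sup>2 + 2 * (norm y)\<^sup>2"
  using norm_add_sq_le_weighted[of 1 x y] by simp

lemma two_squares: "(a + b)\<^sup>2 \<le> 2 * a\<^sup>2 + 2 * (b::real)\<^sup>2"
  using norm_add_sq_le[of a b] by simp

lemma three_squares: "(a + b + c)\<^sup>2 \<le> 3 * (a\<^sup>2 + b\<^sup>2 + (c::real)\<^sup>2)"
proof -
  have "3 * (a\<^sup>2 + b\<^sup>2 + c\<^sup>2) - (a + b + c)\<^sup>2 = (a - b)\<^sup>2 + (a - c)\<^sup>2 + (b - c)\<^sup>2"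
    by (simp add: power2_eq_square algebra_simps)
  moreover have "0 \<le> (a - b)\<^sup>2 + (a - c)\<^sup>2 + (b - c)\<^sup>2" by simp
  ultimately show ?thesis by linarith
qed

lemma half_L2_add:
  fixes x y :: "real \<Rightarrow> 'b::real_normed_vector"
  assumes "half_L2 x" "half_L2 y"
  shows "half_L2 (\<lambda>t. x t + y t)" "sqn (\<lambda>t. x t + y t) \<le> 2 * sqn x + 2 * sqn y"
proof -
  have i: "half_integrable (\<lambda>t. 2 * (norm (x t))\<^sup>2 + 2 * (norm (y t))\<^sup>2)"
    using assms by (intro set_integral_add) (auto simp: half_L2_def)
  have c: "continuous_on {..0} (\<lambda>t. x t + y t)"
    using assms by (intro continuous_intros) (auto simp: half_L2_def)
  show "half_L2 (\<lambda>t. x t + y t)"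
    by (rule half_L2_bound[OF c i]) (rule norm_add_sq_le)
  have "sqn (\<lambda>t. x t + y t) \<le> half_integral (\<lambda>t. 2 * (norm (x t))\<^sup>2 + 2 * (norm (y t))\<^sup>2)"
    by (rule half_L2_bound[OF c i]) (rule norm_add_sq_le)
  also have "\<dots> = 2 * sqn x + 2 * sqn y"
    using assms by (subst set_integral_add) (auto simp: half_L2_def)
  finally show "sqn (\<lambda>t. x t + y t) \<le> 2 * sqn x + 2 * sqn y" .
qed

lemma half_L2_diff:
  fixes x y :: "real \<Rightarrow> 'b::real_normed_vector"
  assumes "half_L2 x" "half_L2 y"
  shows "half_L2 (\<lambda>t. x t - y t)"
  using half_L2_add(1)[OF assms(1) half_L2_scale(1)[OF assms(2), of "-1"]] by simp

lemma half_L2_mult: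
  fixes x y :: "real \<Rightarrow> real"
  assumes "half_L2 x" "half_L2 y"
  shows "half_integrable (\<lambda>t. x t * y t)"
proof (rule half_integrable_bound)
  show "continuous_on {..0} (\<lambda>t. x t * y t)"
    using assms by (intro continuous_intros) (auto simp: half_L2_def)
  show "half_integrable (\<lambda>t. (x t)\<^sup>2 + (y t)\<^sup>2)"
    using assms by (intro set_integral_add) (auto simp: half_L2_def)
  show "norm (x t * y t) \<le> (x t)\<^sup>2 + (y t)\<^sup>2" for t
  proof -
    have "2 * \<bar>x t\<bar> * \<bar>y t\<bar> \<le> (x t)\<^sup>2 + (y t)\<^sup>2"
      using zero_le_power2[of "\<bar>x t\<bar> - \<bar>y t\<bar>"] by (simp add: power2_eq_square algebra_simps)
    moreover have "0 \<le> \<bar>x t\<bar> * \<bar>y t\<bar>" by simp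
    ultimately show ?thesis unfolding real_norm_def abs_mult by linarith
  qed
qed

lemma half_L2_sq: fixes y :: "real \<Rightarrow> real" shows "half_L2 y \<Longrightarrow> half_integrable (\<lambda>t. (y t)\<^sup>2)"
  by (simp add: half_L2_def)

lemma half_L2_shift:
  fixes y :: "real \<Rightarrow> 'b::real_normed_vector"
  assumes y: "half_L2 y" and a: "a \<le> 0"
  shows "half_L2 (\<lambda>t. y (t + a))" "sqn (\<lambda>t. y (t + a)) \<le> sqn y"
proof -
  have c: "continuous_on {..0} (\<lambda>t. y (t + a))"
    by (rule continuous_on_compose2[OF half_L2_cont[OF y]]) (use a in \<open>auto intro!: continuous_intros\<close>)
  have i: "integrable lborel (\<lambda>t. indicator {..0} t *\<^sub>R (norm (y t))\<^sup>2)"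
    using half_L2_int[OF y] by (simp add: set_integrable_def)
  have ia: "integrable lborel (\<lambda>t. indicator {..a} t *\<^sub>R (norm (y t))\<^sup>2)"
    using set_integrable_subset[OF half_L2_int[OF y], of "{..a}"] a by (simp add: set_integrable_def)
  have eq: "(\<lambda>t. indicator {..a} (a + 1 * t) *\<^sub>R (norm (y (a + 1 * t)))\<^sup>2)
     = (\<lambda>t. indicator {..0} t *\<^sub>R (norm (y (t + a)))\<^sup>2)"
    by (auto simp: indicator_def add.commute)
  have "integrable lborel (\<lambda>t. indicator {..0} t *\<^sub>R (norm (y (t + a)))\<^sup>2)"
    using lborel_integrable_real_affine[OF ia, of 1 a] unfolding eq by simp
  thus "half_L2 (\<lambda>t. y (t + a))" using c by (simp add: half_L2_def set_integrable_def)
  have "sqn (\<lambda>t. y (t + a)) = (LINT t|lborel. indicator {..a} t *\<^sub>R (norm (y t))\<^sup>2)"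
    using lborel_integral_real_affine[of 1 "\<lambda>t. indicator {..a} t *\<^sub>R (norm (y t))\<^sup>2" a]
    unfolding eq by (simp add: set_lebesgue_integral_def)
  also have "\<dots> \<le> sqn y"
    unfolding set_lebesgue_integral_def by (rule integral_mono[OF ia i]) (use a in \<open>auto simp: indicator_def\<close>)
  finally show "sqn (\<lambda>t. y (t + a)) \<le> sqn y" .
qed

lemma half_derivative_cong:
  fixes f g :: "real \<Rightarrow> real"
  assumes "(f has_real_derivative f') (at t within {..0})" "t \<le> 0" "\<And>r. r \<le> 0 \<Longrightarrow> f r = g r"
  shows "(g has_real_derivative f') (at t within {..0})"
  by (rule has_field_derivative_transform_within[OF assms(1), of 1]) (use assms in auto)

lemma has_real_derivative_shift:
  fixes y :: "real \<Rightarrow> real"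
  assumes D: "\<And>t. t \<le> 0 \<Longrightarrow> (y has_real_derivative x t) (at t within {..0})" and a: "a \<le> 0" "t \<le> 0"
  shows "((\<lambda>t. y (t + a)) has_real_derivative x (t + a)) (at t within {..0})"
proof -
  have "(y has_real_derivative x (t + a)) (at (t + a) within (\<lambda>t. t + a) ` {..0})"
    by (rule DERIV_subset[OF D]) (use a in auto)
  moreover have "((\<lambda>t. t + a) has_real_derivative 1) (at t within {..0})"
    by (auto intro!: derivative_eq_intros)
  ultimately show ?thesis
    using DERIV_image_chain[of y "x (t + a)" "\<lambda>t. t + a" t "{..0}" 1] by (simp add: o_def)
qed

text \<open>
  The one-dimensional Sobolev inequality, from \<open>(y\<^sup>2)' = 2yy' \<le> y\<^sup>2 + y'\<^sup>2\<close>.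
\<close>

lemma sq_le_sqn_derivative:
  fixes y x :: "real \<Rightarrow> real"
  assumes D: "\<And>t. t \<le> 0 \<Longrightarrow> (y has_real_derivative x t) (at t within {..0})"
    and y: "half_L2 y" and x: "half_L2 x" and t: "t \<le> 0"
  shows "(y t)\<^sup>2 \<le> sqn y + sqn x"
proof -
  define Y X where "Y s = y (s + t)" and "X s = x (s + t)" for s
  have DY: "(Y has_real_derivative X s) (at s within {..0})" if "s \<le> 0" for s
    unfolding Y_def X_def by (rule has_real_derivative_shift[OF D t that])
  have L: "half_L2 Y" "half_L2 X" unfolding Y_def X_def by (intro half_L2_shift y x t)+
  have "(Y 0)\<^sup>2 \<le> half_integral (\<lambda>s. (Y s)\<^sup>2 + (X s)\<^sup>2)"
  proof (rule half_integral_ge_of_derivative_le)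
    show "((\<lambda>s. (Y s)\<^sup>2) has_real_derivative 2 * Y s * X s) (at s within {..0})" if "s \<le> 0" for s
      by (auto intro!: derivative_eq_intros DY that)
    show "half_integrable (\<lambda>s. (Y s)\<^sup>2)" using L by (simp add: half_L2_sq)
    show "half_integrable (\<lambda>s. (Y s)\<^sup>2 + (X s)\<^sup>2)" using L by (intro set_integral_add half_L2_sq)
    show "2 * Y s * X s \<le> (Y s)\<^sup>2 + (X s)\<^sup>2" for s
      using zero_le_power2[of "Y s - X s"] by (simp add: power2_eq_square algebra_simps)
  qed
  also have "\<dots> = sqn Y + sqn X" using L by (subst set_integral_add) (auto simp: half_L2_sq)
  also have "\<dots> \<le> sqn y + sqn x"
    unfolding Y_def X_def using half_L2_shift(2)[OF y t] half_L2_shift(2)[OF x t] by simp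
  finally show ?thesis by (simp add: Y_def)
qed

lemma left_quotient_limit:
  fixes f :: "real \<Rightarrow> real"
  assumes f: "(f has_real_derivative f') (at t within {..0})" and t: "t \<le> 0"
  shows "(\<lambda>j. (f t - f (t - inverse (real (Suc j)))) / inverse (real (Suc j))) \<longlonglongrightarrow> f'"
proof -
  define h where "h j = t - inverse (real (Suc j))" for j
  have "filterlim h (at t within {..0}) sequentially"
    unfolding filterlim_at
  proof
    show "\<forall>\<^sub>F j in sequentially. h j \<in> {..0} \<and> h j \<noteq> t"
      using t by (intro always_eventually) (auto simp: h_def intro: order_trans)
    have "h \<longlonglongrightarrow> t - 0" unfolding h_def[abs_def] by (intro tendsto_intros LIMSEQ_inverse_real_of_nat)
    thus "h \<longlonglongrightarrow> t" by simp
  qed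
  moreover have "((\<lambda>r. (f r - f t) / (r - t)) \<longlongrightarrow> f') (at t within {..0})"
    using f by (simp add: has_field_derivative_iff)
  ultimately have "(\<lambda>j. (f (h j) - f t) / (h j - t)) \<longlonglongrightarrow> f'"
    by (rule filterlim_compose[rotated])
  moreover have "(f (h j) - f t) / (h j - t) = (f t - f (t - inverse (real (Suc j)))) / inverse (real (Suc j))" for j
  proof -
    have "h j - t = - inverse (real (Suc j))" by (simp add: h_def)
    hence "(f (h j) - f t) / (h j - t) = - (f t - f (h j)) / - inverse (real (Suc j))"
      by (simp only: minus_diff_eq)
    thus ?thesis by (simp only: minus_divide_divide h_def)
  qed
  ultimately show ?thesis by simp
qed

lemma half_mono:
  fixes \<Phi> \<phi> :: "real \<Rightarrow> real"
  assumes D: "\<And>t. t \<le> T \<Longrightarrow> (\<Phi> has_real_derivative \<phi> t) (at t within {..0})"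
    and nn: "\<And>t. t \<le> T \<Longrightarrow> 0 \<le> \<phi> t" and st: "s \<le> t" "t \<le> T" "T \<le> 0"
  shows "\<Phi> s \<le> \<Phi> t"
proof -
  have "(\<phi> has_integral (\<Phi> t - \<Phi> s)) {s..t}"
    by (rule fundamental_theorem_of_calculus)
      (use st in \<open>auto simp: has_real_derivative_iff_has_vector_derivative[symmetric]
          intro!: DERIV_subset[OF D]\<close>)
  hence "0 \<le> \<Phi> t - \<Phi> s" by (rule has_integral_nonneg) (use nn st in auto)
  thus ?thesis by simp
qed

lemma antiderivative_half:
  fixes c :: "real \<Rightarrow> 'b::banach"
  assumes c: "continuous_on {..0} c"
  obtains C where "C = (\<lambda>t. - integral {t..0} c)" "C 0 = 0"
    "\<And>t. t \<le> 0 \<Longrightarrow> (C has_vector_derivative c t) (at t within {..0})"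
proof
  let ?C = "\<lambda>t. - integral {t..0} c"
  show "?C = ?C" "?C 0 = 0" by simp_all
  show "(?C has_vector_derivative c t) (at t within {..0})" if t: "t \<le> 0" for t
  proof -
    define a where "a = t - 1"
    have ci: "continuous_on {a..0} c" using c by (auto intro: continuous_on_subset)
    have int: "c integrable_on {a..0}" by (rule integrable_continuous_interval[OF ci])
    have "((\<lambda>u. integral {a..u} c) has_vector_derivative c t) (at t within {a..0})"
      by (rule integral_has_vector_derivative[OF ci]) (use t in \<open>simp add: a_def\<close>)
    hence "((\<lambda>u. integral {a..u} c - integral {a..0} c) has_vector_derivative c t) (at t within {a..0})"
      by (auto intro!: derivative_eq_intros)
    hence "(?C has_vector_derivative c t) (at t within {a..0})"
    proof (rule has_vector_derivative_transform[rotated 2])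
      show "t \<in> {a..0}" using t by (simp add: a_def)
      show "?C x = integral {a..x} c - integral {a..0} c" if "x \<in> {a..0}" for x
      proof -
        have "integral {a..x} c + integral {x..0} c = integral {a..0} c"
          by (rule Henstock_Kurzweil_Integration.integral_combine) (use that int in auto)
        thus ?thesis by (simp add: algebra_simps add_eq_0_iff)
      qed
    qed
    moreover have "at t within {..0} = at t within {a..0}"
      by (rule at_within_nhd[of t "{a<..<1}"]) (use t in \<open>auto simp: a_def\<close>)
    ultimately show ?thesis by simp
  qed
qed

lemma integral_Icc_le_half_integral:
  fixes f :: "real \<Rightarrow> real"
  assumes f: "half_integrable f" and nn: "\<And>t. t \<le> 0 \<Longrightarrow> 0 \<le> f t" and b: "b \<le> 0"
  shows "integral {a..b} f \<le> half_integral f"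
proof -
  have "integral {a..b} f = set_lebesgue_integral lborel {a..b} f"
    by (rule half_integrable_Icc(3)[OF f b, symmetric])
  also have "\<dots> \<le> half_integral f"
    unfolding set_lebesgue_integral_def
    by (rule integral_mono)
      (use half_integrable_Icc(1)[OF f b, of a] f nn b in \<open>auto simp: set_integrable_def indicator_def\<close>)
  finally show ?thesis .
qed

lemma continuous_on_half_of_deriv:
  fixes y :: "real \<Rightarrow> real"
  assumes "\<And>t. t \<le> 0 \<Longrightarrow> (y has_real_derivative x t) (at t within {..0})"
  shows "continuous_on {..0} y"
  using assms by (auto simp: continuous_on_eq_continuous_within intro: DERIV_continuous)

text \<open>
  The bound on \<open>\<xi>\<close> near \<open>-\<infinity>\<close> takes the place of an initial condition: \<open>e\<^bsup>at/eps\<^esup>(\<xi> - \<Gamma>/a)\<close> is decreasing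
  in \<open>t\<close> and its upper bound tends to \<open>0\<close> at \<open>-\<infinity>\<close>.
\<close>

lemma decay_comparison:
  fixes \<xi> \<xi>' :: "real \<Rightarrow> real"
  assumes D: "\<And>t. t \<le> 0 \<Longrightarrow> (\<xi> has_real_derivative \<xi>' t) (at t within {..0})"
    and le: "\<And>t. t \<le> 0 \<Longrightarrow> eps * \<xi>' t \<le> \<Gamma> - a * \<xi> t" and bd: "\<And>t. t \<le> 0 \<Longrightarrow> \<xi> t \<le> M"
    and eps: "0 < eps" and a: "0 < a"
  shows "\<xi> 0 \<le> \<Gamma> / a"
proof -
  define k where "k = a / eps"
  have k: "0 < k" using eps a by (simp add: k_def)
  define \<psi> where "\<psi> t = - (exp (k * t) * (\<xi> t - \<Gamma> / a))" for t
  have D\<psi>: "(\<psi> has_real_derivative - (exp (k * t) * (k * (\<xi> t - \<Gamma> / a) + \<xi>' t))) (at t within {..0})" if "t \<le> 0" for t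
    unfolding \<psi>_def using a by (auto intro!: derivative_eq_intros D that simp: algebra_simps)
  have nn: "0 \<le> - (exp (k * t) * (k * (\<xi> t - \<Gamma> / a) + \<xi>' t))" if "t \<le> 0" for t
  proof -
    have "eps * (k * (\<xi> t - \<Gamma> / a) + \<xi>' t) = a * \<xi> t - \<Gamma> + eps * \<xi>' t"
      using eps a by (simp add: k_def field_simps)
    also have "\<dots> \<le> 0" using le[OF that] by simp
    finally have "k * (\<xi> t - \<Gamma> / a) + \<xi>' t \<le> 0" using eps by (simp add: mult_le_0_iff)
    thus ?thesis by (simp add: mult_nonneg_nonpos)
  qed
  have "\<xi> 0 - \<Gamma> / a \<le> exp (k * t) * \<bar>M - \<Gamma> / a\<bar>" if t: "t \<le> 0" for t
  proof -
    have "\<psi> t \<le> \<psi> 0" by (rule half_mono[where T = 0, OF D\<psi> nn t]) auto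
    hence "\<xi> 0 - \<Gamma> / a \<le> exp (k * t) * (\<xi> t - \<Gamma> / a)" by (simp add: \<psi>_def)
    also have "\<dots> \<le> exp (k * t) * \<bar>M - \<Gamma> / a\<bar>" using bd[OF t] by (intro mult_left_mono) auto
    finally show ?thesis .
  qed
  moreover have "((\<lambda>t. exp (k * t) * \<bar>M - \<Gamma> / a\<bar>) \<longlongrightarrow> 0 * \<bar>M - \<Gamma> / a\<bar>) at_bot"
  proof (intro tendsto_mult tendsto_const)
    show "((\<lambda>t. exp (k * t)) \<longlongrightarrow> 0) at_bot"
      by (rule filterlim_compose[OF exp_at_bot filterlim_tendsto_pos_mult_at_bot[OF tendsto_const k filterlim_ident]])
  qed
  ultimately have "\<xi> 0 - \<Gamma> / a \<le> 0 * \<bar>M - \<Gamma> / a\<bar>"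
    by (intro tendsto_lowerbound[of _ _ at_bot]) (auto intro: eventually_at_bot_linorderI[of 0])
  thus ?thesis by simp
qed

section \<open>A priori estimates for second-order modes\<close>

text \<open>
  The scalar equation \<open>eps y'' + al y' + d y = g\<close> on the half-line, as a first-order system with \<open>x = y'\<close>.
\<close>

definition mode_eq :: "real \<Rightarrow> real \<Rightarrow> real \<Rightarrow> (real \<Rightarrow> real) \<Rightarrow> (real \<Rightarrow> real) \<Rightarrow> (real \<Rightarrow> real) \<Rightarrow> bool" where
  "mode_eq eps al d g y x \<longleftrightarrow> (\<forall>t\<le>0. (y has_real_derivative x t) (at t within {..0}) \<and>
     (x has_real_derivative (g t - al * x t - d * y t) / eps) (at t within {..0}))"

lemma mode_eq_shift:
  assumes "mode_eq eps al d g y x" "a \<le> 0"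
  shows "mode_eq eps al d (\<lambda>t. g (t + a)) (\<lambda>t. y (t + a)) (\<lambda>t. x (t + a))"
  unfolding mode_eq_def
proof (intro allI impI conjI)
  fix t :: real assume t: "t \<le> 0"
  show "((\<lambda>t. y (t + a)) has_real_derivative x (t + a)) (at t within {..0})"
    by (rule has_real_derivative_shift[OF _ assms(2) t]) (use assms(1) in \<open>auto simp: mode_eq_def\<close>)
  show "((\<lambda>t. x (t + a)) has_real_derivative (g (t + a) - al * x (t + a) - d * y (t + a)) / eps)
         (at t within {..0})"
    by (rule has_real_derivative_shift[where x = "\<lambda>t. (g t - al * x t - d * y t) / eps", OF _ assms(2) t])
      (use assms(1) in \<open>auto simp: mode_eq_def\<close>)
qed

lemma mode_eq_cong:
  assumes "mode_eq eps al d g y x" "\<And>t. t \<le> 0 \<Longrightarrow> y t = y' t" "\<And>t. t \<le> 0 \<Longrightarrow> g t = g' t"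
  shows "mode_eq eps al d g' y' x"
  unfolding mode_eq_def
proof (intro allI impI conjI)
  fix t :: real assume t: "t \<le> 0"
  show "(y' has_real_derivative x t) (at t within {..0})"
    by (rule half_derivative_cong[OF _ t assms(2)]) (use assms(1) t in \<open>auto simp: mode_eq_def\<close>)
  show "(x has_real_derivative (g' t - al * x t - d * y' t) / eps) (at t within {..0})"
    using assms t by (auto simp: mode_eq_def)
qed

lemma mode_eq_diff:
  assumes "mode_eq eps al d g y x" "mode_eq eps al d g' y' x'"
  shows "mode_eq eps al d (\<lambda>t. g t - g' t) (\<lambda>t. y t - y' t) (\<lambda>t. x t - x' t)"
  unfolding mode_eq_def
proof (intro allI impI conjI)
  fix t :: real assume t: "t \<le> 0"
  show "((\<lambda>t. y t - y' t) has_real_derivative x t - x' t) (at t within {..0})"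
    using assms t by (intro DERIV_diff) (auto simp: mode_eq_def)
  have eq: "(g t - g' t - al * (x t - x' t) - d * (y t - y' t)) / eps
    = (g t - al * x t - d * y t) / eps - (g' t - al * x' t - d * y' t) / eps"
    unfolding diff_divide_distrib[symmetric] by (rule arg_cong[of _ _ "\<lambda>z. z / eps"]) (simp add: algebra_simps)
  show "((\<lambda>t. x t - x' t) has_real_derivative
     (g t - g' t - al * (x t - x' t) - d * (y t - y' t)) / eps) (at t within {..0})"
    unfolding eq using assms t by (intro DERIV_diff) (auto simp: mode_eq_def)
qed

text \<open>
  Solutions in \<open>L\<^sup>2\<close> have derivatives in \<open>L\<^sup>2\<close>, which is what makes quadratic forms in \<open>(y, x)\<close>
  integrable and the energy principle applicable.  Let \<open>\<Phi> = eps x y + al y\<^sup>2/2\<close>.  Up to an integrable term,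
  \<open>\<Phi>' \<ge> eps x\<^sup>2\<close>.  If \<open>\<Phi>\<close> plus the integral of that term were unbounded below, then \<open>\<Phi> \<le> -1\<close> near \<open>-\<infinity>\<close>,
  hence \<open>(y\<^sup>2)' \<le> -2/eps\<close> there and \<open>y\<close> could not be square integrable.
\<close>

lemma mode_eq_derivative_L2:
  assumes m: "mode_eq eps al d g y x" and eps: "eps > 0" and al: "al \<ge> 0"
    and y: "half_L2 y" and g: "half_L2 g"
  shows "half_L2 x"
proof -
  define xp where "xp t = (g t - al * x t - d * y t) / eps" for t
  have Dy: "(y has_real_derivative x t) (at t within {..0})"
    and Dx: "(x has_real_derivative xp t) (at t within {..0})" if "t \<le> 0" for t
    using m that by (auto simp: mode_eq_def xp_def)
  have xp: "eps * xp t = g t - al * x t - d * y t" for t using eps by (simp add: xp_def)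
  have cx: "continuous_on {..0} x" by (rule continuous_on_half_of_deriv[OF Dx])
  define \<rho> where "\<rho> t = (g t)\<^sup>2 + (1 + \<bar>d\<bar>) * (y t)\<^sup>2" for t
  have \<rho>i: "half_integrable \<rho>"
    unfolding \<rho>_def using y g by (intro set_integral_add set_integrable_mult_right half_L2_sq)
  have \<rho>c: "continuous_on {..0} \<rho>"
    unfolding \<rho>_def using y g by (intro continuous_intros) (auto simp: half_L2_def)
  have \<rho>0: "0 \<le> \<rho> t" for t by (simp add: \<rho>_def)
  obtain G where G: "G = (\<lambda>t. - integral {t..0} \<rho>)"
    and DG: "\<And>t. t \<le> 0 \<Longrightarrow> (G has_vector_derivative \<rho> t) (at t within {..0})"
    using antiderivative_half[OF \<rho>c] by metis
  define R where "R = half_integral \<rho>"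
  have GR: "- R \<le> G t" for t
    using integral_Icc_le_half_integral[OF \<rho>i \<rho>0, of 0 t] by (simp add: G R_def)
  define \<Phi> where "\<Phi> t = eps * x t * y t + al / 2 * (y t)\<^sup>2" for t
  define \<Psi>p where "\<Psi>p t = eps * xp t * y t + eps * (x t)\<^sup>2 + al * x t * y t + \<rho> t" for t
  have D\<Psi>: "((\<lambda>t. \<Phi> t + G t) has_real_derivative \<Psi>p t) (at t within {..0})" if "t \<le> 0" for t
    unfolding \<Phi>_def \<Psi>p_def
    by (auto intro!: derivative_eq_intros Dy Dx DG[unfolded has_real_derivative_iff_has_vector_derivative[symmetric]] that
        simp: power2_eq_square algebra_simps)
  have ge: "eps * (x t)\<^sup>2 \<le> \<Psi>p t" for t
  proof -
    have "\<Psi>p t - eps * (x t)\<^sup>2 = (g t * y t + (g t)\<^sup>2 + (y t)\<^sup>2) + (\<bar>d\<bar> - d) * (y t)\<^sup>2"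
      unfolding \<Psi>p_def xp \<rho>_def by (simp add: power2_eq_square algebra_simps)
    moreover have "0 \<le> (\<bar>d\<bar> - d) * (y t)\<^sup>2" by simp
    moreover have "0 \<le> g t * y t + (g t)\<^sup>2 + (y t)\<^sup>2"
    proof -
      have "g t * y t + (g t)\<^sup>2 + (y t)\<^sup>2 = (g t + y t / 2)\<^sup>2 + 3 / 4 * (y t)\<^sup>2"
        by (simp add: power2_eq_square field_simps)
      thus ?thesis by simp
    qed
    ultimately show ?thesis by linarith
  qed
  have \<Psi>p0: "0 \<le> \<Psi>p t" for t
    by (rule order_trans[OF _ ge]) (use eps in simp)
  have cx2: "continuous_on {..0} (\<lambda>t. eps * (x t)\<^sup>2)" by (intro continuous_intros cx)
  have "\<exists>B. \<forall>t\<le>0. - B \<le> \<Phi> t + G t"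
  proof (rule ccontr)
    assume "\<nexists>B. \<forall>t\<le>0. - B \<le> \<Phi> t + G t"
    then obtain T where T: "T \<le> 0" "\<Phi> T + G T < - (R + 1)" by (metis not_le)
    have le: "\<Phi> t \<le> - 1" if "t \<le> T" for t
    proof -
      have "\<Phi> t + G t \<le> \<Phi> T + G T"
        by (rule half_mono[where T = T and \<phi> = \<Psi>p]) (use that T D\<Psi> \<Psi>p0 in auto)
      thus ?thesis using T GR[of t] by linarith
    qed
    have "1 \<le> (y t)\<^sup>2" if t: "t \<le> T - eps" for t
    proof -
      have "- (y t)\<^sup>2 - t / eps \<le> - (y T)\<^sup>2 - T / eps"
      proof (rule half_mono[where T = T and \<Phi> = "\<lambda>t. - (y t)\<^sup>2 - t / eps" and \<phi> = "\<lambda>t. - 2 * x t * y t - 1 / eps"])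
        show "((\<lambda>t. - (y t)\<^sup>2 - t / eps) has_real_derivative - 2 * x t * y t - 1 / eps) (at t within {..0})"
          if "t \<le> T" for t
          using that T eps by (auto intro!: derivative_eq_intros Dy)
        show "0 \<le> - 2 * x t * y t - 1 / eps" if "t \<le> T" for t
        proof -
          have "eps * (x t * y t) \<le> - 1" 
          proof -
            have "0 \<le> al / 2 * (y t)\<^sup>2" using al by simp
            thus ?thesis using le[OF that] unfolding \<Phi>_def mult.assoc by linarith
          qed
          hence "x t * y t \<le> - (1 / eps)" using eps by (simp add: field_simps)
          moreover have "0 < 1 / eps" using eps by simp
          moreover have "- 2 * x t * y t - 1 / eps = - 2 * (x t * y t) - 1 / eps" by simp
          ultimately show ?thesis by linarith
        qed
      qed (use t T eps in auto)
      moreover have "0 \<le> (y T)\<^sup>2" by simp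
      ultimately have "(T - t) / eps \<le> (y t)\<^sup>2" unfolding diff_divide_distrib by linarith
      moreover have "1 \<le> (T - t) / eps" using t eps by (simp add: field_simps)
      ultimately show ?thesis by linarith
    qed
    thus False using half_integrable_not_bounded_below[OF half_L2_sq[OF y], of 1 "T - eps"] by auto
  qed
  then obtain B where B: "\<And>t. t \<le> 0 \<Longrightarrow> - B \<le> \<Phi> t + G t" by auto
  have "half_integrable (\<lambda>t. eps * (x t)\<^sup>2)"
    by (rule half_integral_le_of_derivative_ge(1)[OF D\<Psi> cx2 _ ge B]) (use eps in auto)
  thus ?thesis using eps cx by (simp add: half_L2_def)
qed

text \<open>
  The energy identity: \<open>(eps x\<^sup>2 + d y\<^sup>2)' = 2xg - 2al x\<^sup>2 \<le> g\<^sup>2/al - al x\<^sup>2\<close>.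
\<close>

lemma mode_energy_integrated:
  assumes m: "mode_eq eps al d g y x" and eps: "eps > 0" and al: "al > 0"
    and y: "half_L2 y" and g: "half_L2 g"
  shows "eps * (x 0)\<^sup>2 + d * (y 0)\<^sup>2 + al * sqn x \<le> sqn g / al"
proof -
  define xp where "xp t = (g t - al * x t - d * y t) / eps" for t
  have Dy: "(y has_real_derivative x t) (at t within {..0})"
    and Dx: "(x has_real_derivative xp t) (at t within {..0})" if "t \<le> 0" for t
    using m that by (auto simp: mode_eq_def xp_def)
  have xp: "eps * xp t = g t - al * x t - d * y t" for t using eps by (simp add: xp_def)
  have x: "half_L2 x" by (rule mode_eq_derivative_L2[OF m eps _ y g]) (use al in simp)
  have "eps * (x 0)\<^sup>2 + d * (y 0)\<^sup>2 \<le> half_integral (\<lambda>t. (1 / al) * (g t)\<^sup>2 - al * (x t)\<^sup>2)"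
  proof (rule half_integral_ge_of_derivative_le[where \<phi> = "\<lambda>t. 2 * (eps * xp t) * x t + 2 * d * x t * y t"])
    show "((\<lambda>t. eps * (x t)\<^sup>2 + d * (y t)\<^sup>2) has_real_derivative 2 * (eps * xp t) * x t + 2 * d * x t * y t)
           (at t within {..0})" if "t \<le> 0" for t
      by (auto intro!: derivative_eq_intros Dy Dx that)
    show "half_integrable (\<lambda>t. eps * (x t)\<^sup>2 + d * (y t)\<^sup>2)"
      using x y by (intro set_integral_add set_integrable_mult_right half_L2_sq)
    show "half_integrable (\<lambda>t. (1 / al) * (g t)\<^sup>2 - al * (x t)\<^sup>2)"
      using x g by (intro set_integral_diff set_integrable_mult_right half_L2_sq)
    show "2 * (eps * xp t) * x t + 2 * d * x t * y t \<le> (1 / al) * (g t)\<^sup>2 - al * (x t)\<^sup>2" for t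
    proof -
      have "(1 / al) * (g t)\<^sup>2 - al * (x t)\<^sup>2 - (2 * (eps * xp t) * x t + 2 * d * x t * y t)
        = (g t - al * x t)\<^sup>2 / al"
        unfolding xp using al by (simp add: field_simps power2_eq_square)
      moreover have "0 \<le> (g t - al * x t)\<^sup>2 / al" using al by simp
      ultimately show ?thesis by linarith
    qed
  qed
  also have "\<dots> = sqn g / al - al * sqn x"
    using x g by (subst set_integral_diff) (auto intro!: set_integrable_mult_right half_L2_sq)
  finally show ?thesis by simp
qed

lemma mode_energy_at:
  assumes m: "mode_eq eps al d g y x" and eps: "eps > 0" and al: "al > 0"
    and y: "half_L2 y" and g: "half_L2 g" and t: "t \<le> 0"
  shows "eps * (x t)\<^sup>2 + d * (y t)\<^sup>2 \<le> sqn g / al"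
proof -
  have "eps * (x t)\<^sup>2 + d * (y t)\<^sup>2 + al * sqn (\<lambda>s. x (s + t)) \<le> sqn (\<lambda>s. g (s + t)) / al"
    using mode_energy_integrated[OF mode_eq_shift[OF m t] eps al half_L2_shift(1)[OF y t] half_L2_shift(1)[OF g t]]
    by simp
  moreover have "0 \<le> al * sqn (\<lambda>s. x (s + t))" using al by (intro mult_nonneg_nonneg half_integral_nonneg) auto
  moreover have "sqn (\<lambda>s. g (s + t)) / al \<le> sqn g / al"
    using half_L2_shift(2)[OF g t] al by (simp add: divide_right_mono)
  ultimately show ?thesis by linarith
qed

text \<open>
  The sharp bound for modes above the gap, without any boundary condition at \<open>0\<close>.  On the whole line it
  would follow from the symbol, as \<open>|-eps k\<^sup>2 + i al k + d| \<ge> dl\<close> for all real \<open>k\<close> when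
  \<open>2 eps dl \<le> al\<^sup>2\<close>.  On the half-line the test function is \<open>y + c x\<close>: the expression
  \<open>g\<^sup>2 - dl\<^sup>2 y\<^sup>2\<close> is \<open>(g - dl (y + c x))\<^sup>2\<close> plus an exact derivative plus a form that is nonnegative
  because of this hypothesis, and the boundary term at \<open>0\<close> has the right sign.
\<close>

lemma high_mode_L2:
  assumes m: "mode_eq eps al d g y x" and eps: "eps > 0" and al: "al > 0"
    and dl: "0 < dl" "dl \<le> d" "2 * eps * dl \<le> al\<^sup>2"
    and y: "half_L2 y" and g: "half_L2 g"
  shows "dl\<^sup>2 * sqn y \<le> sqn g"
proof -
  define xp where "xp t = (g t - al * x t - d * y t) / eps" for t
  have Dy: "(y has_real_derivative x t) (at t within {..0})"
    and Dx: "(x has_real_derivative xp t) (at t within {..0})" if "t \<le> 0" for t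
    using m that by (auto simp: mode_eq_def xp_def)
  have xp: "eps * xp t = g t - al * x t - d * y t" for t using eps by (simp add: xp_def)
  have x: "half_L2 x" by (rule mode_eq_derivative_L2[OF m eps _ y g]) (use al in simp)
  \<comment> \<open>this choice keeps the coefficient of \<open>x\<^sup>2\<close> below nonnegative in the whole range \<open>2 eps dl \<le> al\<^sup>2\<close>\<close>
  define c where "c = 2 * eps / al"
  have c: "c > 0" "c * al = 2 * eps" using eps al by (auto simp: c_def)
  define \<Phi> where "\<Phi> t = dl * (2 * eps * (x t * y t) + al * (y t)\<^sup>2 + c * eps * (x t)\<^sup>2 + c * (d - dl) * (y t)\<^sup>2)" for t
  define \<Phi>p where "\<Phi>p t = dl * (2 * (eps * xp t) * y t + 2 * eps * (x t)\<^sup>2 + 2 * al * x t * y t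
    + 2 * c * (eps * xp t) * x t + 2 * c * (d - dl) * x t * y t)" for t
  have "\<Phi> 0 \<le> half_integral (\<lambda>t. (g t)\<^sup>2 - dl\<^sup>2 * (y t)\<^sup>2)"
  proof (rule half_integral_ge_of_derivative_le[where \<phi> = \<Phi>p])
    show "(\<Phi> has_real_derivative \<Phi>p t) (at t within {..0})" if "t \<le> 0" for t
      unfolding \<Phi>_def \<Phi>p_def
      by (auto intro!: derivative_eq_intros Dy Dx that simp: power2_eq_square algebra_simps)
    show "half_integrable \<Phi>"
      unfolding \<Phi>_def using x y by (intro set_integral_add set_integrable_mult_right half_L2_sq half_L2_mult)
    show "half_integrable (\<lambda>t. (g t)\<^sup>2 - dl\<^sup>2 * (y t)\<^sup>2)"
      using y g by (intro set_integral_diff set_integrable_mult_right half_L2_sq)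
    show "\<Phi>p t \<le> (g t)\<^sup>2 - dl\<^sup>2 * (y t)\<^sup>2" for t
    proof -
      have "(g t)\<^sup>2 - dl\<^sup>2 * (y t)\<^sup>2 - \<Phi>p t = (g t - dl * (y t + c * x t))\<^sup>2
          + 2 * dl * (d - dl) * (y t)\<^sup>2 + (2 * dl * (c * al - eps) - dl\<^sup>2 * c\<^sup>2) * (x t)\<^sup>2"
        unfolding \<Phi>p_def xp by (simp add: power2_eq_square algebra_simps)
      moreover have "0 \<le> 2 * dl * (c * al - eps) - dl\<^sup>2 * c\<^sup>2"
      proof -
        have "(2 * eps * dl) * (2 * eps) \<le> al\<^sup>2 * (2 * eps)"
          by (rule mult_right_mono[OF dl(3)]) (use eps in simp)
        hence "dl * c\<^sup>2 \<le> 2 * eps" using al by (simp add: c_def field_simps power2_eq_square)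
        hence "dl * (dl * c\<^sup>2) \<le> dl * (2 * eps)" using dl by (intro mult_left_mono) auto
        thus ?thesis using c by (simp add: power2_eq_square algebra_simps)
      qed
      moreover have "0 \<le> 2 * dl * (d - dl) * (y t)\<^sup>2" using dl by simp
      ultimately show ?thesis
        using zero_le_power2[of "g t - dl * (y t + c * x t)"]
          mult_nonneg_nonneg[of "2 * dl * (c * al - eps) - dl\<^sup>2 * c\<^sup>2" "(x t)\<^sup>2"] zero_le_power2[of "x t"]
        by linarith
    qed
  qed
  also have "\<dots> = sqn g - dl\<^sup>2 * sqn y"
    using y g by (subst set_integral_diff) (auto intro!: set_integrable_mult_right half_L2_sq)
  finally have "\<Phi> 0 \<le> sqn g - dl\<^sup>2 * sqn y" .
  moreover have "0 \<le> \<Phi> 0"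
  proof -
    have "al * (2 * eps * (x 0 * y 0) + al * (y 0)\<^sup>2 + c * eps * (x 0)\<^sup>2)
      = (al * y 0 + eps * x 0)\<^sup>2 + eps\<^sup>2 * (x 0)\<^sup>2"
      using al by (simp add: c_def power2_eq_square algebra_simps)
    moreover have "0 \<le> (al * y 0 + eps * x 0)\<^sup>2 + eps\<^sup>2 * (x 0)\<^sup>2" by simp
    ultimately have "0 \<le> 2 * eps * (x 0 * y 0) + al * (y 0)\<^sup>2 + c * eps * (x 0)\<^sup>2"
      using al by (metis zero_le_mult_iff not_less_iff_gr_or_eq not_le)
    moreover have "0 \<le> c * (d - dl) * (y 0)\<^sup>2" using c dl by simp
    ultimately show ?thesis unfolding \<Phi>_def using dl by (intro mult_nonneg_nonneg) auto
  qed
  ultimately show ?thesis by linarith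
qed

text \<open>
  Below the gap the boundary condition fixes the part of the solution on the slow characteristic root
  to be \<open>q\<close>; in the applications \<open>s\<^sup>2 = al\<^sup>2 - 4 eps d\<close>.  Here testing with \<open>y\<close> suffices; the boundary
  condition turns the boundary term into \<open>s (y(0)\<^sup>2/2 - q y(0))\<close>.
\<close>

lemma low_mode_L2:
  assumes m: "mode_eq eps al d g y x" and eps: "eps > 0" and al: "al > 0"
    and D: "d = - D" "D > 0" and s: "s > 0" and bc: "eps * x 0 + (al + s) / 2 * y 0 = s * q"
    and y: "half_L2 y" and g: "half_L2 g"
  shows "D\<^sup>2 * sqn y + D * s / 2 * (y 0)\<^sup>2 \<le> sqn g + 2 * D * s * q\<^sup>2"
proof -
  define xp where "xp t = (g t - al * x t - d * y t) / eps" for t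
  have Dy: "(y has_real_derivative x t) (at t within {..0})"
    and Dx: "(x has_real_derivative xp t) (at t within {..0})" if "t \<le> 0" for t
    using m that by (auto simp: mode_eq_def xp_def)
  have xp: "eps * xp t = g t - al * x t + D * y t" for t using eps by (simp add: xp_def D)
  have x: "half_L2 x" by (rule mode_eq_derivative_L2[OF m eps _ y g]) (use al in simp)
  define \<Phi> where "\<Phi> t = - (2 * D) * (eps * (x t * y t) + al / 2 * (y t)\<^sup>2)" for t
  define \<Phi>p where "\<Phi>p t = - (2 * D) * ((eps * xp t) * y t + eps * (x t)\<^sup>2 + al * x t * y t)" for t
  have "\<Phi> 0 \<le> half_integral (\<lambda>t. (g t)\<^sup>2 - D\<^sup>2 * (y t)\<^sup>2)"
  proof (rule half_integral_ge_of_derivative_le[where \<phi> = \<Phi>p])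
    show "(\<Phi> has_real_derivative \<Phi>p t) (at t within {..0})" if "t \<le> 0" for t
      unfolding \<Phi>_def \<Phi>p_def
      by (auto intro!: derivative_eq_intros Dy Dx that simp: power2_eq_square algebra_simps)
    show "half_integrable \<Phi>"
      unfolding \<Phi>_def using x y by (intro set_integral_add set_integrable_mult_right half_L2_sq half_L2_mult)
    show "half_integrable (\<lambda>t. (g t)\<^sup>2 - D\<^sup>2 * (y t)\<^sup>2)"
      using y g by (intro set_integral_diff set_integrable_mult_right half_L2_sq)
    show "\<Phi>p t \<le> (g t)\<^sup>2 - D\<^sup>2 * (y t)\<^sup>2" for t
    proof -
      have "(g t)\<^sup>2 - D\<^sup>2 * (y t)\<^sup>2 - \<Phi>p t = (g t + D * y t)\<^sup>2 + 2 * D * eps * (x t)\<^sup>2"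
        unfolding \<Phi>p_def xp by (simp add: power2_eq_square algebra_simps)
      moreover have "0 \<le> (g t + D * y t)\<^sup>2 + 2 * D * eps * (x t)\<^sup>2" using D eps by simp
      ultimately show ?thesis by linarith
    qed
  qed
  also have "\<dots> = sqn g - D\<^sup>2 * sqn y"
    using y g by (subst set_integral_diff) (auto intro!: set_integrable_mult_right half_L2_sq)
  finally have "\<Phi> 0 \<le> sqn g - D\<^sup>2 * sqn y" .
  moreover have "D * s / 2 * (y 0)\<^sup>2 - 2 * D * s * q\<^sup>2 \<le> \<Phi> 0"
  proof -
    have ex: "eps * x 0 = s * q - (al + s) / 2 * y 0" using bc by simp
    have "\<Phi> 0 = - (2 * D) * ((eps * x 0) * y 0 + al / 2 * (y 0)\<^sup>2)" by (simp add: \<Phi>_def)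
    also have "\<dots> = 2 * D * (s / 2 * (y 0)\<^sup>2 - s * q * y 0)"
      unfolding ex by (simp add: power2_eq_square field_simps)
    finally have "\<Phi> 0 - (D * s / 2 * (y 0)\<^sup>2 - 2 * D * s * q\<^sup>2) = D * s / 2 * (y 0 - 2 * q)\<^sup>2"
      by (simp add: power2_eq_square algebra_simps)
    moreover have "0 \<le> D * s / 2 * (y 0 - 2 * q)\<^sup>2" using D s by simp
    ultimately show ?thesis by linarith
  qed
  ultimately show ?thesis by linarith
qed

section \<open>A priori estimates for first-order modes\<close>

text \<open>
  The sign of \<open>d\<close> is free: for \<open>d > 0\<close> this bounds \<open>y(0)\<close> as well, and for \<open>d < 0\<close> the value \<open>y(0)\<close> is
  the datum.
\<close>

lemma first_order_mode_L2:
  fixes y g :: "real \<Rightarrow> real"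
  assumes Dy: "\<And>t. t \<le> 0 \<Longrightarrow> (y has_real_derivative g t - d * y t) (at t within {..0})"
    and y: "half_L2 y" and g: "half_L2 g"
  shows "d * (y 0)\<^sup>2 + d\<^sup>2 * sqn y \<le> sqn g"
proof -
  have "d * (y 0)\<^sup>2 \<le> half_integral (\<lambda>t. (g t)\<^sup>2 - d\<^sup>2 * (y t)\<^sup>2)"
  proof (rule half_integral_ge_of_derivative_le[where \<phi> = "\<lambda>t. 2 * d * y t * (g t - d * y t)"])
    show "((\<lambda>t. d * (y t)\<^sup>2) has_real_derivative 2 * d * y t * (g t - d * y t)) (at t within {..0})"
      if "t \<le> 0" for t
      by (auto intro!: derivative_eq_intros Dy that)
    show "half_integrable (\<lambda>t. d * (y t)\<^sup>2)"
      using y by (intro set_integrable_mult_right half_L2_sq)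
    show "half_integrable (\<lambda>t. (g t)\<^sup>2 - d\<^sup>2 * (y t)\<^sup>2)"
      using y g by (intro set_integral_diff set_integrable_mult_right half_L2_sq)
    show "2 * d * y t * (g t - d * y t) \<le> (g t)\<^sup>2 - d\<^sup>2 * (y t)\<^sup>2" for t
      using zero_le_power2[of "g t - d * y t"] by (simp add: power2_eq_square algebra_simps)
  qed
  also have "\<dots> = sqn g - d\<^sup>2 * sqn y"
    using y g by (subst set_integral_diff) (auto intro!: set_integrable_mult_right half_L2_sq)
  finally show ?thesis by simp
qed

lemma first_order_mode_at:
  fixes y g :: "real \<Rightarrow> real"
  assumes Dy: "\<And>t. t \<le> 0 \<Longrightarrow> (y has_real_derivative g t - d * y t) (at t within {..0})"
    and y: "half_L2 y" and g: "half_L2 g" and t: "t \<le> 0"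
  shows "d * (y t)\<^sup>2 \<le> sqn g"
proof -
  have "d * (y (0 + t))\<^sup>2 + d\<^sup>2 * sqn (\<lambda>s. y (s + t)) \<le> sqn (\<lambda>s. g (s + t))"
    by (rule first_order_mode_L2[OF has_real_derivative_shift[OF Dy t] half_L2_shift(1)[OF y t] half_L2_shift(1)[OF g t]])
  moreover have "0 \<le> d\<^sup>2 * sqn (\<lambda>s. y (s + t))" by (intro mult_nonneg_nonneg half_integral_nonneg) auto
  ultimately show ?thesis using half_L2_shift(2)[OF g t] by simp
qed

section \<open>Solvability of the modes\<close>

lemma half_integrable_exp:
  assumes k: "k > (0::real)"
  shows "half_integrable (\<lambda>t. exp (k * t))" "half_integral (\<lambda>t. exp (k * t)) \<le> 1 / k"
proof -
  have D: "((\<lambda>t. exp (k * t) / k) has_real_derivative exp (k * t)) (at t within {..0})" for t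
    using k by (auto intro!: derivative_eq_intros)
  show "half_integrable (\<lambda>t. exp (k * t))"
    by (rule half_integral_le_of_derivative_ge(1)[OF D, of _ 0]) (use k in \<open>auto intro!: continuous_intros\<close>)
  have "half_integral (\<lambda>t. exp (k * t)) \<le> exp (k * 0) / k + 0"
    by (rule half_integral_le_of_derivative_ge(2)[OF D]) (use k in \<open>auto intro!: continuous_intros\<close>)
  thus "half_integral (\<lambda>t. exp (k * t)) \<le> 1 / k" by simp
qed

lemma half_L2_norm_antiderivative:
  fixes f :: "real \<Rightarrow> 'b::real_normed_vector"
  assumes f: "half_L2 f"
  obtains G where "\<And>t. t \<le> 0 \<Longrightarrow> (G has_real_derivative (norm (f t))\<^sup>2) (at t within {..0})"
    "\<And>t. - sqn f \<le> G t"
proof -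
  have "continuous_on {..0} (\<lambda>t. (norm (f t))\<^sup>2)" using f by (intro continuous_intros half_L2_cont)
  from antiderivative_half[OF this] obtain G where
    G: "G = (\<lambda>t. - integral {t..0} (\<lambda>t. (norm (f t))\<^sup>2))"
    and DG: "\<And>t. t \<le> 0 \<Longrightarrow> (G has_vector_derivative (norm (f t))\<^sup>2) (at t within {..0})" by metis
  show ?thesis
  proof (rule that[of G])
    show "- sqn f \<le> G t" for t
      using integral_Icc_le_half_integral[OF half_L2_int[OF f], of 0 t] by (simp add: G)
  qed (use DG G in \<open>auto simp: has_real_derivative_iff_has_vector_derivative\<close>)
qed

lemma continuous_on_half_of_vderiv:
  fixes y :: "real \<Rightarrow> 'b::real_normed_vector"
  assumes "\<And>t. t \<le> 0 \<Longrightarrow> (y has_vector_derivative x t) (at t within {..0})"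
  shows "continuous_on {..0} y"
  using assms by (auto simp: continuous_on_eq_continuous_within intro: has_vector_derivative_continuous)

lemma norm_sq_has_derivative:
  fixes w :: "real \<Rightarrow> 'b::real_inner"
  assumes "(w has_vector_derivative w') (at t within S)"
  shows "((\<lambda>t. (norm (w t))\<^sup>2) has_real_derivative 2 * (w t \<bullet> w')) (at t within S)"
proof -
  have "((\<lambda>t. w t \<bullet> w t) has_vector_derivative w t \<bullet> w' + w' \<bullet> w t) (at t within S)"
    by (rule bounded_bilinear.has_vector_derivative[OF bounded_bilinear_inner assms assms])
  thus ?thesis
    by (simp add: has_real_derivative_iff_has_vector_derivative power2_norm_eq_inner inner_commute)
qed

lemma inner_complex_mult: "w \<bullet> (k * w) = Re k * (norm w)\<^sup>2"
  by (simp add: inner_complex_def cmod_power2) (simp add: power2_eq_square algebra_simps)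

lemma inner_young:
  fixes x y :: "'b::real_inner"
  assumes "c > 0"
  shows "2 * \<bar>x \<bullet> y\<bar> \<le> c * (norm x)\<^sup>2 + (norm y)\<^sup>2 / c"
proof -
  have "2 * \<bar>x \<bullet> y\<bar> \<le> 2 * (norm x * norm y)" using Cauchy_Schwarz_ineq2[of x y] by simp
  also have "\<dots> \<le> c * (norm x)\<^sup>2 + (norm y)\<^sup>2 / c"
  proof -
    have "c * (norm x)\<^sup>2 + (norm y)\<^sup>2 / c - 2 * (norm x * norm y) = (c * norm x - norm y)\<^sup>2 / c"
      using assms by (simp add: power2_eq_square field_simps)
    moreover have "0 \<le> (c * norm x - norm y)\<^sup>2 / c" using assms by simp
    ultimately show ?thesis by linarith
  qed
  finally show ?thesis .
qed

lemma variation_of_constants: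
  fixes k w0 :: complex and f :: "real \<Rightarrow> complex"
  assumes DA: "(A has_vector_derivative exp (- (k * of_real t)) * f t) (at t within S)"
  shows "((\<lambda>t. exp (k * of_real t) * (w0 + A t)) has_vector_derivative
      k * (exp (k * of_real t) * (w0 + A t)) + f t) (at t within S)"
proof -
  have e: "((\<lambda>t. exp (k * of_real t)) has_vector_derivative k * exp (k * of_real t)) (at t within S)"
  proof -
    have "((\<lambda>z. exp (k * z)) has_field_derivative k * exp (k * of_real t)) (at (of_real t))"
      by (auto intro!: derivative_eq_intros)
    thus ?thesis by (rule has_vector_derivative_real_field)
  qed
  have 2: "((\<lambda>t. w0 + A t) has_vector_derivative exp (- (k * of_real t)) * f t) (at t within S)"
    using DA by (auto intro!: derivative_eq_intros)
  have EE: "exp (k * of_real t) * exp (- (k * of_real t)) = 1"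
    by (simp add: exp_minus)
  have "exp (k * of_real t) * (exp (- (k * of_real t)) * f t) + k * exp (k * of_real t) * (w0 + A t)
      = k * (exp (k * of_real t) * (w0 + A t)) + f t"
    by (simp add: mult.assoc[symmetric] EE)
  with has_vector_derivative_mult[OF e 2] show ?thesis by (simp only:)
qed

lemma unstable_first_order_solution:
  fixes k w0 :: complex and f :: "real \<Rightarrow> complex"
  assumes k: "Re k > 0" and f: "half_L2 f"
  obtains w where "w 0 = w0" "half_L2 w"
    "\<And>t. t \<le> 0 \<Longrightarrow> (w has_vector_derivative k * w t + f t) (at t within {..0})"
proof -
  have "continuous_on {..0} (\<lambda>t. exp (- (k * of_real t)) * f t)"
    by (intro continuous_intros half_L2_cont f)
  from antiderivative_half[OF this] obtain A where A0: "A 0 = 0"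
    and DA: "\<And>t. t \<le> 0 \<Longrightarrow> (A has_vector_derivative exp (- (k * of_real t)) * f t) (at t within {..0})" by metis
  define w where "w t = exp (k * of_real t) * (w0 + A t)" for t
  have Dw: "(w has_vector_derivative k * w t + f t) (at t within {..0})" if "t \<le> 0" for t
    unfolding w_def by (rule variation_of_constants[where f = f and k = k, OF DA[OF that]])
  obtain G where DG: "\<And>t. t \<le> 0 \<Longrightarrow> (G has_real_derivative (norm (f t))\<^sup>2) (at t within {..0})"
    and G: "\<And>t. - sqn f \<le> G t" using half_L2_norm_antiderivative[OF f] by metis
  have cw: "continuous_on {..0} w" by (rule continuous_on_half_of_vderiv[OF Dw])
  have "half_integrable (\<lambda>t. Re k * (norm (w t))\<^sup>2)"
  proof (rule half_integral_le_of_derivative_ge(1)[where \<Phi> = "\<lambda>t. (norm (w t))\<^sup>2 + G t / Re k" and B = "sqn f / Re k"])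
    show "((\<lambda>t. (norm (w t))\<^sup>2 + G t / Re k) has_real_derivative
        2 * (w t \<bullet> (k * w t + f t)) + (norm (f t))\<^sup>2 / Re k) (at t within {..0})" if "t \<le> 0" for t
      by (rule DERIV_add[OF norm_sq_has_derivative[OF Dw[OF that]] DERIV_cdivide[OF DG[OF that]]])
    show "continuous_on {..0} (\<lambda>t. Re k * (norm (w t))\<^sup>2)" by (intro continuous_intros cw)
    show "Re k * (norm (w t))\<^sup>2 \<le> 2 * (w t \<bullet> (k * w t + f t)) + (norm (f t))\<^sup>2 / Re k" for t
      using inner_young[OF k, of "w t" "f t"] by (simp add: inner_add_right inner_complex_mult)
    show "- (sqn f / Re k) \<le> (norm (w t))\<^sup>2 + G t / Re k" for t
      using divide_right_mono[OF G[of t], of "Re k"] k zero_le_power2[of "norm (w t)"]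
      unfolding minus_divide_left by linarith
  qed (use k in auto)
  hence "half_L2 w" using k cw by (simp add: half_L2_def)
  moreover have "w 0 = w0" by (simp add: w_def A0)
  ultimately show ?thesis using that Dw by blast
qed

text \<open>
  The solution is \<open>w(t) = \<integral>\<^bsub>-\<infinity>\<^esub>\<^bsup>t\<^esup> e\<^bsup>k(t-r)\<^esup>f(r) dr\<close>, written as \<open>e\<^bsup>kt\<^esup>(c + A t)\<close> with the antiderivative
  \<open>A\<close> of \<open>e\<^bsup>-kr\<^esup>f(r)\<close> that vanishes at \<open>0\<close>.  Young's inequality bounds it pointwise, and then the
  energy inequality for \<open>|w|\<^sup>2\<close> places it in \<open>L\<^sup>2\<close>.
\<close>

lemma stable_first_order_solution:
  fixes k :: complex and f :: "real \<Rightarrow> complex"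
  assumes k: "Re k < 0" and f: "half_L2 f"
  obtains w where "half_L2 w"
    "\<And>t. t \<le> 0 \<Longrightarrow> (w has_vector_derivative k * w t + f t) (at t within {..0})"
proof -
  define \<kappa> where "\<kappa> = - Re k"
  have \<kappa>: "\<kappa> > 0" using k by (simp add: \<kappa>_def)
  define a where "a t = exp (- (k * of_real t)) * f t" for t
  have ca: "continuous_on {..0} a" unfolding a_def by (intro continuous_intros half_L2_cont f)
  have na: "norm (a t) = exp (\<kappa> * t) * norm (f t)" for t by (simp add: a_def norm_mult \<kappa>_def)
  have young: "norm (a r) \<le> exp (\<kappa> * T) * (exp (2 * \<kappa> * (r - T)) + (norm (f r))\<^sup>2)" for r T
  proof -
    define E where "E = exp (\<kappa> * (r - T))"
    have "E * norm (f r) \<le> E\<^sup>2 + (norm (f r))\<^sup>2"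
    proof -
      have "E\<^sup>2 + (norm (f r))\<^sup>2 - E * norm (f r) = (E - norm (f r) / 2)\<^sup>2 + 3 / 4 * (norm (f r))\<^sup>2"
        by (simp add: power2_eq_square field_simps)
      moreover have "0 \<le> (E - norm (f r) / 2)\<^sup>2 + 3 / 4 * (norm (f r))\<^sup>2" by simp
      ultimately show ?thesis by linarith
    qed
    moreover have "E\<^sup>2 = exp (2 * \<kappa> * (r - T))" by (simp add: E_def power2_eq_square flip: exp_add)
    moreover have "exp (\<kappa> * r) = exp (\<kappa> * T) * E" by (simp add: E_def flip: exp_add) (simp add: algebra_simps)
    ultimately show ?thesis unfolding na by (simp add: mult.assoc)
  qed
  have ia: "half_integrable a"
  proof (rule half_integrable_bound[OF ca])
    show "half_integrable (\<lambda>r. exp (\<kappa> * 0) * (exp (2 * \<kappa> * r) + (norm (f r))\<^sup>2))"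
      using half_integrable_exp(1)[of "2 * \<kappa>"] \<kappa> half_L2_int[OF f] by (intro set_integrable_mult_right set_integral_add) auto
    show "norm (a t) \<le> exp (\<kappa> * 0) * (exp (2 * \<kappa> * t) + (norm (f t))\<^sup>2)" for t
      using young[of t 0] by simp
  qed
  obtain A where A: "A = (\<lambda>t. - integral {t..0} a)"
    and DA: "\<And>t. t \<le> 0 \<Longrightarrow> (A has_vector_derivative a t) (at t within {..0})"
    using antiderivative_half[OF ca] by metis
  define c where "c = half_integral a"
  define w where "w t = exp (k * of_real t) * (c + A t)" for t
  have Dw: "(w has_vector_derivative k * w t + f t) (at t within {..0})" if "t \<le> 0" for t
    unfolding w_def by (rule variation_of_constants[where f = f and k = k, OF DA[OF that, unfolded a_def]])
  have cw: "continuous_on {..0} w" by (rule continuous_on_half_of_vderiv[OF Dw])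
  define M where "M = 1 / (2 * \<kappa>) + sqn f"
  have wM: "norm (w T) \<le> M" if T: "T \<le> 0" for T
  proof -
    have si: "set_integrable lborel {S..0} a" for S
      by (rule set_integrable_subset[OF ia]) auto
    have ai': "a integrable_on {S..0}" for S
      by (rule integrable_continuous_interval, rule continuous_on_subset[OF ca]) auto
    have ai: "a integrable_on {S..T}" for S
      by (rule integrable_continuous_interval, rule continuous_on_subset[OF ca]) (use T in auto)
    have cf: "continuous_on {S..T} f" for S
      by (rule continuous_on_subset[OF half_L2_cont[OF f]]) (use T in auto)
    have "((\<lambda>S. set_lebesgue_integral lborel {S..0} a) \<longlongrightarrow> c) at_bot"
      unfolding c_def by (rule tendsto_set_lebesgue_integral_at_bot) (use ia in auto)
    hence "((\<lambda>S. - A S) \<longlongrightarrow> c) at_bot"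
      using set_borel_integral_eq_integral(2)[OF si] by (simp add: A)
    hence "((\<lambda>S. norm (- A S + A T)) \<longlongrightarrow> norm (c + A T)) at_bot"
      by (intro tendsto_intros)
    moreover have "\<forall>\<^sub>F S in at_bot. norm (- A S + A T) \<le> exp (\<kappa> * T) * M"
    unfolding eventually_at_bot_linorder
    proof (intro exI[of _ T] allI impI)
      fix S assume S: "S \<le> T"
      have "integral {S..T} a + integral {T..0} a = integral {S..0} a"
        by (rule Henstock_Kurzweil_Integration.integral_combine)
          (use S T ai' in auto)
      hence "- A S + A T = integral {S..T} a" by (simp add: A algebra_simps)
      also have "norm \<dots> \<le> integral {S..T} (\<lambda>r. exp (\<kappa> * T) * (exp (2 * \<kappa> * (r - T)) + (norm (f r))\<^sup>2))"
        by (rule integral_norm_bound_integral[OF ai _ young])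
          (intro refl integrable_continuous_interval continuous_intros cf)+
      also have "\<dots> = exp (\<kappa> * T) * (integral {S..T} (\<lambda>r. exp (2 * \<kappa> * (r - T))) + integral {S..T} (\<lambda>r. (norm (f r))\<^sup>2))"
        unfolding integral_mult_right
        by (subst Henstock_Kurzweil_Integration.integral_add)
          (intro refl integrable_continuous_interval continuous_intros cf)+
      also have "\<dots> \<le> exp (\<kappa> * T) * M"
      proof -
        have "((\<lambda>r. exp (2 * \<kappa> * (r - T))) has_integral
           (exp (2 * \<kappa> * (T - T)) / (2 * \<kappa>) - exp (2 * \<kappa> * (S - T)) / (2 * \<kappa>))) {S..T}"
          by (rule fundamental_theorem_of_calculus[OF S])
            (use \<kappa> in \<open>auto intro!: derivative_eq_intros simp: has_real_derivative_iff_has_vector_derivative[symmetric]\<close>)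
        from integral_unique[OF this] have "integral {S..T} (\<lambda>r. exp (2 * \<kappa> * (r - T))) \<le> 1 / (2 * \<kappa>)"
          using \<kappa> by simp
        moreover have "integral {S..T} (\<lambda>r. (norm (f r))\<^sup>2) \<le> sqn f"
          by (rule integral_Icc_le_half_integral[OF half_L2_int[OF f] _ T]) simp
        ultimately show ?thesis unfolding M_def by simp
      qed
      finally show "norm (- A S + A T) \<le> exp (\<kappa> * T) * M" .
    qed
    ultimately have "norm (c + A T) \<le> exp (\<kappa> * T) * M"
      by (rule tendsto_upperbound) simp
    hence "norm (w T) \<le> exp (- (\<kappa> * T)) * (exp (\<kappa> * T) * M)"
      unfolding w_def norm_mult by (simp add: \<kappa>_def mult_left_mono)
    also have "exp (- (\<kappa> * T)) * (exp (\<kappa> * T) * M) = M"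
      by (simp add: mult.assoc[symmetric] flip: exp_add)
    finally show ?thesis .
  qed
  have M0: "0 \<le> M" using wM[of 0] norm_ge_zero[of "w 0"] by linarith
  obtain G where DG: "\<And>t. t \<le> 0 \<Longrightarrow> (G has_real_derivative (norm (f t))\<^sup>2) (at t within {..0})"
    and G: "\<And>t. - sqn f \<le> G t" using half_L2_norm_antiderivative[OF f] by metis
  have "half_integrable (\<lambda>t. \<kappa> * (norm (w t))\<^sup>2)"
  proof (rule half_integral_le_of_derivative_ge(1)[where \<Phi> = "\<lambda>t. - (norm (w t))\<^sup>2 + G t / \<kappa>" and B = "M\<^sup>2 + sqn f / \<kappa>"])
    show "((\<lambda>t. - (norm (w t))\<^sup>2 + G t / \<kappa>) has_real_derivative
        - (2 * (w t \<bullet> (k * w t + f t))) + (norm (f t))\<^sup>2 / \<kappa>) (at t within {..0})" if "t \<le> 0" for t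
      by (rule DERIV_add[OF DERIV_minus[OF norm_sq_has_derivative[OF Dw[OF that]]] DERIV_cdivide[OF DG[OF that]]])
    show "continuous_on {..0} (\<lambda>t. \<kappa> * (norm (w t))\<^sup>2)" by (intro continuous_intros cw)
    show "\<kappa> * (norm (w t))\<^sup>2 \<le> - (2 * (w t \<bullet> (k * w t + f t))) + (norm (f t))\<^sup>2 / \<kappa>" for t
      using inner_young[OF \<kappa>, of "w t" "f t"] by (simp add: inner_add_right inner_complex_mult \<kappa>_def)
    show "- (M\<^sup>2 + sqn f / \<kappa>) \<le> - (norm (w t))\<^sup>2 + G t / \<kappa>" if "t \<le> 0" for t
      using divide_right_mono[OF G[of t], of \<kappa>] \<kappa> power_mono[OF wM[OF that], of 2] by simp
  qed (use \<kappa> in auto)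
  hence "half_L2 w" using \<kappa> cw by (simp add: half_L2_def)
  thus ?thesis using that Dw by blast
qed

lemma half_L2_complex_of_real: "half_L2 g \<Longrightarrow> half_L2 (\<lambda>t. complex_of_real (g t))"
  by (auto simp: half_L2_def intro!: continuous_intros)

lemma half_L2_Re:
  assumes w: "half_L2 w" shows "half_L2 (\<lambda>t. Re (w t))"
proof (rule half_L2_bound(1)[OF _ half_L2_int[OF w]])
  show "continuous_on {..0} (\<lambda>t. Re (w t))" by (intro continuous_intros half_L2_cont w)
  show "(norm (Re (w t)))\<^sup>2 \<le> (norm (w t))\<^sup>2" for t
    by (intro power_mono) (auto simp: abs_Re_le_cmod)
qed

lemma has_real_derivative_Re:
  "(w has_vector_derivative w') F \<Longrightarrow> ((\<lambda>t. Re (w t)) has_real_derivative Re w') F"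
  unfolding has_real_derivative_iff_has_vector_derivative
  by (rule bounded_linear.has_vector_derivative[OF bounded_linear_Re])

text \<open>
  The operator \<open>eps \<partial>\<^sup>2 + al \<partial> + d\<close> factors as \<open>eps (\<partial> - k1)(\<partial> - k2)\<close>.  Solving the two first-order equations
  one after the other over the complex numbers treats real, double and complex characteristic roots
  alike; the real part solves the real equation.
\<close>

lemma second_order_from_first_order:
  fixes k1 k2 :: complex
  assumes eps: "eps > 0" and k2: "Re k2 < 0"
    and sum: "k1 + k2 = - of_real (al / eps)" and prod: "k1 * k2 = of_real (d / eps)"
    and w: "half_L2 w"
    and Dw: "\<And>t. t \<le> 0 \<Longrightarrow> (w has_vector_derivative k1 * w t + of_real (g t / eps)) (at t within {..0})"
  obtains Y where "half_L2 (\<lambda>t. Re (Y t))" "mode_eq eps al d g (\<lambda>t. Re (Y t)) (\<lambda>t. Re (k2 * Y t + w t))"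
proof -
  obtain Y where Y: "half_L2 Y"
    and DY: "\<And>t. t \<le> 0 \<Longrightarrow> (Y has_vector_derivative k2 * Y t + w t) (at t within {..0})"
    using stable_first_order_solution[OF k2 w] by metis
  have "mode_eq eps al d g (\<lambda>t. Re (Y t)) (\<lambda>t. Re (k2 * Y t + w t))"
    unfolding mode_eq_def
  proof (intro allI impI conjI)
    fix t :: real assume t: "t \<le> 0"
    show "((\<lambda>t. Re (Y t)) has_real_derivative Re (k2 * Y t + w t)) (at t within {..0})"
      by (rule has_real_derivative_Re[OF DY[OF t]])
    define X where "X = k2 * Y t + w t"
    have "((\<lambda>t. k2 * Y t + w t) has_vector_derivative k2 * X + (k1 * w t + of_real (g t / eps))) (at t within {..0})"
      unfolding X_def
      by (intro has_vector_derivative_add has_vector_derivative_mult_right DY Dw t)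
    hence D: "((\<lambda>t. Re (k2 * Y t + w t)) has_real_derivative Re (k2 * X + (k1 * w t + of_real (g t / eps)))) (at t within {..0})"
      by (rule has_real_derivative_Re)
    have "k2 * X + (k1 * w t + of_real (g t / eps)) = (k1 + k2) * X - (k1 * k2) * Y t + of_real (g t / eps)"
      by (simp add: X_def algebra_simps)
    also have "Re \<dots> = (g t - al * Re X - d * Re (Y t)) / eps"
      unfolding sum prod using eps by (simp add: field_simps)
    finally have "((\<lambda>t. Re (k2 * Y t + w t)) has_real_derivative
        (g t - al * Re X - d * Re (Y t)) / eps) (at t within {..0})"
      using D by (simp only:)
    thus "((\<lambda>t. Re (k2 * Y t + w t)) has_real_derivative
        (g t - al * Re (k2 * Y t + w t) - d * Re (Y t)) / eps) (at t within {..0})"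
      by (simp only: X_def)
  qed
  thus ?thesis using that half_L2_Re[OF Y] by blast
qed

lemma high_mode_solvable:
  assumes eps: "eps > 0" and al: "al > 0" and d: "d > 0" and g: "half_L2 g"
  obtains y x where "half_L2 y" "mode_eq eps al d g y x"
proof -
  define r where "r = csqrt (of_real (al\<^sup>2 - 4 * eps * d))"
  have r2: "r\<^sup>2 = of_real (al\<^sup>2 - 4 * eps * d)" by (simp add: r_def)
  have rr: "\<bar>Re r\<bar> < al"
  proof (cases "0 \<le> al\<^sup>2 - 4 * eps * d")
    case True
    have "r = of_real (sqrt (al\<^sup>2 - 4 * eps * d))" unfolding r_def using True by (subst csqrt_of_real_nonneg) auto
    hence "\<bar>Re r\<bar> = sqrt (al\<^sup>2 - 4 * eps * d)" using True by simp
    also have "\<dots> < sqrt (al\<^sup>2)" using eps d by (intro real_sqrt_less_mono) simp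
    finally show ?thesis using al by simp
  next
    case False
    hence "r = \<i> * of_real (sqrt \<bar>al\<^sup>2 - 4 * eps * d\<bar>)"
      unfolding r_def by (subst csqrt_of_real_nonpos) auto
    thus ?thesis using al by simp
  qed
  define k1 k2 where "k1 = (- of_real al + r) / of_real (2 * eps)" and "k2 = (- of_real al - r) / of_real (2 * eps)"
  have "Re k1 = (- al + Re r) / (2 * eps)" "Re k2 = (- al - Re r) / (2 * eps)"
    by (simp_all only: k1_def k2_def Re_divide_of_real) simp_all
  hence k: "Re k1 < 0" "Re k2 < 0"
    using rr eps by (auto simp: divide_neg_pos)
  have "k1 + k2 = - of_real (2 * al) / of_real (2 * eps)"
    unfolding k1_def k2_def add_divide_distrib[symmetric] by simp
  also have "\<dots> = - of_real (al / eps)" by simp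
  finally have sum: "k1 + k2 = - of_real (al / eps)" .
  have "k1 * k2 = ((- of_real al + r) * (- of_real al - r)) / of_real (2 * eps * (2 * eps))"
    unfolding k1_def k2_def times_divide_times_eq of_real_mult[of "2 * eps"] ..
  also have "(- of_real al + r) * (- of_real al - r) = of_real (al\<^sup>2) - r\<^sup>2"
    by (simp add: power2_eq_square algebra_simps)
  also have "\<dots> = of_real (4 * eps * d)" unfolding r2 by simp
  also have "of_real (4 * eps * d) / of_real (2 * eps * (2 * eps)) = complex_of_real (4 * eps * d / (2 * eps * (2 * eps)))"
    by (simp only: of_real_divide)
  also have "4 * eps * d / (2 * eps * (2 * eps)) = d / eps" using eps by simp
  finally have prod: "k1 * k2 = of_real (d / eps)" .
  have "half_L2 (\<lambda>t. complex_of_real (g t / eps))"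
    using half_L2_complex_of_real[OF half_L2_scale(1)[OF g, of "1 / eps"]] by simp
  from stable_first_order_solution[OF k(1) this] obtain w where "half_L2 w"
    "\<And>t. t \<le> 0 \<Longrightarrow> (w has_vector_derivative k1 * w t + of_real (g t / eps)) (at t within {..0})" by blast
  note w = this
  show ?thesis
  proof (rule second_order_from_first_order[OF eps k(2) sum prod w])
    fix Y assume "half_L2 (\<lambda>t. Re (Y t))" "mode_eq eps al d g (\<lambda>t. Re (Y t)) (\<lambda>t. Re (k2 * Y t + w t))"
    thus ?thesis by (rule that)
  qed
qed

text \<open>
  The root \<open>k1 = (s - al)/(2 eps)\<close> is positive, so the value of \<open>w = Y' - k2 Y\<close> at \<open>0\<close> is free; it is
  chosen to meet the boundary condition.
\<close>

lemma low_mode_solvable: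
  assumes eps: "eps > 0" and al: "al > 0" and d: "d < 0" and s: "s > 0" "s\<^sup>2 = al\<^sup>2 - 4 * eps * d" and g: "half_L2 g"
  obtains y x where "half_L2 y" "mode_eq eps al d g y x" "eps * x 0 + (al + s) / 2 * y 0 = s * q"
proof -
  have "al\<^sup>2 < s\<^sup>2" using s(2) mult_pos_neg[of "4 * eps" d] eps d by simp
  hence sal: "al < s" using s al by (simp add: power2_less_imp_less)
  define k1 k2 where "k1 = complex_of_real ((s - al) / (2 * eps))" and "k2 = complex_of_real ((- al - s) / (2 * eps))"
  have k: "Re k1 > 0" "Re k2 < 0"
    using sal al s eps unfolding k1_def k2_def complex.sel Re_complex_of_real by (auto intro: divide_neg_pos)
  have "k1 + k2 = of_real ((s - al) / (2 * eps) + (- al - s) / (2 * eps))"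
    by (simp only: k1_def k2_def of_real_add)
  also have "(s - al) / (2 * eps) + (- al - s) / (2 * eps) = - (al / eps)"
    using eps by (simp add: field_simps)
  finally have sum: "k1 + k2 = - of_real (al / eps)" by (simp only: of_real_minus)
  have "k1 * k2 = of_real ((s - al) / (2 * eps) * ((- al - s) / (2 * eps)))"
    by (simp only: k1_def k2_def of_real_mult)
  also have "(s - al) / (2 * eps) * ((- al - s) / (2 * eps)) = (al\<^sup>2 - s\<^sup>2) / (4 * eps\<^sup>2)"
    by (simp add: power2_eq_square algebra_simps)
  also have "\<dots> = d / eps" unfolding s(2) using eps by (simp add: power2_eq_square)
  finally have prod: "k1 * k2 = of_real (d / eps)" .
  have "half_L2 (\<lambda>t. complex_of_real (g t / eps))"
    using half_L2_complex_of_real[OF half_L2_scale(1)[OF g, of "1 / eps"]] by simp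
  from unstable_first_order_solution[OF k(1) this] obtain w
    where w0: "w 0 = of_real (s * q / eps)" and w: "half_L2 w"
    "\<And>t. t \<le> 0 \<Longrightarrow> (w has_vector_derivative k1 * w t + of_real (g t / eps)) (at t within {..0})" by metis
  show ?thesis
  proof (rule second_order_from_first_order[OF eps k(2) sum prod w])
    fix Y assume Y: "half_L2 (\<lambda>t. Re (Y t))" "mode_eq eps al d g (\<lambda>t. Re (Y t)) (\<lambda>t. Re (k2 * Y t + w t))"
    have "Re (k2 * Y 0 + w 0) = (- al - s) / (2 * eps) * Re (Y 0) + s * q / eps"
      unfolding w0 k2_def plus_complex.sel Re_complex_of_real scaleR_conv_of_real[symmetric] by simp
    hence "eps * Re (k2 * Y 0 + w 0) + (al + s) / 2 * Re (Y 0) = s * q"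
      using eps by (simp add: field_simps)
    from that[OF Y this] show ?thesis .
  qed
qed

lemma first_order_stable_mode_solvable:
  assumes d: "d > 0" and g: "half_L2 g"
  obtains y :: "real \<Rightarrow> real" where "half_L2 y"
    "\<And>t. t \<le> 0 \<Longrightarrow> (y has_real_derivative g t - d * y t) (at t within {..0})"
proof -
  define k where "k = - complex_of_real d"
  have "Re k < 0" using d by (simp add: k_def)
  thus ?thesis
  proof (rule stable_first_order_solution[OF _ half_L2_complex_of_real[OF g]])
    fix w assume w: "half_L2 w"
      "\<And>t. t \<le> 0 \<Longrightarrow> (w has_vector_derivative k * w t + of_real (g t)) (at t within {..0})"
    show ?thesis
    proof (rule that[of "\<lambda>t. Re (w t)"])
      show "((\<lambda>t. Re (w t)) has_real_derivative g t - d * Re (w t)) (at t within {..0})" if "t \<le> 0" for t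
        using has_real_derivative_Re[OF w(2)[OF that]] by (simp add: k_def)
    qed (rule half_L2_Re[OF w(1)])
  qed
qed

lemma first_order_unstable_mode_solvable:
  assumes d: "d < 0" and g: "half_L2 g"
  obtains y :: "real \<Rightarrow> real" where "half_L2 y" "y 0 = q"
    "\<And>t. t \<le> 0 \<Longrightarrow> (y has_real_derivative g t - d * y t) (at t within {..0})"
proof -
  define k where "k = - complex_of_real d"
  have "Re k > 0" using d by (simp add: k_def)
  thus ?thesis
  proof (rule unstable_first_order_solution[OF _ half_L2_complex_of_real[OF g], where ?w0.0 = "of_real q"])
    fix w assume w: "w 0 = of_real q" "half_L2 w"
      "\<And>t. t \<le> 0 \<Longrightarrow> (w has_vector_derivative k * w t + of_real (g t)) (at t within {..0})"
    show ?thesis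
    proof (rule that[of "\<lambda>t. Re (w t)"])
      show "((\<lambda>t. Re (w t)) has_real_derivative g t - d * Re (w t)) (at t within {..0})" if "t \<le> 0" for t
        using has_real_derivative_Re[OF w(3)[OF that]] by (simp add: k_def)
      show "half_L2 (\<lambda>t. Re (w t))" by (rule half_L2_Re[OF w(2)])
      show "Re (w 0) = q" by (simp add: w)
    qed
  qed
qed

section \<open>Sums and limits of square-integrable functions\<close>

lemma half_integral_sum:
  fixes f :: "'i \<Rightarrow> real \<Rightarrow> real"
  assumes "\<And>i. i \<in> I \<Longrightarrow> half_integrable (f i)"
  shows "half_integrable (\<lambda>t. \<Sum>i\<in>I. f i t)" "half_integral (\<lambda>t. \<Sum>i\<in>I. f i t) = (\<Sum>i\<in>I. half_integral (f i))"
  using assms unfolding set_integrable_def set_lebesgue_integral_def scaleR_sum_right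
  by (auto intro!: Bochner_Integration.integrable_sum Bochner_Integration.integral_sum)

lemma half_L2_weighted_add:
  fixes x y :: "real \<Rightarrow> 'b::real_normed_vector"
  assumes "half_L2 x" "half_L2 y" and \<eta>: "\<eta> > 0"
  shows "sqn (\<lambda>t. x t + y t) \<le> (1 + \<eta>) * sqn x + (1 + 1 / \<eta>) * sqn y"
proof -
  have i: "half_integrable (\<lambda>t. (1 + \<eta>) * (norm (x t))\<^sup>2 + (1 + 1 / \<eta>) * (norm (y t))\<^sup>2)"
    using assms by (intro set_integral_add set_integrable_mult_right) (auto simp: half_L2_def)
  have "sqn (\<lambda>t. x t + y t) \<le> half_integral (\<lambda>t. (1 + \<eta>) * (norm (x t))\<^sup>2 + (1 + 1 / \<eta>) * (norm (y t))\<^sup>2)"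
    by (rule half_L2_bound(2)[OF half_L2_cont[OF half_L2_add(1)[OF assms(1,2)]] i])
      (rule norm_add_sq_le_weighted[OF \<eta>])
  also have "\<dots> = (1 + \<eta>) * sqn x + (1 + 1 / \<eta>) * sqn y"
    using assms by (subst set_integral_add) (auto simp: half_L2_def)
  finally show ?thesis .
qed

text \<open>
  By Fatou's lemma; continuity of the limit supplies its measurability.
\<close>

lemma half_L2_limit:
  fixes Y :: "real \<Rightarrow> 'b::real_normed_vector"
  assumes X: "\<And>j. half_L2 (X j)" "\<And>j. sqn (X j) \<le> B"
    and lim: "\<And>t. t \<le> 0 \<Longrightarrow> (\<lambda>j. X j t) \<longlonglongrightarrow> Y t" and c: "continuous_on {..0} Y"
  shows "half_L2 Y" "sqn Y \<le> B"
proof -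
  define f where "f y t = indicator {..0} t * (norm (y t))\<^sup>2" for y :: "real \<Rightarrow> 'b" and t :: real
  have m: "f y \<in> borel_measurable lborel" if "continuous_on {..0} y" for y
    using borel_measurable_continuous_on_indicator[of "{..0}" "\<lambda>t. (norm (y t))\<^sup>2"] that
    by (simp add: f_def[abs_def] continuous_intros)
  have fX: "integrable lborel (f (X j))" "integral\<^sup>L lborel (f (X j)) = sqn (X j)" for j
    using half_L2_int[OF X(1)[of j]] by (simp_all add: set_integrable_def set_lebesgue_integral_def f_def[abs_def])
  have f0: "0 \<le> f y t" for y t by (simp add: f_def)
  have B0: "0 \<le> B" using order_trans[OF half_integral_nonneg X(2)] by simp
  have "(\<integral>\<^sup>+t. ennreal (f Y t) \<partial>lborel) = (\<integral>\<^sup>+t. liminf (\<lambda>j. ennreal (f (X j) t)) \<partial>lborel)"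
  proof (rule nn_integral_cong)
    fix t
    have "(\<lambda>j. ennreal (f (X j) t)) \<longlonglongrightarrow> ennreal (f Y t)"
      by (cases "t \<le> 0") (auto simp: f_def intro!: tendsto_intros tendsto_ennrealI lim)
    thus "ennreal (f Y t) = liminf (\<lambda>j. ennreal (f (X j) t))"
      by (intro lim_imp_Liminf[symmetric]) auto
  qed
  also have "\<dots> \<le> liminf (\<lambda>j. \<integral>\<^sup>+t. ennreal (f (X j) t) \<partial>lborel)"
    by (rule nn_integral_liminf) (use m half_L2_cont[OF X(1)] in simp)
  also have "\<dots> \<le> liminf (\<lambda>j. ennreal B)"
    by (rule Liminf_mono) (use X(2) f0 fX in \<open>auto simp: nn_integral_eq_integral intro!: always_eventually ennreal_leI\<close>)
  finally have le: "(\<integral>\<^sup>+t. ennreal (f Y t) \<partial>lborel) \<le> ennreal B" by (simp add: Liminf_const)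
  have int: "integrable lborel (f Y)"
    by (rule integrableI_nonneg[OF m[OF c]]) (use f0 le in \<open>auto simp: le_less_trans\<close>)
  thus "half_L2 Y" using c by (simp add: half_L2_def set_integrable_def f_def[abs_def])
  have "ennreal (integral\<^sup>L lborel (f Y)) \<le> ennreal B"
    using le nn_integral_eq_integral[OF int] f0 by simp
  hence "integral\<^sup>L lborel (f Y) \<le> B" using B0 by (simp add: ennreal_le_iff)
  thus "sqn Y \<le> B" by (simp add: set_lebesgue_integral_def f_def[abs_def])
qed

section \<open>Orthonormal expansions\<close>

lemma sum_Ico_le_tail:
  fixes \<beta> :: "nat \<Rightarrow> real"
  assumes "summable \<beta>" "\<And>n. 0 \<le> \<beta> n"
  shows "(\<Sum>n\<in>{m..<k}. \<beta> n) \<le> (\<Sum>n. \<beta> (n + m))"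
proof -
  have "(\<Sum>n\<in>{m..<k}. \<beta> n) = (\<Sum>n<k - m. \<beta> (n + m))"
  proof (cases "m \<le> k")
    case True thus ?thesis using sum.shift_bounds_nat_ivl[of \<beta> 0 m "k - m"] by (simp add: lessThan_atLeast0)
  qed auto
  also have "\<dots> \<le> (\<Sum>n. \<beta> (n + m))"
    by (rule sum_le_suminf) (use assms summable_iff_shift[of \<beta> m] in auto)
  finally show ?thesis .
qed

locale hilbert_basis =
  fixes b :: "nat \<Rightarrow> 'a::{real_inner, complete_space}"
  assumes orth: "b m \<bullet> b n = (if m = n then 1 else 0)"
    and total: "closure (span (range b)) = UNIV"
begin

lemma inner_partial: "(\<Sum>n<k. c n *\<^sub>R b n) \<bullet> b j = (if j < k then c j else 0)"
  by (simp add: inner_sum_left orth if_distrib sum.delta cong: if_cong)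

lemma norm_partial: "(norm (\<Sum>n<k. c n *\<^sub>R b n))\<^sup>2 = (\<Sum>n<k. (c n)\<^sup>2)"
  unfolding power2_norm_eq_inner inner_sum_right inner_scaleR_right
  by (intro sum.cong) (auto simp: inner_partial power2_eq_square)

lemma norm_partial_Ico: "(norm (\<Sum>n\<in>{m..<k}. c n *\<^sub>R b n))\<^sup>2 = (\<Sum>n\<in>{m..<k}. (c n)\<^sup>2)"
proof -
  define c' where "c' n = (if m \<le> n then c n else 0)" for n
  have eq: "(\<Sum>n<k. f (c' n) n) = (\<Sum>n\<in>{m..<k}. f (c n) n)" if "\<And>n. f 0 n = 0" for f :: "real \<Rightarrow> nat \<Rightarrow> 'x::comm_monoid_add"
    by (rule sum.mono_neutral_cong_right) (auto simp: c'_def that)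
  from norm_partial[of c' k] show ?thesis
    using eq[of "\<lambda>c n. c *\<^sub>R b n"] eq[of "\<lambda>c n. c\<^sup>2"] by simp
qed

lemma bessel: "(\<Sum>n<k. (x \<bullet> b n)\<^sup>2) \<le> (norm x)\<^sup>2"
proof -
  define P where "P = (\<Sum>n<k. (x \<bullet> b n) *\<^sub>R b n)"
  have "P \<bullet> P = x \<bullet> P"
    by (simp add: P_def inner_sum_right inner_partial power2_eq_square)
  hence "(norm (x - P))\<^sup>2 = (norm x)\<^sup>2 - (norm P)\<^sup>2"
    by (simp add: power2_norm_eq_inner inner_diff inner_commute)
  hence "(norm P)\<^sup>2 \<le> (norm x)\<^sup>2" using zero_le_power2[of "norm (x - P)"] by linarith
  thus ?thesis by (simp add: P_def norm_partial)
qed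

lemma norm_partial_le: "norm (\<Sum>n<k. (x \<bullet> b n) *\<^sub>R b n) \<le> norm x"
  by (rule power2_le_imp_le) (simp_all add: norm_partial bessel)

lemma expansion: "(\<lambda>k. \<Sum>n<k. (x \<bullet> b n) *\<^sub>R b n) \<longlonglongrightarrow> x"
proof -
  define P where "P k x = (\<Sum>n<k. (x \<bullet> b n) *\<^sub>R b n)" for k x
  define S where "S = {x. (\<lambda>k. P k x) \<longlonglongrightarrow> x}"
  have Padd: "P k (x + y) = P k x + P k y" "P k (r *\<^sub>R x) = r *\<^sub>R P k x" for k x y r
    by (simp_all add: P_def inner_add_left scaleR_add_left sum.distrib scaleR_sum_right)
  have Pdiff: "P k (x - y) = P k x - P k y" for k x y
    using Padd(1)[of k x "- y"] Padd(2)[of k "-1" y] by simp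
  have "range b \<subseteq> S"
  proof
    fix y assume "y \<in> range b" then obtain j where y: "y = b j" by auto
    have "\<forall>\<^sub>F k in sequentially. P k y = y"
    proof (rule eventually_sequentiallyI[of "Suc j"])
      fix k assume "Suc j \<le> k"
      have "P k y = (\<Sum>n<k. (if n = j then b n else 0))"
        unfolding P_def y by (intro sum.cong) (auto simp: orth)
      thus "P k y = y" using \<open>Suc j \<le> k\<close> by (simp add: y)
    qed
    thus "y \<in> S" unfolding S_def by (simp add: tendsto_eventually)
  qed
  moreover have "subspace S"
    unfolding subspace_def S_def by (auto simp: Padd P_def[of _ 0] intro!: tendsto_intros)
  ultimately have sub: "span (range b) \<subseteq> S" by (rule span_minimal)
  have "x \<in> closure (span (range b))" using total by simp
  have "(\<lambda>k. P k x) \<longlonglongrightarrow> x"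
  proof (rule LIMSEQ_I)
    fix r :: real assume r: "r > 0"
    obtain y where y: "y \<in> span (range b)" "dist y x < r / 3"
      using \<open>x \<in> closure _\<close> r unfolding closure_approachable by (metis divide_pos_pos zero_less_numeral)
    hence "(\<lambda>k. P k y) \<longlonglongrightarrow> y" using sub by (auto simp: S_def)
    then obtain k0 where k0: "\<And>k. k \<ge> k0 \<Longrightarrow> norm (P k y - y) < r / 3"
      using LIMSEQ_D[of "\<lambda>k. P k y" y "r / 3"] r by auto
    show "\<exists>k0. \<forall>k\<ge>k0. norm (P k x - x) < r"
    proof (intro exI allI impI)
      fix k assume "k0 \<le> k"
      have "norm (P k x - P k y) \<le> norm (x - y)"
        unfolding Pdiff[symmetric] unfolding P_def by (rule norm_partial_le)
      moreover have "norm (x - y) < r / 3" using y by (simp add: dist_norm norm_minus_commute)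
      moreover have "norm (P k x - x) \<le> norm (P k x - P k y) + norm (P k y - y) + norm (x - y)"
        using norm_triangle_ineq[of "P k x - P k y + (P k y - y)" "y - x"]
          norm_triangle_ineq[of "P k x - P k y" "P k y - y"] by (simp add: norm_minus_commute)
      ultimately show "norm (P k x - x) < r" using k0[OF \<open>k0 \<le> k\<close>] by linarith
    qed
  qed
  thus ?thesis by (simp add: P_def)
qed

lemma parseval: "(\<lambda>n. (x \<bullet> b n) * (y \<bullet> b n)) sums (x \<bullet> y)"
proof -
  have "(\<lambda>k. (\<Sum>n<k. (x \<bullet> b n) *\<^sub>R b n) \<bullet> y) \<longlonglongrightarrow> x \<bullet> y"
    by (intro tendsto_intros expansion)
  thus ?thesis by (simp add: sums_def inner_sum_left inner_commute[of y])
qed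

lemma parseval_norm: "(\<lambda>n. (x \<bullet> b n)\<^sup>2) sums (norm x)\<^sup>2"
  using parseval[of x x] by (simp add: power2_eq_square power2_norm_eq_inner[unfolded power2_eq_square])

lemma eqI: "(\<And>n. x \<bullet> b n = y \<bullet> b n) \<Longrightarrow> x = y"
  using LIMSEQ_unique[OF expansion[of x]] expansion[of y] by simp

lemma norm_le_partial:
  assumes "\<And>k. (\<Sum>n<k. (x \<bullet> b n)\<^sup>2) \<le> B"
  shows "(norm x)\<^sup>2 \<le> B"
  using parseval_norm[of x] assms unfolding sums_def by (intro LIMSEQ_le_const2) auto

text \<open>
  The Riesz--Fischer theorem with a parameter: uniformly small tails make the expansion converge
  uniformly.
\<close>

lemma continuous_from_coefficients:
  fixes c :: "nat \<Rightarrow> 'x::topological_space \<Rightarrow> real"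
  assumes c: "\<And>n. continuous_on S (c n)"
    and tail: "\<And>t m k. t \<in> S \<Longrightarrow> (\<Sum>n\<in>{m..<k}. (c n t)\<^sup>2) \<le> \<tau> m" and \<tau>: "\<tau> \<longlonglongrightarrow> 0"
  obtains u where "continuous_on S u" "\<And>t n. t \<in> S \<Longrightarrow> u t \<bullet> b n = c n t"
proof -
  define U where "U k t = (\<Sum>n<k. c n t *\<^sub>R b n)" for k t
  have diff: "norm (U k t - U m t) ^ 2 \<le> \<tau> m" if "m \<le> k" "t \<in> S" for m k t
  proof -
    have "U k t = U m t + (\<Sum>n\<in>{m..<k}. c n t *\<^sub>R b n)"
      unfolding U_def lessThan_atLeast0 using sum.atLeastLessThan_concat[of 0 m k "\<lambda>n. c n t *\<^sub>R b n"] that by simp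
    thus ?thesis using tail[OF that(2)] by (simp add: norm_partial_Ico)
  qed
  have "uniformly_Cauchy_on S U"
  proof (rule uniformly_Cauchy_onI')
    fix r :: real assume r: "r > 0"
    obtain M where M: "\<And>m. m \<ge> M \<Longrightarrow> norm (\<tau> m - 0) < r\<^sup>2"
      using LIMSEQ_D[OF \<tau>, of "r\<^sup>2"] r by auto
    show "\<exists>M. \<forall>x\<in>S. \<forall>m\<ge>M. \<forall>n>m. dist (U m x) (U n x) < r"
    proof (intro exI ballI allI impI)
      fix t m n assume "t \<in> S" "M \<le> m" "m < n"
      hence "norm (U n t - U m t) ^ 2 < r\<^sup>2" using diff[of m n t] M[of m] by auto
      thus "dist (U m t) (U n t) < r"
        using r by (simp add: dist_norm norm_minus_commute power2_less_imp_less)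
    qed
  qed
  then obtain u where u: "uniform_limit S U u sequentially"
    using Cauchy_uniformly_convergent unfolding uniformly_convergent_on_def by blast
  show ?thesis
  proof (rule that[of u])
    show "continuous_on S u"
      by (rule uniform_limit_theorem[OF _ u])
        (auto simp: U_def intro!: always_eventually continuous_on_sum continuous_on_scaleR c)
    show "u t \<bullet> b n = c n t" if "t \<in> S" for t n
    proof -
      have "(\<lambda>k. U k t \<bullet> b n) \<longlonglongrightarrow> u t \<bullet> b n"
        by (intro tendsto_intros tendsto_uniform_limitI[OF u that])
      moreover have "(\<lambda>k. U k t \<bullet> b n) \<longlonglongrightarrow> c n t"
        by (rule tendsto_eventually, rule eventually_sequentiallyI[of "Suc n"]) (simp add: U_def inner_partial)
      ultimately show ?thesis by (rule LIMSEQ_unique)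
    qed
  qed
qed

lemma half_L2_inner:
  assumes u: "half_L2 u" shows "half_L2 (\<lambda>t. u t \<bullet> x)"
proof (rule half_L2_bound(1)[of _ "\<lambda>t. (norm x)\<^sup>2 * (norm (u t))\<^sup>2"])
  show "(norm (u t \<bullet> x))\<^sup>2 \<le> (norm x)\<^sup>2 * (norm (u t))\<^sup>2" for t
    using Cauchy_Schwarz_ineq[of "u t" x] by (simp add: power2_norm_eq_inner mult.commute)
qed (use u in \<open>auto simp: half_L2_def intro!: continuous_intros\<close>)

lemma sqn_partial:
  assumes u: "half_L2 u"
  shows "(\<Sum>n<k. sqn (\<lambda>t. u t \<bullet> b n)) \<le> sqn u"
proof -
  have i: "half_integrable (\<lambda>t. (norm (u t \<bullet> b n))\<^sup>2)" for n
    by (rule half_L2_int[OF half_L2_inner[OF u]])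
  have "(\<Sum>n<k. sqn (\<lambda>t. u t \<bullet> b n)) = half_integral (\<lambda>t. \<Sum>n<k. (norm (u t \<bullet> b n))\<^sup>2)"
    by (rule half_integral_sum(2)[symmetric]) (rule i)
  also have "\<dots> \<le> sqn u"
    by (rule half_integral_mono[OF half_integral_sum(1) half_L2_int[OF u]])
      (use i bessel in \<open>auto\<close>)
  finally show ?thesis .
qed

lemma sqn_le_partial:
  assumes c: "continuous_on {..0} u" and i: "\<And>n. half_L2 (\<lambda>t. u t \<bullet> b n)"
    and le: "\<And>k. (\<Sum>n<k. sqn (\<lambda>t. u t \<bullet> b n)) \<le> B"
  shows "half_L2 u" "sqn u \<le> B"
proof -
  define X where "X k t = (\<Sum>n<k. (u t \<bullet> b n) *\<^sub>R b n)" for k t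
  have Xn: "(\<lambda>t. (norm (X k t))\<^sup>2) = (\<lambda>t. \<Sum>n<k. (norm (u t \<bullet> b n))\<^sup>2)" for k
    by (simp add: X_def norm_partial)
  have Xc: "continuous_on {..0} (X k)" for k
    unfolding X_def by (intro continuous_intros c)
  have X2: "half_L2 (X k)" for k
    unfolding half_L2_def Xn using Xc half_integral_sum(1)[of "{..<k}" "\<lambda>n t. (norm (u t \<bullet> b n))\<^sup>2"] half_L2_int[OF i]
    by simp
  have XB: "sqn (X k) \<le> B" for k
    unfolding Xn using half_integral_sum(2)[of "{..<k}" "\<lambda>n t. (norm (u t \<bullet> b n))\<^sup>2"] half_L2_int[OF i] le[of k]
    by simp
  show "half_L2 u" "sqn u \<le> B"
    using half_L2_limit[where X = X and Y = u, OF X2 XB] expansion c by (auto simp: X_def)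
qed

end

section \<open>Fixed points of problems that decouple into modes\<close>

text \<open>
  An abstract setting that covers both the wave and the parabolic equation.  The relation \<open>sol n y g\<close> says
  that \<open>y\<close> solves the linear scalar problem of mode \<open>n\<close> with right-hand side \<open>g\<close>, boundary data included; two
  solutions differ by at most \<open>1/dl\<close> times the difference of the right-hand sides in \<open>L\<^sup>2\<close>, and they are
  also close pointwise.  The nonlinearity \<open>G\<close> is Lipschitz with a constant below \<open>dl\<close>.
\<close>

locale modal_problem = hilbert_basis b for b :: "nat \<Rightarrow> 'a::{real_inner, complete_space}" +
  fixes sol :: "nat \<Rightarrow> (real \<Rightarrow> real) \<Rightarrow> (real \<Rightarrow> real) \<Rightarrow> bool"
    and dl K L :: real and N :: nat and G :: "real \<Rightarrow> 'a \<Rightarrow> 'a"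
  assumes sol_exists: "half_L2 g \<Longrightarrow> \<exists>y. half_L2 y \<and> sol n y g"
    and sol_cong: "sol n y g \<Longrightarrow> (\<And>t. t \<le> 0 \<Longrightarrow> y t = y' t) \<Longrightarrow> (\<And>t. t \<le> 0 \<Longrightarrow> g t = g' t) \<Longrightarrow> sol n y' g'"
    and sol_L2: "sol n y g \<Longrightarrow> sol n y' g' \<Longrightarrow> half_L2 y \<Longrightarrow> half_L2 y' \<Longrightarrow> half_L2 g \<Longrightarrow> half_L2 g' \<Longrightarrow>
       dl\<^sup>2 * sqn (\<lambda>t. y t - y' t) \<le> sqn (\<lambda>t. g t - g' t)"
    and sol_sup: "sol n y g \<Longrightarrow> sol n y' g' \<Longrightarrow> half_L2 y \<Longrightarrow> half_L2 y' \<Longrightarrow> half_L2 g \<Longrightarrow> half_L2 g' \<Longrightarrow>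
       t \<le> 0 \<Longrightarrow> (y t - y' t)\<^sup>2 \<le> K * sqn (\<lambda>t. g t - g' t)"
    and sol_zero: "N \<le> n \<Longrightarrow> sol n (\<lambda>t. 0) (\<lambda>t. 0)"
    and L: "0 \<le> L" "L < dl" and K: "0 \<le> K"
    and G_lip: "t \<le> 0 \<Longrightarrow> norm (G t u - G t v) \<le> L * norm (u - v)" and G0: "t \<le> 0 \<Longrightarrow> G t 0 = 0"
    and G_cont: "continuous_on {..0} Y \<Longrightarrow> continuous_on {..0} (\<lambda>t. G t (Y t))"
begin

lemma dl: "0 < dl" using L by linarith

definition Sol :: "(real \<Rightarrow> 'a) \<Rightarrow> (real \<Rightarrow> 'a) \<Rightarrow> bool" where
  "Sol Y g \<longleftrightarrow> (\<forall>n. sol n (\<lambda>t. Y t \<bullet> b n) (\<lambda>t. g t \<bullet> b n))"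

lemma Sol_diff:
  assumes S: "Sol Y g" "Sol Y' g'" and h: "half_L2 Y" "half_L2 Y'" "half_L2 g" "half_L2 g'"
  shows "dl\<^sup>2 * sqn (\<lambda>t. Y t - Y' t) \<le> sqn (\<lambda>t. g t - g' t)"
    "t \<le> 0 \<Longrightarrow> (norm (Y t - Y' t))\<^sup>2 \<le> K * sqn (\<lambda>t. g t - g' t)"
proof -
  note i = half_L2_inner
  have part: "(\<Sum>n<k. sqn (\<lambda>t. (g t - g' t) \<bullet> b n)) \<le> sqn (\<lambda>t. g t - g' t)" for k
    by (rule sqn_partial[OF half_L2_diff[OF h(3,4)]])
  have "sqn (\<lambda>t. Y t - Y' t) \<le> sqn (\<lambda>t. g t - g' t) / dl\<^sup>2"
  proof (rule sqn_le_partial(2))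
    show "continuous_on {..0} (\<lambda>t. Y t - Y' t)" by (rule half_L2_cont[OF half_L2_diff[OF h(1,2)]])
    show "half_L2 (\<lambda>t. (Y t - Y' t) \<bullet> b n)" for n by (rule i[OF half_L2_diff[OF h(1,2)]])
    show "(\<Sum>n<k. sqn (\<lambda>t. (Y t - Y' t) \<bullet> b n)) \<le> sqn (\<lambda>t. g t - g' t) / dl\<^sup>2" for k
    proof -
      have "dl\<^sup>2 * sqn (\<lambda>t. (Y t - Y' t) \<bullet> b n) \<le> sqn (\<lambda>t. (g t - g' t) \<bullet> b n)" for n
        unfolding inner_diff_left using S h by (intro sol_L2) (auto simp: Sol_def intro: i)
      hence "dl\<^sup>2 * (\<Sum>n<k. sqn (\<lambda>t. (Y t - Y' t) \<bullet> b n)) \<le> (\<Sum>n<k. sqn (\<lambda>t. (g t - g' t) \<bullet> b n))"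
        unfolding sum_distrib_left by (intro sum_mono)
      also note part
      finally show ?thesis using dl by (simp add: field_simps)
    qed
  qed
  thus "dl\<^sup>2 * sqn (\<lambda>t. Y t - Y' t) \<le> sqn (\<lambda>t. g t - g' t)" using dl by (simp add: field_simps)
  assume t: "t \<le> 0"
  show "(norm (Y t - Y' t))\<^sup>2 \<le> K * sqn (\<lambda>t. g t - g' t)"
  proof (rule norm_le_partial)
    fix k
    have "((Y t - Y' t) \<bullet> b n)\<^sup>2 \<le> K * sqn (\<lambda>t. (g t - g' t) \<bullet> b n)" for n
      unfolding inner_diff_left using S h t by (intro sol_sup) (auto simp: Sol_def intro: i)
    hence "(\<Sum>n<k. ((Y t - Y' t) \<bullet> b n)\<^sup>2) \<le> K * (\<Sum>n<k. sqn (\<lambda>t. (g t - g' t) \<bullet> b n))"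
      unfolding sum_distrib_left by (intro sum_mono)
    also have "\<dots> \<le> K * sqn (\<lambda>t. g t - g' t)" by (rule mult_left_mono[OF part K])
    finally show "(\<Sum>n<k. ((Y t - Y' t) \<bullet> b n)\<^sup>2) \<le> K * sqn (\<lambda>t. g t - g' t)" .
  qed
qed

text \<open>
  A finite sum suffices, because boundary data occur in the modes below \<open>N\<close> only.
\<close>

lemma base_solution:
  obtains Y0 where "half_L2 Y0" "Sol Y0 (\<lambda>t. 0)"
proof -
  have z: "half_L2 (\<lambda>t. 0::real)" by (simp add: half_L2_def set_integrable_def)
  have "\<forall>n. \<exists>y. half_L2 y \<and> sol n y (\<lambda>t. 0)" using sol_exists[OF z] by blast
  then obtain y where y: "\<And>n. half_L2 (y n)" "\<And>n. sol n (y n) (\<lambda>t. 0)" by metis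
  define Y0 where "Y0 t = (\<Sum>n<N. y n t *\<^sub>R b n)" for t
  have sq: "(norm (Y0 t))\<^sup>2 = (\<Sum>n<N. (norm (y n t))\<^sup>2)" for t by (simp add: Y0_def norm_partial)
  have "continuous_on {..0} Y0" unfolding Y0_def by (intro continuous_intros half_L2_cont y)
  moreover have "half_integrable (\<lambda>t. \<Sum>n<N. (norm (y n t))\<^sup>2)"
    by (rule half_integral_sum) (rule half_L2_int[OF y(1)])
  ultimately have "half_L2 Y0" by (simp add: half_L2_def sq)
  moreover have "Sol Y0 (\<lambda>t. 0)"
    unfolding Sol_def
  proof
    fix n show "sol n (\<lambda>t. Y0 t \<bullet> b n) (\<lambda>t. 0 \<bullet> b n)"
      using y(2)[of n] sol_zero[of n] by (cases "n < N") (simp_all add: Y0_def inner_partial)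
  qed
  ultimately show ?thesis by (rule that)
qed

lemma Sol_exists:
  assumes g: "half_L2 g"
  obtains Y where "half_L2 Y" "Sol Y g"
proof -
  note i = half_L2_inner
  obtain Y0 where "half_L2 Y0" "Sol Y0 (\<lambda>t. 0)" by (rule base_solution)
  hence Y0: "half_L2 Y0" "\<And>n. sol n (\<lambda>t. Y0 t \<bullet> b n) (\<lambda>t. 0)" by (simp_all add: Sol_def)
  have "\<forall>n. \<exists>y. half_L2 y \<and> sol n y (\<lambda>t. g t \<bullet> b n)" using sol_exists[OF i[OF g]] by blast
  then obtain y where y: "\<And>n. half_L2 (y n)" "\<And>n. sol n (y n) (\<lambda>t. g t \<bullet> b n)" by metis
  define c where "c n t = y n t - Y0 t \<bullet> b n" for n t
  define \<gamma> where "\<gamma> n = sqn (\<lambda>t. g t \<bullet> b n)" for n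
  have z: "half_L2 (\<lambda>t. 0::real)" by (simp add: half_L2_def set_integrable_def)
  have c2: "half_L2 (c n)" for n unfolding c_def[abs_def] by (rule half_L2_diff[OF y(1) i[OF Y0(1)]])
  have cL: "dl\<^sup>2 * sqn (c n) \<le> \<gamma> n" for n
    using sol_L2[OF y(2) Y0(2) y(1) i[OF Y0(1)] i[OF g] z] by (simp add: c_def[abs_def] \<gamma>_def)
  have cS: "(c n t)\<^sup>2 \<le> K * \<gamma> n" if "t \<le> 0" for n t
    using sol_sup[OF y(2) Y0(2) y(1) i[OF Y0(1)] i[OF g] z that] by (simp add: c_def[abs_def] \<gamma>_def)
  have \<gamma>0: "0 \<le> \<gamma> n" for n unfolding \<gamma>_def by (rule half_integral_nonneg) simp
  have \<gamma>p: "(\<Sum>n<k. \<gamma> n) \<le> sqn g" for k unfolding \<gamma>_def by (rule sqn_partial[OF g])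
  have \<gamma>s: "summable \<gamma>" using \<gamma>0 \<gamma>p by (rule summableI_nonneg_bounded)
  obtain w where w: "continuous_on {..0} w" "\<And>t n. t \<in> {..0} \<Longrightarrow> w t \<bullet> b n = c n t"
  proof (rule continuous_from_coefficients[of "{..0}" c "\<lambda>m. K * (\<Sum>n. \<gamma> (n + m))"])
    show "continuous_on {..0} (c n)" for n by (rule half_L2_cont[OF c2])
    show "(\<lambda>m. K * (\<Sum>n. \<gamma> (n + m))) \<longlonglongrightarrow> 0"
      using tendsto_mult_right_zero[OF suminf_exist_split2[OF \<gamma>s]] by simp
    fix t :: real and m k :: nat assume t: "t \<in> {..0}"
    have "(\<Sum>n\<in>{m..<k}. (c n t)\<^sup>2) \<le> K * (\<Sum>n\<in>{m..<k}. \<gamma> n)"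
      unfolding sum_distrib_left using cS t by (intro sum_mono) auto
    also have "(\<Sum>n\<in>{m..<k}. \<gamma> n) \<le> (\<Sum>n. \<gamma> (n + m))" by (rule sum_Ico_le_tail[OF \<gamma>s \<gamma>0])
    finally show "(\<Sum>n\<in>{m..<k}. (c n t)\<^sup>2) \<le> K * (\<Sum>n. \<gamma> (n + m))" using K by (simp add: mult_left_mono)
  qed (use that in blast)
  have wsq: "sqn (\<lambda>t. w t \<bullet> b n) = sqn (c n)" for n
    by (rule set_lebesgue_integral_cong) (use w(2) in auto)
  have w2: "half_L2 (\<lambda>t. w t \<bullet> b n)" for n
    by (rule half_L2_bound(1)[OF _ half_L2_int[OF c2[of n]]]) (use w in \<open>auto intro!: continuous_intros\<close>)
  have W: "half_L2 w"
  proof (rule sqn_le_partial(1)[OF w(1) w2])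
    fix k
    have "dl\<^sup>2 * (\<Sum>n<k. sqn (\<lambda>t. w t \<bullet> b n)) \<le> (\<Sum>n<k. \<gamma> n)"
      unfolding sum_distrib_left wsq by (intro sum_mono cL)
    also note \<gamma>p
    finally show "(\<Sum>n<k. sqn (\<lambda>t. w t \<bullet> b n)) \<le> sqn g / dl\<^sup>2" using dl by (simp add: field_simps)
  qed
  show ?thesis
  proof (rule that)
    show "half_L2 (\<lambda>t. Y0 t + w t)" by (rule half_L2_add[OF Y0(1) W])
    show "Sol (\<lambda>t. Y0 t + w t) g"
      unfolding Sol_def using w(2) by (auto intro!: sol_cong[OF y(2)] simp: inner_add_left c_def)
  qed
qed

lemma G_L2:
  assumes Y: "half_L2 Y" shows "half_L2 (\<lambda>t. G t (Y t))"
proof (rule half_L2_bound(1)[OF G_cont[OF half_L2_cont[OF Y]]])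
  show "half_integrable (\<lambda>t. L\<^sup>2 * (norm (Y t))\<^sup>2)" using half_L2_int[OF Y] by simp
  show "(norm (G t (Y t)))\<^sup>2 \<le> L\<^sup>2 * (norm (Y t))\<^sup>2" if "t \<le> 0" for t
    using G_lip[OF that, of "Y t" 0] G0[OF that] by (simp flip: power_mult_distrib add: power_mono)
qed

lemma G_diff:
  assumes "half_L2 Y" "half_L2 Z"
  shows "sqn (\<lambda>t. G t (Y t) - G t (Z t)) \<le> L\<^sup>2 * sqn (\<lambda>t. Y t - Z t)"
proof -
  have "sqn (\<lambda>t. G t (Y t) - G t (Z t)) \<le> half_integral (\<lambda>t. L\<^sup>2 * (norm (Y t - Z t))\<^sup>2)"
  proof (rule half_L2_bound(2))
    show "continuous_on {..0} (\<lambda>t. G t (Y t) - G t (Z t))"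
      by (rule half_L2_cont[OF half_L2_diff[OF G_L2[OF assms(1)] G_L2[OF assms(2)]]])
    show "half_integrable (\<lambda>t. L\<^sup>2 * (norm (Y t - Z t))\<^sup>2)"
      using half_L2_int[OF half_L2_diff[OF assms]] by simp
    show "(norm (G t (Y t) - G t (Z t)))\<^sup>2 \<le> L\<^sup>2 * (norm (Y t - Z t))\<^sup>2" if "t \<le> 0" for t
      using G_lip[OF that] by (simp flip: power_mult_distrib add: power_mono)
  qed
  thus ?thesis by simp
qed

definition rho where "rho = L\<^sup>2 / dl\<^sup>2"

lemma rho: "0 \<le> rho" "rho < 1"
  using L dl by (auto simp: rho_def power_strict_mono)

lemma Sol_contraction:
  assumes "Sol Y (\<lambda>t. G t (X t))" "Sol Y' (\<lambda>t. G t (X' t))"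
    and h: "half_L2 Y" "half_L2 Y'" "half_L2 X" "half_L2 X'"
  shows "sqn (\<lambda>t. Y t - Y' t) \<le> rho * sqn (\<lambda>t. X t - X' t)"
    "t \<le> 0 \<Longrightarrow> (norm (Y t - Y' t))\<^sup>2 \<le> K * L\<^sup>2 * sqn (\<lambda>t. X t - X' t)"
proof -
  have "dl\<^sup>2 * sqn (\<lambda>t. Y t - Y' t) \<le> L\<^sup>2 * sqn (\<lambda>t. X t - X' t)"
    using Sol_diff(1)[OF assms(1,2) h(1,2) G_L2[OF h(3)] G_L2[OF h(4)]] G_diff[OF h(3,4)] by linarith
  thus "sqn (\<lambda>t. Y t - Y' t) \<le> rho * sqn (\<lambda>t. X t - X' t)"
    using dl by (simp add: rho_def field_simps)
  assume t: "t \<le> 0"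
  have "(norm (Y t - Y' t))\<^sup>2 \<le> K * sqn (\<lambda>t. G t (X t) - G t (X' t))"
    by (rule Sol_diff(2)[OF assms(1,2) h(1,2) G_L2[OF h(3)] G_L2[OF h(4)] t])
  also have "\<dots> \<le> K * (L\<^sup>2 * sqn (\<lambda>t. X t - X' t))" by (rule mult_left_mono[OF G_diff[OF h(3,4)] K])
  finally show "(norm (Y t - Y' t))\<^sup>2 \<le> K * L\<^sup>2 * sqn (\<lambda>t. X t - X' t)" by (simp add: mult.assoc)
qed

lemma fixed_point_unique:
  assumes "Sol Y (\<lambda>t. G t (Y t))" "Sol Z (\<lambda>t. G t (Z t))" "half_L2 Y" "half_L2 Z" "t \<le> 0"
  shows "Y t = Z t"
proof -
  have "sqn (\<lambda>t. Y t - Z t) \<le> rho * sqn (\<lambda>t. Y t - Z t)"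
    by (rule Sol_contraction(1)[OF assms(1-4) assms(3,4)])
  hence "(1 - rho) * sqn (\<lambda>t. Y t - Z t) \<le> 0" by (simp add: algebra_simps)
  hence "sqn (\<lambda>t. Y t - Z t) \<le> 0" using rho by (simp add: mult_le_0_iff)
  hence "K * L\<^sup>2 * sqn (\<lambda>t. Y t - Z t) \<le> 0" using K by (simp add: mult_nonneg_nonpos)
  hence "(norm (Y t - Z t))\<^sup>2 \<le> 0"
    using Sol_contraction(2)[OF assms(1-4) assms(3,4) assms(5)] by linarith
  thus ?thesis by simp
qed

text \<open>
  Picard iteration.  The map is a contraction in \<open>L\<^sup>2\<close>, but the pointwise bound by the \<open>L\<^sup>2\<close> norm of the
  right-hand side makes the iterates converge uniformly, so their limit exists by completeness
  of \<open>H\<close> and is continuous.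
\<close>

lemma fixed_point_exists:
  obtains Y where "half_L2 Y" "Sol Y (\<lambda>t. G t (Y t))"
proof -
  define T where "T X = (SOME Y. half_L2 Y \<and> Sol Y (\<lambda>t. G t (X t)))" for X
  have T: "half_L2 (T X)" "Sol (T X) (\<lambda>t. G t (X t))" if "half_L2 X" for X
  proof -
    have "\<exists>Y. half_L2 Y \<and> Sol Y (\<lambda>t. G t (X t))" using Sol_exists[OF G_L2[OF that]] by blast
    from someI_ex[OF this] show "half_L2 (T X)" "Sol (T X) (\<lambda>t. G t (X t))" by (auto simp: T_def)
  qed
  obtain Y0 where Y0: "half_L2 Y0" "Sol Y0 (\<lambda>t. 0)" by (rule base_solution)
  define Y where "Y k = (T ^^ k) Y0" for k
  have Ys: "Y (Suc k) = T (Y k)" for k by (simp add: Y_def)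
  have YL: "half_L2 (Y k)" for k by (induction k) (simp_all add: Y_def Y0 T)
  have YS: "Sol (Y (Suc k)) (\<lambda>t. G t (Y k t))" for k unfolding Ys by (rule T(2)[OF YL])
  note con = Sol_contraction[OF YS YS YL YL YL YL]
  obtain \<eta> where \<eta>: "\<eta> > 0" "(1 + \<eta>) * rho < 1"
  proof
    show "1 - rho > 0" using rho by simp
    have "1 - (1 + (1 - rho)) * rho = (1 - rho)\<^sup>2" by (simp add: power2_eq_square algebra_simps)
    moreover have "(1 - rho)\<^sup>2 > 0" using rho by simp
    ultimately show "(1 + (1 - rho)) * rho < 1" by linarith
  qed
  define C where "C = (1 + 1 / \<eta>) * sqn (\<lambda>t. Y 1 t - Y 0 t)"
  define B where "B = C / (1 - (1 + \<eta>) * rho)"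
  have C0: "0 \<le> C" unfolding C_def using \<eta> by (intro mult_nonneg_nonneg half_integral_nonneg) auto
  have B0: "0 \<le> B" unfolding B_def using C0 \<eta> by simp
  \<comment> \<open>the iterates stay in a ball around the start, so the contraction makes the tails geometrically small\<close>
  have Bj: "sqn (\<lambda>t. Y j t - Y 0 t) \<le> B" for j
  proof (induction j)
    case 0 thus ?case using B0 by simp
  next
    case (Suc j)
    have "sqn (\<lambda>t. (Y (Suc j) t - Y (Suc 0) t) + (Y (Suc 0) t - Y 0 t))
       \<le> (1 + \<eta>) * sqn (\<lambda>t. Y (Suc j) t - Y (Suc 0) t) + (1 + 1 / \<eta>) * sqn (\<lambda>t. Y (Suc 0) t - Y 0 t)"
      by (rule half_L2_weighted_add) (use \<eta> half_L2_diff YL in auto)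
    also have "\<dots> \<le> (1 + \<eta>) * (rho * B) + C"
    proof (rule add_mono)
      have "sqn (\<lambda>t. Y (Suc j) t - Y (Suc 0) t) \<le> rho * B"
        by (rule order_trans[OF con(1) mult_left_mono[OF Suc.IH]]) (use rho in simp)
      thus "(1 + \<eta>) * sqn (\<lambda>t. Y (Suc j) t - Y (Suc 0) t) \<le> (1 + \<eta>) * (rho * B)"
        using \<eta> by (intro mult_left_mono) auto
    qed (simp add: C_def)
    also have "\<dots> = B"
    proof -
      have "B * (1 - (1 + \<eta>) * rho) = C" using \<eta> by (simp add: B_def)
      thus ?thesis by (simp add: algebra_simps)
    qed
    finally show ?case by simp
  qed
  have geo: "sqn (\<lambda>t. Y (k + j) t - Y k t) \<le> rho ^ k * B" for k j
  proof (induction k)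
    case 0 thus ?case using Bj by simp
  next
    case (Suc k)
    have "sqn (\<lambda>t. Y (Suc (k + j)) t - Y (Suc k) t) \<le> rho * sqn (\<lambda>t. Y (k + j) t - Y k t)" by (rule con(1))
    also have "\<dots> \<le> rho * (rho ^ k * B)" by (rule mult_left_mono[OF Suc.IH]) (use rho in simp)
    finally show ?case by simp
  qed
  define M where "M = K * L\<^sup>2 * B"
  have M0: "0 \<le> M" unfolding M_def using K B0 by simp
  have sup: "(norm (Y (Suc (k + j)) t - Y (Suc k) t))\<^sup>2 \<le> M * rho ^ k" if "t \<le> 0" for k j t
  proof -
    have "(norm (Y (Suc (k + j)) t - Y (Suc k) t))\<^sup>2 \<le> K * L\<^sup>2 * sqn (\<lambda>t. Y (k + j) t - Y k t)"
      by (rule con(2)[OF that])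
    also have "\<dots> \<le> K * L\<^sup>2 * (rho ^ k * B)" by (rule mult_left_mono[OF geo]) (use K in simp)
    finally show ?thesis by (simp add: M_def mult_ac)
  qed
  have lim0: "(\<lambda>k. M * rho ^ k) \<longlonglongrightarrow> 0"
    using tendsto_mult_right_zero[OF LIMSEQ_realpow_zero[OF rho]] by simp
  have "uniformly_Cauchy_on {..0} (\<lambda>k. Y (Suc k))"
  proof (rule uniformly_Cauchy_onI')
    fix r :: real assume r: "r > 0"
    obtain k0 where k0: "\<And>k. k \<ge> k0 \<Longrightarrow> norm (M * rho ^ k - 0) < r\<^sup>2"
      using LIMSEQ_D[OF lim0, of "r\<^sup>2"] r by auto
    show "\<exists>k0. \<forall>t\<in>{..0}. \<forall>m\<ge>k0. \<forall>n>m. dist (Y (Suc m) t) (Y (Suc n) t) < r"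
    proof (intro exI ballI allI impI)
      fix t :: real and m n assume "t \<in> {..0}" "k0 \<le> m" "m < n"
      hence "(norm (Y (Suc n) t - Y (Suc m) t))\<^sup>2 < r\<^sup>2"
        using sup[of t m "n - m"] k0[of m] by auto
      thus "dist (Y (Suc m) t) (Y (Suc n) t) < r"
        using r by (simp add: dist_norm norm_minus_commute power2_less_imp_less)
    qed
  qed
  then obtain Z where Z: "uniform_limit {..0} (\<lambda>k. Y (Suc k)) Z sequentially"
    using Cauchy_uniformly_convergent unfolding uniformly_convergent_on_def by blast
  have Zc: "continuous_on {..0} Z"
    by (rule uniform_limit_theorem[OF _ Z]) (auto intro!: always_eventually half_L2_cont YL)
  have Zlim: "(\<lambda>k. Y (Suc k) t) \<longlonglongrightarrow> Z t" if "t \<le> 0" for t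
    by (rule tendsto_uniform_limitI[OF Z]) (use that in simp)
  have ZY: "half_L2 (\<lambda>t. Z t - Y k t)" "sqn (\<lambda>t. Z t - Y k t) \<le> rho ^ k * B" for k
  proof -
    have a: "half_L2 (\<lambda>t. Y (k + Suc j) t - Y k t)" "sqn (\<lambda>t. Y (k + Suc j) t - Y k t) \<le> rho ^ k * B" for j
      by (rule half_L2_diff[OF YL YL], rule geo)
    have b: "(\<lambda>j. Y (k + Suc j) t - Y k t) \<longlonglongrightarrow> Z t - Y k t" if "t \<le> 0" for t
      using LIMSEQ_ignore_initial_segment[OF Zlim[OF that], of k] by (intro tendsto_intros) (simp add: add.commute)
    have c: "continuous_on {..0} (\<lambda>t. Z t - Y k t)" by (intro continuous_intros Zc half_L2_cont YL)
    show "half_L2 (\<lambda>t. Z t - Y k t)" "sqn (\<lambda>t. Z t - Y k t) \<le> rho ^ k * B"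
      by (rule half_L2_limit[where X = "\<lambda>j t. Y (k + Suc j) t - Y k t", OF a b c]; assumption)+
  qed
  have ZL: "half_L2 Z" using half_L2_add(1)[OF ZY(1)[of 0] YL[of 0]] by simp
  have TZ: "T Z t = Z t" if t: "t \<le> 0" for t
  proof -
    have "(norm (T Z t - Y (Suc k) t))\<^sup>2 \<le> M * rho ^ k" for k
    proof -
      have "(norm (T Z t - Y (Suc k) t))\<^sup>2 \<le> K * L\<^sup>2 * sqn (\<lambda>t. Z t - Y k t)"
        by (rule Sol_contraction(2)[OF T(2)[OF ZL] YS T(1)[OF ZL] YL ZL YL t])
      also have "\<dots> \<le> K * L\<^sup>2 * (rho ^ k * B)" by (rule mult_left_mono[OF ZY(2)]) (use K in simp)
      finally show ?thesis by (simp add: M_def mult_ac)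
    qed
    moreover have "(\<lambda>k. (norm (T Z t - Y (Suc k) t))\<^sup>2) \<longlonglongrightarrow> (norm (T Z t - Z t))\<^sup>2"
      by (intro tendsto_intros Zlim t)
    ultimately have "(norm (T Z t - Z t))\<^sup>2 \<le> 0"
      by (intro LIMSEQ_le[OF _ lim0]) auto
    thus ?thesis by simp
  qed
  have "Sol Z (\<lambda>t. G t (Z t))"
    using T(2)[OF ZL] TZ unfolding Sol_def by (auto intro: sol_cong)
  thus ?thesis using that ZL by blast
qed

end

section \<open>Mean value estimates from coefficients\<close>

context hilbert_basis
begin

text \<open>
  The mean value inequality for the first \<open>m\<close> coefficients.  The scalar mean value theorem is applied to the
  pairing of \<open>C\<close> with the vector \<open>y\<close> that is to be estimated.
\<close>

lemma modes_mean_value: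
  fixes C :: "nat \<Rightarrow> real \<Rightarrow> real" and c :: "real \<Rightarrow> 'a"
  assumes D: "\<And>n r. s \<le> r \<Longrightarrow> r \<le> t \<Longrightarrow> (C n has_real_derivative c r \<bullet> b n) (at r within {..0})"
    and st: "s \<le> t" "t \<le> 0" and M: "\<And>r. s \<le> r \<Longrightarrow> r \<le> t \<Longrightarrow> norm (c r - x) \<le> M"
  shows "(\<Sum>n<m. (C n t - C n s - (t - s) * (x \<bullet> b n))\<^sup>2) \<le> (M * (t - s))\<^sup>2"
proof (cases "s = t")
  case False
  hence "s < t" using st by simp
  define a where "a n = C n t - C n s - (t - s) * (x \<bullet> b n)" for n
  define y where "y = (\<Sum>n<m. a n *\<^sub>R b n)"
  define \<phi> where "\<phi> r = (\<Sum>n<m. a n * (C n r - r * (x \<bullet> b n)))" for r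
  have "\<exists>r\<in>{s<..<t}. \<phi> t - \<phi> s = (\<Sum>n<m. a n * (c r \<bullet> b n - x \<bullet> b n)) * (t - s)"
  proof (rule mvt_simple[OF \<open>s < t\<close>, of \<phi> "\<lambda>r h. (\<Sum>n<m. a n * (c r \<bullet> b n - x \<bullet> b n)) * h"])
    fix r assume r: "s \<le> r" "r \<le> t"
    have C: "(C n has_real_derivative c r \<bullet> b n) (at r within {s..t})" for n
      by (rule DERIV_subset[OF D[OF r]]) (use st in auto)
    have "(\<phi> has_real_derivative (\<Sum>n<m. a n * (c r \<bullet> b n - x \<bullet> b n))) (at r within {s..t})"
      unfolding \<phi>_def by (intro DERIV_sum DERIV_cmult DERIV_diff C) (auto intro!: derivative_eq_intros)
    thus "(\<phi> has_derivative (\<lambda>h. (\<Sum>n<m. a n * (c r \<bullet> b n - x \<bullet> b n)) * h)) (at r within {s..t})"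
      by (simp add: has_field_derivative_def)
  qed
  then obtain r where r: "s < r" "r < t"
    and eq: "\<phi> t - \<phi> s = (\<Sum>n<m. a n * (c r \<bullet> b n - x \<bullet> b n)) * (t - s)" by auto
  have "\<phi> t - \<phi> s = (\<Sum>n<m. (a n)\<^sup>2)"
    unfolding \<phi>_def sum_subtractf[symmetric] by (intro sum.cong) (auto simp: a_def power2_eq_square algebra_simps)
  moreover have "(\<Sum>n<m. a n * (c r \<bullet> b n - x \<bullet> b n)) = (c r - x) \<bullet> y"
    by (simp add: y_def inner_sum_right inner_diff_left)
  ultimately have "(norm y)\<^sup>2 = ((c r - x) \<bullet> y) * (t - s)"
    using eq by (simp add: y_def norm_partial)
  also have "\<dots> \<le> (M * norm y) * (t - s)"
  proof (rule mult_right_mono)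
    have "(c r - x) \<bullet> y \<le> norm (c r - x) * norm y" by (rule norm_cauchy_schwarz)
    also have "\<dots> \<le> M * norm y" using M[of r] r by (intro mult_right_mono) auto
    finally show "(c r - x) \<bullet> y \<le> M * norm y" .
  qed (use st in simp)
  finally have *: "norm y * norm y \<le> (M * (t - s)) * norm y" by (simp add: power2_eq_square mult_ac)
  have M0: "0 \<le> M" using M[of s] st norm_ge_zero order_trans by blast
  have "norm y \<le> M * (t - s)"
    using * mult_right_le_imp_le[OF *] M0 st by (cases "y = 0") auto
  hence "(norm y)\<^sup>2 \<le> (M * (t - s))\<^sup>2" by (intro power_mono) auto
  thus ?thesis by (simp add: y_def norm_partial a_def)
qed simp

lemma norm_mean_value:
  fixes u c :: "real \<Rightarrow> 'a"
  assumes D: "\<And>n r. s \<le> r \<Longrightarrow> r \<le> t \<Longrightarrow> ((\<lambda>r. u r \<bullet> b n) has_real_derivative c r \<bullet> b n) (at r within {..0})"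
    and st: "s \<le> t" "t \<le> 0" and M: "\<And>r. s \<le> r \<Longrightarrow> r \<le> t \<Longrightarrow> norm (c r - x) \<le> M"
  shows "norm (u t - u s - (t - s) *\<^sub>R x) \<le> M * (t - s)"
proof (rule power2_le_imp_le)
  show "(norm (u t - u s - (t - s) *\<^sub>R x))\<^sup>2 \<le> (M * (t - s))\<^sup>2"
  proof (rule norm_le_partial)
    fix k
    show "(\<Sum>n<k. ((u t - u s - (t - s) *\<^sub>R x) \<bullet> b n)\<^sup>2) \<le> (M * (t - s))\<^sup>2"
      using modes_mean_value[where m = k and C = "\<lambda>n r. u r \<bullet> b n" and c = c and x = x, OF D st M]
      by (simp add: inner_diff_left)
  qed
  have "0 \<le> M" using M[of s] st norm_ge_zero order_trans by blast
  thus "0 \<le> M * (t - s)" using st by simp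
qed

text \<open>
  A continuous candidate for the derivative is the derivative as soon as this is true coefficientwise.
\<close>

lemma vector_derivative_from_modes:
  fixes u v :: "real \<Rightarrow> 'a"
  assumes v: "continuous_on {..0} v"
    and D: "\<And>n t. t \<le> 0 \<Longrightarrow> ((\<lambda>r. u r \<bullet> b n) has_real_derivative v t \<bullet> b n) (at t within {..0})"
    and t: "t \<le> 0"
  shows "(u has_vector_derivative v t) (at t within {..0})"
  unfolding has_vector_derivative_def has_derivative_within_alt
proof (intro conjI allI impI)
  show "bounded_linear (\<lambda>h. h *\<^sub>R v t)" by (rule bounded_linear_scaleR_left)
  fix r :: real assume "r > 0"
  then obtain h where h: "h > 0" "\<And>s. s \<le> 0 \<Longrightarrow> dist s t < h \<Longrightarrow> norm (v s - v t) < r"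
    using v t \<open>r > 0\<close> unfolding continuous_on_iff by (force simp: dist_norm)
  show "\<exists>d>0. \<forall>s\<in>{..0}. norm (s - t) < d \<longrightarrow> norm (u s - u t - (s - t) *\<^sub>R v t) \<le> r * norm (s - t)"
  proof (intro exI[of _ h] conjI ballI impI h(1))
    fix s assume s: "s \<in> {..0::real}" "norm (s - t) < h"
    show "norm (u s - u t - (s - t) *\<^sub>R v t) \<le> r * norm (s - t)"
    proof (cases "t \<le> s")
      case True
      have "norm (u s - u t - (s - t) *\<^sub>R v t) \<le> r * (s - t)"
        by (rule norm_mean_value[OF D]) (use s True t h(2) in \<open>auto simp: dist_real_def less_imp_le\<close>)
      thus ?thesis using True by simp
    next
      case False
      have "norm (u t - u s - (t - s) *\<^sub>R v t) \<le> r * (t - s)"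
        by (rule norm_mean_value[OF D]) (use s False t h(2) in \<open>auto simp: dist_real_def less_imp_le\<close>)
      moreover have "u t - u s - (t - s) *\<^sub>R v t = - (u s - u t - (s - t) *\<^sub>R v t)"
        by (simp add: algebra_simps)
      ultimately have "norm (u s - u t - (s - t) *\<^sub>R v t) \<le> r * (t - s)"
        by (simp only: norm_minus_cancel)
      thus ?thesis using False by (simp add: abs_real_def)
    qed
  qed
qed

end

section \<open>The spectral setting\<close>

locale inertial_setting =
  fixes D :: "'a::{real_inner, complete_space} set" and A :: "'a \<Rightarrow> 'a" and lam :: "nat \<Rightarrow> real"
    and e :: "nat \<Rightarrow> 'a" and F :: "'a \<Rightarrow> 'a" and L :: real and N :: nat
  assumes setting: "spectral_setting D A lam e"
    and F_lip: "norm (F u1 - F u2) \<le> L * norm (u1 - u2)"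
    and F_zero: "F 0 = 0" and N_pos: "1 \<le> N" and gap: "2 * L < lam (N + 1) - lam N"
begin

definition b :: "nat \<Rightarrow> 'a" where "b n = e (Suc n)"
definition l :: "nat \<Rightarrow> real" where "l n = lam (Suc n)"

lemma eigen: "b n \<in> D" "A (b n) = l n *\<^sub>R b n"
  using setting by (auto simp: spectral_setting_def eigenbasis_def b_def l_def)

lemma l_mono: "m \<le> n \<Longrightarrow> l m \<le> l n"
  using setting by (auto simp: spectral_setting_def eigenbasis_def l_def mono_on_def)

sublocale hilbert_basis b
proof
  show "b m \<bullet> b n = (if m = n then 1 else 0)" for m n
    using setting by (auto simp: spectral_setting_def eigenbasis_def b_def)
  have "{1..} = range Suc"
  proof (intro set_eqI iffI)
    fix n :: nat assume "n \<in> {1..}" thus "n \<in> range Suc" by (cases n) auto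
  qed auto
  hence "e ` {1..} = range b" by (auto simp: b_def image_image)
  thus "closure (span (range b)) = UNIV"
    using setting by (simp add: spectral_setting_def eigenbasis_def)
qed

lemma norm_b: "norm (b n) = 1" using orth[of n n] by (simp add: norm_eq_sqrt_inner)

lemma l_pos: "0 < l n"
proof -
  have "b n \<noteq> 0" using norm_b[of n] by auto
  hence "0 < A (b n) \<bullet> b n" using setting eigen(1) by (auto simp: spectral_setting_def positive_op_def)
  thus ?thesis by (simp add: eigen orth)
qed

lemma adjoint_graph: "(\<forall>x\<in>D. A x \<bullet> y = x \<bullet> z) \<longleftrightarrow> (y \<in> D \<and> z = A y)"
  using setting by (simp add: spectral_setting_def self_adjoint_op_def)

lemma A_symmetric: "x \<in> D \<Longrightarrow> y \<in> D \<Longrightarrow> A x \<bullet> y = x \<bullet> A y"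
  using adjoint_graph[of y "A y"] by simp

lemma A_coefficient: "x \<in> D \<Longrightarrow> A x \<bullet> b n = l n * (x \<bullet> b n)"
  using A_symmetric[OF _ eigen(1)] by (simp add: eigen(2))

text \<open>
  By Parseval's identity \<open>z\<close> represents the functional \<open>x \<mapsto> A x \<bullet> y\<close>, so \<open>y\<close> is in the domain of the adjoint.
\<close>

lemma domainI:
  assumes z: "\<And>n. z \<bullet> b n = l n * (y \<bullet> b n)"
  shows "y \<in> D" "A y = z"
proof -
  have "A x \<bullet> y = x \<bullet> z" if "x \<in> D" for x
    using sums_unique2[OF parseval[of "A x" y]] parseval[of x z] that
    by (simp add: A_coefficient z mult_ac)
  hence "y \<in> D \<and> z = A y"
    using adjoint_graph[of y z] by simp
  thus "y \<in> D" "A y = z" by auto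
qed

text \<open>
  Otherwise the images \<open>e\<^sub>n/\<lambda>\<^sub>n\<close> of the eigenvectors under the compact inverse would keep a positive
  distance from each other.
\<close>

lemma l_at_top: "filterlim l at_top sequentially"
proof (rule ccontr)
  assume nt: "\<not> ?thesis"
  have "\<exists>B. \<forall>n. l n \<le> B"
  proof (rule ccontr)
    assume nb: "\<nexists>B. \<forall>n. l n \<le> B"
    have "filterlim l at_top sequentially"
      unfolding filterlim_at_top
    proof
      fix B
      obtain m where "B \<le> l m" using nb by (metis linear)
      thus "\<forall>\<^sub>F n in sequentially. B \<le> l n"
        using l_mono order_trans by (intro eventually_sequentiallyI[of m]) blast
    qed
    thus False using nt by simp
  qed
  then obtain B where B: "\<And>n. l n \<le> B" by auto
  have B0: "0 < B" using l_pos[of 0] B[of 0] by linarith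
  have ci: "has_compact_inverse D A" using setting by (simp add: spectral_setting_def)
  hence inj: "inj_on A D" by (simp add: has_compact_inverse_def bij_betw_def)
  have comp: "compact (closure (inv_into D A ` X))" if "bounded X" for X
    using ci that by (simp add: has_compact_inverse_def)
  define a where "a n = (1 / l n) *\<^sub>R b n" for n
  have aD: "a n \<in> D" "A (a n) = b n" for n
  proof -
    have "b n \<bullet> b m = l m * (a n \<bullet> b m)" for m
      using l_pos[of n] l_pos[of m] by (simp add: a_def orth)
    from domainI[OF this] show "a n \<in> D" "A (a n) = b n" by auto
  qed
  have in_closure: "a n \<in> closure (inv_into D A ` range b)" for n
  proof -
    have "inv_into D A (b n) = a n" using inv_into_f_f[OF inj aD(1)[of n]] by (simp add: aD(2))
    hence "a n \<in> inv_into D A ` range b" by (metis imageI rangeI)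
    thus ?thesis by (rule subsetD[OF closure_subset])
  qed
  have "bounded (range b)" unfolding bounded_iff by (intro exI[of _ 1]) (simp add: norm_b)
  hence sc: "seq_compact (closure (inv_into D A ` range b))"
    using comp by (simp add: compact_eq_seq_compact_metric)
  obtain x and r :: "nat \<Rightarrow> nat" where r: "strict_mono r" "(a \<circ> r) \<longlonglongrightarrow> x"
    by (rule seq_compactE[OF sc, of a]) (use in_closure in simp_all)
  have "Cauchy (a \<circ> r)" using r(2) by (simp add: LIMSEQ_imp_Cauchy)
  then obtain M where M: "\<And>m n. m \<ge> M \<Longrightarrow> n \<ge> M \<Longrightarrow> norm ((a \<circ> r) m - (a \<circ> r) n) < 1 / B"
    using CauchyD[of "a \<circ> r" "1 / B"] B0 by auto
  have ne: "r M \<noteq> r (Suc M)" using strict_monoD[OF r(1), of M "Suc M"] by simp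
  have "1 / B \<le> 1 / l (r M)" using B[of "r M"] B0 l_pos[of "r M"] by (intro divide_left_mono) auto
  also have "1 / l (r M) = (a (r M) - a (r (Suc M))) \<bullet> b (r M)"
    using ne by (simp add: a_def inner_diff_left orth)
  also have "\<dots> \<le> norm (a (r M) - a (r (Suc M)))"
    using norm_cauchy_schwarz[of "a (r M) - a (r (Suc M))" "b (r M)"] by (simp add: norm_b)
  also have "\<dots> < 1 / B" using M[of M "Suc M"] by simp
  finally show False by simp
qed

lemma L_nonneg: "0 \<le> L"
  using order_trans[OF norm_ge_zero F_lip[of "b 0" 0]] by (simp add: norm_b)

lemma F_bound: "norm (F u) \<le> L * norm u"
  using F_lip[of u 0] by (simp add: F_zero)

lemma F_continuous: "continuous_on S F"
proof (rule continuous_on_subset[of UNIV])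
  have "L-lipschitz_on UNIV F"
    using L_nonneg F_lip by (intro lipschitz_onI) (auto simp: dist_norm)
  thus "continuous_on UNIV F" by (rule lipschitz_on_continuous_on)
qed simp

subsection \<open>The inverse operator\<close>

definition Ainv :: "'a \<Rightarrow> 'a" where "Ainv = inv_into D A"

lemma Ainv: "Ainv x \<in> D" "A (Ainv x) = x" "y \<in> D \<Longrightarrow> Ainv (A y) = y"
proof -
  have bij: "bij_betw A D UNIV" using setting by (auto simp: spectral_setting_def has_compact_inverse_def)
  show "Ainv x \<in> D" "A (Ainv x) = x"
    using bij unfolding Ainv_def by (auto simp: bij_betw_def inv_into_into f_inv_into_f)
  show "y \<in> D \<Longrightarrow> Ainv (A y) = y"
    using bij unfolding Ainv_def by (auto simp: bij_betw_def)
qed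

lemma Ainv_coefficient: "Ainv x \<bullet> b n = (x \<bullet> b n) / l n"
  using A_coefficient[OF Ainv(1), of x n] l_pos[of n] by (simp add: Ainv(2) field_simps)

lemma Ainv_symmetric: "Ainv x \<bullet> y = x \<bullet> Ainv y"
  using A_symmetric[OF Ainv(1) Ainv(1), of x y] by (simp add: Ainv(2))

lemma Ainv_diff: "Ainv (x - y) = Ainv x - Ainv y"
  by (rule eqI) (simp add: Ainv_coefficient inner_diff_left diff_divide_distrib)

lemma Ainv_bound: "norm (Ainv x) \<le> norm x / l 0"
proof (rule power2_le_imp_le)
  show "(norm (Ainv x))\<^sup>2 \<le> (norm x / l 0)\<^sup>2"
  proof (rule norm_le_partial)
    fix k
    have "(\<Sum>n<k. (Ainv x \<bullet> b n)\<^sup>2) \<le> (\<Sum>n<k. (x \<bullet> b n)\<^sup>2 / (l 0)\<^sup>2)"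
      unfolding Ainv_coefficient power_divide
      by (intro sum_mono divide_left_mono power_mono) (use l_mono[of 0] l_pos in \<open>auto simp: less_imp_le intro!: mult_pos_pos zero_less_power\<close>)
    also have "\<dots> \<le> (norm x)\<^sup>2 / (l 0)\<^sup>2"
      unfolding sum_divide_distrib[symmetric] by (intro divide_right_mono bessel) simp
    finally show "(\<Sum>n<k. (Ainv x \<bullet> b n)\<^sup>2) \<le> (norm x / l 0)\<^sup>2" by (simp add: power_divide)
  qed
qed (use l_pos[of 0] in simp)

lemma Ainv_continuous: "continuous_on S Ainv"
proof (rule continuous_on_subset[of UNIV])
  have "(1 / l 0)-lipschitz_on UNIV Ainv"
    using l_pos[of 0] Ainv_bound by (intro lipschitz_onI) (auto simp: dist_norm Ainv_diff[symmetric])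
  thus "continuous_on UNIV Ainv" by (rule lipschitz_on_continuous_on)
qed simp

subsection \<open>Norms of the scale\<close>

lemma Hs_norm_one:
  assumes "\<And>n. z \<bullet> b n = sqrt (l n) * (x \<bullet> b n)"
  shows "x \<in> Hs_space lam e 1" "Hs_norm lam e 1 x = norm z"
proof -
  have "(\<lambda>n. lam (Suc n) powr 1 * (x \<bullet> e (Suc n))\<^sup>2) = (\<lambda>n. (z \<bullet> b n)\<^sup>2)"
    using assms l_pos by (auto simp: power_mult_distrib less_imp_le l_def b_def)
  thus "x \<in> Hs_space lam e 1" "Hs_norm lam e 1 x = norm z"
    using parseval_norm[of z] by (auto simp: Hs_space_def Hs_norm_def sums_iff)
qed

subsection \<open>The spectral gap\<close>

definition dl where "dl = (l N - l (N - 1)) / 2"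
definition mu where "mu = (l N + l (N - 1)) / 2"
definition d where "d n = l n - mu"

lemma lam_N: "lam N = l (N - 1)" "lam (N + 1) = l N" "lam (Suc N) = l N"
  using N_pos by (auto simp: l_def)

lemma dl: "L < dl" "0 < dl"
  using gap L_nonneg unfolding lam_N dl_def by auto

lemma mu_pos: "0 < mu" using l_pos[of N] l_pos[of "N - 1"] by (simp add: mu_def)

lemma d_low: "n < N \<Longrightarrow> d n \<le> - dl" and d_low': "n < N \<Longrightarrow> - d n \<le> mu"
  and d_high: "N \<le> n \<Longrightarrow> dl \<le> d n"
proof -
  show "d n \<le> - dl" if "n < N" using l_mono[of n "N - 1"] that by (simp add: d_def dl_def mu_def field_simps)
  show "- d n \<le> mu" using l_pos[of n] by (simp add: d_def)
  show "dl \<le> d n" if "N \<le> n" using l_mono[OF that] by (simp add: d_def dl_def mu_def field_simps)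
qed

text \<open>
  Above the gap \<open>d n = l n - mu\<close> controls \<open>l n\<close>, so the modal energy controls the \<open>H\<^sup>1\<close> norm.
\<close>

lemma l_le_d: assumes "N \<le> n" shows "l n \<le> l N / dl * d n"
proof -
  have lN: "l N = mu + dl" "l N \<le> l n" using l_mono[OF assms] by (auto simp: mu_def dl_def field_simps)
  have "l N * d n - dl * l n = mu * (l n - l N)"
    by (simp add: d_def lN(1) algebra_simps)
  moreover have "0 \<le> mu * (l n - l N)" using mu_pos lN by simp
  ultimately show ?thesis using dl by (simp add: field_simps)
qed

text \<open>
  The nonlinearity in the variable \<open>e\<^bsup>th t\<^esup>u\<close>; it keeps the Lipschitz constant of \<open>F\<close>.
\<close>

definition Fw :: "real \<Rightarrow> real \<Rightarrow> 'a \<Rightarrow> 'a" where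
  "Fw th t x = exp (th * t) *\<^sub>R F (exp (- (th * t)) *\<^sub>R x)"

lemma Fw_lip: "norm (Fw th t x - Fw th t y) \<le> L * norm (x - y)"
proof -
  have "norm (Fw th t x - Fw th t y) = exp (th * t) * norm (F (exp (- (th * t)) *\<^sub>R x) - F (exp (- (th * t)) *\<^sub>R y))"
    by (simp add: Fw_def flip: scaleR_diff_right)
  also have "\<dots> \<le> exp (th * t) * (L * norm (exp (- (th * t)) *\<^sub>R x - exp (- (th * t)) *\<^sub>R y))"
    by (intro mult_left_mono F_lip) simp
  also have "\<dots> = L * norm (x - y)"
    by (simp add: exp_minus flip: scaleR_diff_right)
  finally show ?thesis .
qed

lemma Fw_zero: "Fw th t 0 = 0" by (simp add: Fw_def F_zero)

lemma Fw_cont: "continuous_on S Y \<Longrightarrow> continuous_on S (\<lambda>t. Fw th t (Y t))"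
  unfolding Fw_def by (intro continuous_intros continuous_on_compose2[OF F_continuous[of UNIV]]) auto

lemma in_weighted_L2_iff:
  assumes "continuous_on {..0} u"
  shows "in_weighted_L2 th u \<longleftrightarrow> half_L2 (\<lambda>t. exp (th * t) *\<^sub>R u t)"
proof -
  have "(norm (exp (th * t) *\<^sub>R u t))\<^sup>2 = exp (2 * th * t) * (norm (u t))\<^sup>2" for t
    by (simp add: power_mult_distrib exp_double[symmetric] mult.assoc)
  thus ?thesis using assms by (auto simp: in_weighted_L2_def half_L2_def intro!: continuous_intros)
qed

lemma low_projection: "p \<in> range (spectral_proj e N) \<Longrightarrow> N \<le> n \<Longrightarrow> p \<bullet> b n = 0"
proof -
  assume "p \<in> range (spectral_proj e N)" "N \<le> n"
  then obtain x where x: "p = (\<Sum>n=1..N. (x \<bullet> e n) *\<^sub>R e n)" by (auto simp: spectral_proj_def)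
  have "(\<Sum>n=1..N. (x \<bullet> e n) *\<^sub>R e n) = (\<Sum>n<N. (x \<bullet> b n) *\<^sub>R b n)"
    by (simp add: b_def sum.atLeast1_atMost_eq)
  thus ?thesis using x \<open>N \<le> n\<close> by (simp add: inner_partial)
qed

lemma spectral_proj_coefficient: "spectral_proj e N x \<bullet> b n = (if n < N then x \<bullet> b n else 0)"
proof -
  have "spectral_proj e N x = (\<Sum>n<N. (x \<bullet> b n) *\<^sub>R b n)"
    by (simp add: spectral_proj_def b_def sum.atLeast1_atMost_eq)
  thus ?thesis by (simp add: inner_partial)
qed

lemma spectral_proj_eq_iff:
  assumes "p \<in> range (spectral_proj e N)"
  shows "spectral_proj e N x = p \<longleftrightarrow> (\<forall>n<N. x \<bullet> b n = p \<bullet> b n)"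
  using low_projection[OF assms] by (auto simp: spectral_proj_coefficient intro!: eqI)

end

section \<open>The damped wave equation\<close>

context inertial_setting
begin

text \<open>
  Constants for the wave equation.  As \<open>eps lsum \<le> 1\<close>, the number \<open>a0\<close> is a lower bound for \<open>al\<close> that does not
  depend on \<open>eps\<close>; \<open>kap\<close> and \<open>KH\<close> come from the bounds for low and for all modes in \<open>mode_bounds\<close>.
\<close>

definition lsum where "lsum = 3 * l N + l (N - 1)"
definition a0 where "a0 = sqrt (2 * dl / lsum)"
definition kap where "kap = 1 / dl\<^sup>2 + 3 / a0\<^sup>2"
definition KH where "KH = l N / (dl * a0) + (1 / a0 + mu * kap + l N * kap) * (1 + 2 * mu)"

lemma lsum_pos: "0 < lsum" using l_pos[of N] l_pos[of "N - 1"] by (simp add: lsum_def)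

lemma a0_pos: "0 < a0" using lsum_pos dl by (simp add: a0_def)

lemma kap_pos: "0 < kap" using dl a0_pos by (simp add: kap_def add_pos_pos)

lemma KH_bounds: "l N / (dl * a0) \<le> KH" "(1 / a0 + mu * kap + l N * kap) * (1 + 2 * mu) \<le> KH" "0 < KH"
proof -
  have "0 < l N / (dl * a0)" using l_pos dl a0_pos by simp
  moreover have "0 < (1 / a0 + mu * kap + l N * kap) * (1 + 2 * mu)"
    using l_pos[of N] a0_pos kap_pos mu_pos by (intro mult_pos_pos add_pos_pos) auto
  ultimately show "l N / (dl * a0) \<le> KH" "(1 / a0 + mu * kap + l N * kap) * (1 + 2 * mu) \<le> KH" "0 < KH"
    by (auto simp: KH_def)
qed

end

locale hyperbolic_setting = inertial_setting +
  fixes eps :: real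
  assumes eps: "0 < eps" and eps_small: "3 * lam (N + 1) + lam N \<le> 1 / eps"
begin

text \<open>
  \<open>s n\<close> is the square root of the discriminant of \<open>eps k\<^sup>2 + k + l n\<close>, \<open>al\<close> is the same expression at the midpoint
  \<open>mu\<close> of the gap, and \<open>- th\<close> is the larger root of \<open>eps k\<^sup>2 + k + mu\<close>.
\<close>

definition al where "al = sqrt (1 - 4 * eps * mu)"
definition th where "th = (1 - al) / (2 * eps)"
definition s where "s n = sqrt (1 - 4 * eps * l n)"

lemma eps_lsum: "eps * lsum \<le> 1"
  using eps_small eps unfolding lam_N by (simp add: lsum_def field_simps)

lemma al2_ge: "a0\<^sup>2 \<le> 1 - 4 * eps * mu" "2 * eps * dl \<le> 1 - 4 * eps * mu"
proof -
  define r where "r = 2 * dl / lsum"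
  have r: "r * lsum = 2 * dl" using lsum_pos by (simp add: r_def)
  have mu: "4 * mu = lsum - 2 * dl" by (simp add: mu_def dl_def lsum_def field_simps)
  have eq: "1 - 4 * eps * mu = 1 - eps * lsum + 2 * (eps * dl)"
    using arg_cong[OF mu, of "\<lambda>z. eps * z"] by (simp add: right_diff_distrib)
  show "2 * eps * dl \<le> 1 - 4 * eps * mu" unfolding eq using eps_lsum by simp
  have "2 * dl \<le> lsum" using l_pos[of N] l_pos[of "N - 1"] by (simp add: dl_def lsum_def)
  hence "0 \<le> 1 - r" using lsum_pos by (simp add: r_def)
  hence "(1 - r) * (eps * lsum) \<le> (1 - r) * 1" by (rule mult_left_mono[OF eps_lsum])
  moreover have "(1 - r) * (eps * lsum) = eps * lsum - eps * (r * lsum)" by (simp add: left_diff_distrib)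
  ultimately have "r \<le> 1 - 4 * eps * mu" unfolding eq r by simp
  moreover have "a0\<^sup>2 = r" using dl lsum_pos by (simp add: a0_def r_def)
  ultimately show "a0\<^sup>2 \<le> 1 - 4 * eps * mu" by simp
qed

lemma al2: "al\<^sup>2 = 1 - 4 * eps * mu"
  using order_trans[OF zero_le_power2 al2_ge(1)] by (simp add: al_def)

lemma al: "a0 \<le> al" "0 < al" "al < 1" "2 * eps * dl \<le> al\<^sup>2"
proof -
  show "a0 \<le> al" using al2_ge(1) a0_pos by (simp add: al_def real_le_rsqrt)
  thus "0 < al" using a0_pos by linarith
  show "al < 1" using eps mu_pos by (simp add: al_def)
  show "2 * eps * dl \<le> al\<^sup>2" using al2_ge(2) by (simp add: al2)
qed

lemma th: "al = 1 - 2 * eps * th" "mu = th - eps * th\<^sup>2" "mu < th" "th \<le> 2 * mu" "0 < th"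
proof -
  show e1: "al = 1 - 2 * eps * th" using eps by (simp add: th_def)
  have "(1 - 2 * eps * th)\<^sup>2 = 1 - 4 * eps * mu" using al2 e1 by simp
  hence "4 * eps * mu = 4 * eps * (th - eps * th\<^sup>2)"
    by (simp add: power2_eq_square algebra_simps)
  thus e2: "mu = th - eps * th\<^sup>2" using eps by simp
  show p: "0 < th" using al eps by (simp add: th_def)
  thus "mu < th" using e2 eps by simp
  have "eps * th * th \<le> 1 / 2 * th" using e1 al p by (intro mult_right_mono) auto
  thus "th \<le> 2 * mu" using e2 by (simp add: power2_eq_square mult.assoc)
qed

lemma s: assumes "n < N" shows "(s n)\<^sup>2 = 1 - 4 * eps * l n" "al \<le> s n" "0 < s n" "s n \<le> 1"
    "(s n)\<^sup>2 = al\<^sup>2 - 4 * eps * d n"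
proof -
  have "l n \<le> mu" using d_low[OF assms] dl by (simp add: d_def)
  hence le: "1 - 4 * eps * mu \<le> 1 - 4 * eps * l n" using eps by simp
  thus "al \<le> s n" by (simp add: al_def s_def)
  thus "0 < s n" using al by linarith
  have "0 \<le> 1 - 4 * eps * l n" using le al2 zero_le_power2[of al] by linarith
  thus 2: "(s n)\<^sup>2 = 1 - 4 * eps * l n" by (simp add: s_def)
  show "s n \<le> 1" using eps l_pos[of n] by (simp add: s_def)
  show "(s n)\<^sup>2 = al\<^sup>2 - 4 * eps * d n" unfolding 2 al2 d_def by (simp add: algebra_simps)
qed

lemma theta_eps_eq: "theta_eps lam N eps = th"
  unfolding theta_eps_def
proof (rule Least_equality)
  have m: "lam (N + 1) + lam N = 2 * mu" unfolding lam_N mu_def by simp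
  show "2 * th * (eps * th - 1) + lam (N + 1) + lam N = 0"
    using m th(2) by (simp add: power2_eq_square algebra_simps)
  fix x assume "2 * x * (eps * x - 1) + lam (N + 1) + lam N = 0"
  hence "eps * x\<^sup>2 - x + mu = 0" using m by (simp add: power2_eq_square algebra_simps)
  hence "4 * eps * (eps * x\<^sup>2 - x + mu) = 0" by simp
  hence "(2 * eps * x - 1)\<^sup>2 = al\<^sup>2" unfolding al2 by (simp add: power2_eq_square algebra_simps)
  hence "2 * eps * x - 1 = al \<or> 2 * eps * x - 1 = - al" by (simp add: power2_eq_iff)
  hence "1 - al \<le> 2 * eps * x" using al by auto
  thus "th \<le> x" using eps by (simp add: th_def field_simps)
qed

lemma weighted_mode:
  assumes w: "\<And>t. t \<le> 0 \<Longrightarrow> (w has_real_derivative \<omega> t) (at t within {..0})"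
    and \<omega>: "\<And>t. t \<le> 0 \<Longrightarrow> (\<omega> has_real_derivative (h t - \<omega> t - c * w t) / eps) (at t within {..0})"
  shows "mode_eq eps al (c - mu) (\<lambda>t. exp (th * t) * h t) (\<lambda>t. exp (th * t) * w t)
    (\<lambda>t. exp (th * t) * (\<omega> t + th * w t))"
  unfolding mode_eq_def
proof (intro allI impI conjI)
  fix t :: real assume t: "t \<le> 0"
  show "((\<lambda>t. exp (th * t) * w t) has_real_derivative exp (th * t) * (\<omega> t + th * w t)) (at t within {..0})"
    by (auto intro!: derivative_eq_intros w t simp: algebra_simps)
  define E where "E = exp (th * t)"
  have "((\<lambda>t. exp (th * t) * (\<omega> t + th * w t)) has_real_derivative
      E * th * (\<omega> t + th * w t) + E * ((h t - \<omega> t - c * w t) / eps + th * \<omega> t)) (at t within {..0})"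
    unfolding E_def by (auto intro!: derivative_eq_intros w \<omega> t simp: algebra_simps)
  also have "E * th * (\<omega> t + th * w t) + E * ((h t - \<omega> t - c * w t) / eps + th * \<omega> t)
      = (E * h t - al * (E * (\<omega> t + th * w t)) - (c - mu) * (E * w t)) / eps"
    unfolding th(1) th(2) using eps by (simp add: field_simps power2_eq_square)
  finally show "((\<lambda>t. exp (th * t) * (\<omega> t + th * w t)) has_real_derivative
      (exp (th * t) * h t - al * (exp (th * t) * (\<omega> t + th * w t)) - (c - mu) * (exp (th * t) * w t)) / eps)
     (at t within {..0})" unfolding E_def .
qed

lemma unweighted_mode:
  assumes m: "mode_eq eps al (c - mu) g y x" and t: "t \<le> 0"
  shows "((\<lambda>t. exp (- (th * t)) * y t) has_real_derivative exp (- (th * t)) * (x t - th * y t)) (at t within {..0})"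
    "((\<lambda>t. exp (- (th * t)) * (x t - th * y t)) has_real_derivative
      (exp (- (th * t)) * g t - exp (- (th * t)) * (x t - th * y t) - c * (exp (- (th * t)) * y t)) / eps) (at t within {..0})"
proof -
  have y: "(y has_real_derivative x t) (at t within {..0})"
    and x: "(x has_real_derivative (g t - al * x t - (c - mu) * y t) / eps) (at t within {..0})"
    using m t by (auto simp: mode_eq_def)
  show "((\<lambda>t. exp (- (th * t)) * y t) has_real_derivative exp (- (th * t)) * (x t - th * y t)) (at t within {..0})"
    by (auto intro!: derivative_eq_intros y simp: algebra_simps)
  define E where "E = exp (- (th * t))"
  have "((\<lambda>t. exp (- (th * t)) * (x t - th * y t)) has_real_derivative
      - (E * th) * (x t - th * y t) + E * ((g t - al * x t - (c - mu) * y t) / eps - th * x t)) (at t within {..0})"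
    unfolding E_def by (auto intro!: derivative_eq_intros y x simp: algebra_simps)
  also have "- (E * th) * (x t - th * y t) + E * ((g t - al * x t - (c - mu) * y t) / eps - th * x t)
     = (E * g t - E * (x t - th * y t) - c * (E * y t)) / eps"
    unfolding th(1) th(2) using eps by (simp add: field_simps power2_eq_square)
  finally show "((\<lambda>t. exp (- (th * t)) * (x t - th * y t)) has_real_derivative
      (exp (- (th * t)) * g t - exp (- (th * t)) * (x t - th * y t) - c * (exp (- (th * t)) * y t)) / eps) (at t within {..0})"
    unfolding E_def .
qed

text \<open>
  The boundary condition in the weighted variable, cleared of denominators (see \<open>bc_iff\<close>).
\<close>

definition bc :: "nat \<Rightarrow> real \<Rightarrow> (real \<Rightarrow> real) \<Rightarrow> (real \<Rightarrow> real) \<Rightarrow> bool" where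
  "bc n q y x \<longleftrightarrow> (n < N \<longrightarrow> eps * x 0 + (al + s n) / 2 * y 0 = s n * q)"

text \<open>
  The bounds that are uniform in \<open>eps\<close>.  High modes: \<open>high_mode_L2\<close> and the energy identity.  Low modes:
  there \<open>d n < 0\<close>, so the energy identity needs a bound for \<open>y(0)\<close>, which comes from the boundary
  term in \<open>low_mode_L2\<close>; a bound for \<open>y\<close> at other times follows from those for \<open>y\<close> and \<open>x\<close> in \<open>L\<^sup>2\<close>.
\<close>

lemma mode_bounds:
  assumes m: "mode_eq eps al (d n) g y x" and y: "half_L2 y" and g: "half_L2 g"
    and bc: "bc n q y x" and q: "N \<le> n \<Longrightarrow> q = 0"
  shows "dl\<^sup>2 * sqn y \<le> sqn g + 2 * mu * q\<^sup>2"
    "\<And>t. t \<le> 0 \<Longrightarrow> eps * (x t)\<^sup>2 + l n * (y t)\<^sup>2 \<le> KH * (sqn g + q\<^sup>2)"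
proof -
  have g0: "0 \<le> sqn g" and y0: "0 \<le> sqn y" by (rule half_integral_nonneg; simp)+
  have "dl\<^sup>2 * sqn y \<le> sqn g + 2 * mu * q\<^sup>2 \<and> (\<forall>t\<le>0. eps * (x t)\<^sup>2 + l n * (y t)\<^sup>2 \<le> KH * (sqn g + q\<^sup>2))"
  proof (cases "n < N")
    case False
    hence dn: "dl \<le> d n" using d_high by simp
    have q0: "q = 0" using q False by simp
    have 1: "dl\<^sup>2 * sqn y \<le> sqn g" by (rule high_mode_L2[OF m eps al(2) dl(2) dn al(4) y g])
    have "eps * (x t)\<^sup>2 + l n * (y t)\<^sup>2 \<le> KH * (sqn g + q\<^sup>2)" if t: "t \<le> 0" for t
    proof -
      have ge1: "1 \<le> l N / dl" using l_pos[of "N - 1"] dl l_pos[of N] by (simp add: dl_def field_simps)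
      have "eps * (x t)\<^sup>2 + l n * (y t)\<^sup>2 \<le> l N / dl * (eps * (x t)\<^sup>2) + l N / dl * d n * (y t)\<^sup>2"
      proof (rule add_mono)
        show "eps * (x t)\<^sup>2 \<le> l N / dl * (eps * (x t)\<^sup>2)"
          using mult_right_mono[OF ge1, of "eps * (x t)\<^sup>2"] eps by simp
        show "l n * (y t)\<^sup>2 \<le> l N / dl * d n * (y t)\<^sup>2"
          by (rule mult_right_mono[OF l_le_d]) (use False in auto)
      qed
      also have "\<dots> = l N / dl * (eps * (x t)\<^sup>2 + d n * (y t)\<^sup>2)" by (simp add: algebra_simps)
      also have "\<dots> \<le> l N / dl * (sqn g / a0)"
      proof (rule mult_left_mono)
        have "eps * (x t)\<^sup>2 + d n * (y t)\<^sup>2 \<le> sqn g / al" by (rule mode_energy_at[OF m eps al(2) y g t])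
        also have "\<dots> \<le> sqn g / a0" using al a0_pos g0 by (intro divide_left_mono) auto
        finally show "eps * (x t)\<^sup>2 + d n * (y t)\<^sup>2 \<le> sqn g / a0" .
      qed (use l_pos[of N] dl in simp)
      also have "\<dots> = l N / (dl * a0) * sqn g" by simp
      also have "\<dots> \<le> KH * sqn g" by (rule mult_right_mono[OF KH_bounds(1) g0])
      finally show ?thesis by (simp add: q0)
    qed
    thus ?thesis using 1 by (simp add: q0)
  next
    case True
    define R where "R = sqn g + 2 * mu * q\<^sup>2"
    define Dn where "Dn = - d n"
    have Dn: "d n = - Dn" "0 < Dn" "dl \<le> Dn" "Dn \<le> mu"
      using d_low[OF True] d_low'[OF True] dl by (auto simp: Dn_def)
    have sn: "0 < s n" "s n \<le> 1" "a0 \<le> s n" using s[OF True] al by auto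
    have R0: "0 \<le> R" unfolding R_def using g0 mu_pos by simp
    have gR: "sqn g \<le> R" unfolding R_def using mu_pos by simp
    have "Dn\<^sup>2 * sqn y + Dn * s n / 2 * (y 0)\<^sup>2 \<le> sqn g + 2 * Dn * s n * q\<^sup>2"
      by (rule low_mode_L2[OF m eps al(2) Dn(1,2) sn(1) _ y g]) (use bc True in \<open>simp add: bc_def\<close>)
    also have "2 * Dn * s n * q\<^sup>2 \<le> 2 * mu * 1 * q\<^sup>2"
      by (intro mult_right_mono mult_mono) (use Dn sn in auto)
    finally have 1: "Dn\<^sup>2 * sqn y + Dn * s n / 2 * (y 0)\<^sup>2 \<le> R" by (simp add: R_def)
    have n1: "0 \<le> Dn\<^sup>2 * sqn y" "0 \<le> Dn * s n / 2 * (y 0)\<^sup>2" using y0 Dn sn by auto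
    have "dl\<^sup>2 * sqn y \<le> Dn\<^sup>2 * sqn y" using Dn dl y0 by (intro mult_right_mono power_mono) auto
    hence 2: "dl\<^sup>2 * sqn y \<le> R" using 1 n1 by linarith
    have Dy: "Dn * (y 0)\<^sup>2 \<le> 2 * R / a0"
    proof -
      have "a0 * (Dn * (y 0)\<^sup>2) \<le> s n * (Dn * (y 0)\<^sup>2)" using sn Dn by (intro mult_right_mono) auto
      also have "\<dots> \<le> 2 * R" using 1 n1 by (simp add: mult_ac)
      finally show ?thesis using a0_pos by (simp add: field_simps)
    qed
    have x: "half_L2 x" by (rule mode_eq_derivative_L2[OF m eps _ y g]) (use al in simp)
    have x0: "0 \<le> sqn x" by (rule half_integral_nonneg) simp
    have gal: "sqn g / al \<le> R / a0" using gR al a0_pos R0 by (intro frac_le) auto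
    have sx: "sqn x \<le> 3 * R / a0\<^sup>2"
    proof -
      have "eps * (x 0)\<^sup>2 + d n * (y 0)\<^sup>2 + al * sqn x \<le> sqn g / al"
        by (rule mode_energy_integrated[OF m eps al(2) y g])
      hence "al * sqn x \<le> 3 * R / a0"
      proof -
        have "0 \<le> eps * (x 0)\<^sup>2" using eps by simp
        moreover have "3 * R / a0 = 2 * R / a0 + R / a0" by (simp add: add_divide_distrib[symmetric])
        moreover have "d n * (y 0)\<^sup>2 = - (Dn * (y 0)\<^sup>2)" by (simp add: Dn(1))
        ultimately show ?thesis using Dy gal \<open>eps * (x 0)\<^sup>2 + _ + _ \<le> _\<close> by linarith
      qed
      moreover have "a0 * sqn x \<le> al * sqn x" using al x0 by (intro mult_right_mono) auto
      ultimately have "a0 * sqn x \<le> 3 * R / a0" by linarith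
      thus ?thesis using a0_pos by (simp add: field_simps power2_eq_square)
    qed
    have "eps * (x t)\<^sup>2 + l n * (y t)\<^sup>2 \<le> KH * (sqn g + q\<^sup>2)" if t: "t \<le> 0" for t
    proof -
      have "(y t)\<^sup>2 \<le> sqn y + sqn x"
        by (rule sq_le_sqn_derivative[OF _ y x t]) (use m in \<open>auto simp: mode_eq_def\<close>)
      also have "\<dots> \<le> R / dl\<^sup>2 + 3 * R / a0\<^sup>2" using 2 sx dl by (intro add_mono) (auto simp: field_simps)
      also have "\<dots> = kap * R" by (simp add: kap_def field_simps)
      finally have yk: "(y t)\<^sup>2 \<le> kap * R" .
      have "eps * (x t)\<^sup>2 \<le> R / a0 + Dn * (y t)\<^sup>2"
        using mode_energy_at[OF m eps al(2) y g t] gal by (simp add: Dn(1))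
      also have "Dn * (y t)\<^sup>2 \<le> mu * (kap * R)" using Dn yk mu_pos by (intro mult_mono) auto
      finally have a: "eps * (x t)\<^sup>2 \<le> R / a0 + mu * (kap * R)" by simp
      have b: "l n * (y t)\<^sup>2 \<le> l N * (kap * R)"
        using l_mono[of n N] True l_pos yk by (intro mult_mono) (auto simp: less_imp_le)
      have "R \<le> (1 + 2 * mu) * (sqn g + q\<^sup>2)"
        using g0 mu_pos by (simp add: R_def algebra_simps)
      hence "(1 / a0 + mu * kap + l N * kap) * R \<le> (1 / a0 + mu * kap + l N * kap) * ((1 + 2 * mu) * (sqn g + q\<^sup>2))"
        using a0_pos mu_pos kap_pos l_pos[of N] by (intro mult_left_mono) auto
      also have "\<dots> \<le> KH * (sqn g + q\<^sup>2)"
        unfolding mult.assoc[symmetric] by (rule mult_right_mono[OF KH_bounds(2)]) (use g0 in simp)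
      finally show ?thesis using a b by (simp add: algebra_simps)
    qed
    thus ?thesis using 2 by (simp add: R_def)
  qed
  thus "dl\<^sup>2 * sqn y \<le> sqn g + 2 * mu * q\<^sup>2"
    "\<And>t. t \<le> 0 \<Longrightarrow> eps * (x t)\<^sup>2 + l n * (y t)\<^sup>2 \<le> KH * (sqn g + q\<^sup>2)" by auto
qed

definition hsol :: "'a \<Rightarrow> nat \<Rightarrow> (real \<Rightarrow> real) \<Rightarrow> (real \<Rightarrow> real) \<Rightarrow> bool" where
  "hsol p n y g \<longleftrightarrow> (\<exists>x. mode_eq eps al (d n) g y x \<and> bc n (p \<bullet> b n) y x)"

lemma hsol_exists:
  assumes g: "half_L2 g"
  shows "\<exists>y. half_L2 y \<and> hsol p n y g"
proof (cases "n < N")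
  case True
  have "d n < 0" using d_low[OF True] dl by simp
  from low_mode_solvable[OF eps al(2) this s(3)[OF True] s(5)[OF True] g]
  obtain y x where "half_L2 y" "mode_eq eps al (d n) g y x" "eps * x 0 + (al + s n) / 2 * y 0 = s n * (p \<bullet> b n)"
    by metis
  thus ?thesis by (auto simp: hsol_def bc_def)
next
  case False
  have "d n > 0" using d_high[of n] dl False by simp
  from high_mode_solvable[OF eps al(2) this g] show ?thesis using False by (metis hsol_def bc_def)
qed

lemma hsol_diff:
  assumes "hsol p n y g" "hsol p n y' g'" and h: "half_L2 y" "half_L2 y'" "half_L2 g" "half_L2 g'"
  shows "dl\<^sup>2 * sqn (\<lambda>t. y t - y' t) \<le> sqn (\<lambda>t. g t - g' t)"
    "t \<le> 0 \<Longrightarrow> (y t - y' t)\<^sup>2 \<le> KH / l 0 * sqn (\<lambda>t. g t - g' t)"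
proof -
  obtain x x' where x: "mode_eq eps al (d n) g y x" "bc n (p \<bullet> b n) y x"
    and x': "mode_eq eps al (d n) g' y' x'" "bc n (p \<bullet> b n) y' x'"
    using assms(1,2) by (auto simp: hsol_def)
  have bc0: "bc n 0 (\<lambda>t. y t - y' t) (\<lambda>t. x t - x' t)"
  proof -
    have "eps * (x 0 - x' 0) + (al + s n) / 2 * (y 0 - y' 0)
      = (eps * x 0 + (al + s n) / 2 * y 0) - (eps * x' 0 + (al + s n) / 2 * y' 0)"
      by (simp only: right_diff_distrib add_diff_add)
    thus ?thesis using x(2) x'(2) by (simp add: bc_def)
  qed
  note mb = mode_bounds[OF mode_eq_diff[OF x(1) x'(1)] half_L2_diff[OF h(1,2)] half_L2_diff[OF h(3,4)] bc0]
  show "dl\<^sup>2 * sqn (\<lambda>t. y t - y' t) \<le> sqn (\<lambda>t. g t - g' t)" using mb(1) by simp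
  assume t: "t \<le> 0"
  have "l 0 * (y t - y' t)\<^sup>2 \<le> l n * (y t - y' t)\<^sup>2"
    using l_mono[of 0 n] by (intro mult_right_mono) auto
  also have "\<dots> \<le> KH * sqn (\<lambda>t. g t - g' t)"
  proof -
    have "0 \<le> eps * (x t - x' t)\<^sup>2" using eps by simp
    thus ?thesis using mb(2)[OF _ t] by simp
  qed
  finally show "(y t - y' t)\<^sup>2 \<le> KH / l 0 * sqn (\<lambda>t. g t - g' t)"
    using l_pos[of 0] by (simp add: field_simps)
qed

lemma hsol_modal_problem: "modal_problem b (hsol p) dl (KH / l 0) L N (Fw th)"
proof
  show "hsol p n (\<lambda>t. 0) (\<lambda>t. 0)" if "N \<le> n" for n
    unfolding hsol_def using that by (intro exI[of _ "\<lambda>t. 0"]) (simp add: mode_eq_def bc_def)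
  show "half_L2 g \<Longrightarrow> \<exists>y. half_L2 y \<and> hsol p n y g" for g n by (rule hsol_exists)
  fix n y g y' g' assume h: "hsol p n y g" "\<And>t. t \<le> 0 \<Longrightarrow> y t = y' t" "\<And>t. t \<le> 0 \<Longrightarrow> g t = g' t"
  obtain x where x: "mode_eq eps al (d n) g y x" "bc n (p \<bullet> b n) y x" using h(1) by (auto simp: hsol_def)
  have "mode_eq eps al (d n) g' y' x" by (rule mode_eq_cong[OF x(1) h(2,3)])
  moreover have "bc n (p \<bullet> b n) y' x" using x(2) h(2)[of 0] by (simp add: bc_def)
  ultimately show "hsol p n y' g'" unfolding hsol_def by blast
next
  show "0 \<le> KH / l 0" using KH_bounds(3) l_pos[of 0] by simp
qed (fact dl(1) L_nonneg hsol_diff | rule Fw_lip | rule Fw_zero | erule Fw_cont)+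

end

context hyperbolic_setting
begin

text \<open>
  The wave equation tested with eigenvectors only, together with the derivative \<open>v\<close> of \<open>u\<close>.  The
  solutions in the sense of \<open>solves_hyperbolic\<close> are recovered from it in \<open>hyperbolic_solution_exists\<close>.
\<close>

definition hyp_modal :: "'a \<Rightarrow> (real \<Rightarrow> 'a) \<Rightarrow> (real \<Rightarrow> 'a) \<Rightarrow> bool" where
  "hyp_modal p u v \<longleftrightarrow> continuous_on {..0} u \<and> continuous_on {..0} v \<and>
     half_L2 (\<lambda>t. exp (th * t) *\<^sub>R u t) \<and>
     (\<forall>n. \<forall>t\<le>0. ((\<lambda>r. u r \<bullet> b n) has_real_derivative v t \<bullet> b n) (at t within {..0}) \<and>
        ((\<lambda>r. v r \<bullet> b n) has_real_derivative (F (u t) \<bullet> b n - v t \<bullet> b n - l n * (u t \<bullet> b n)) / eps)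
           (at t within {..0})) \<and>
     (\<forall>n<N. eps / s n * (v 0 \<bullet> b n) + (1 + s n) / (2 * s n) * (u 0 \<bullet> b n) = p \<bullet> b n)"

lemma bc_iff:
  assumes "n < N"
  shows "eps / s n * v + (1 + s n) / (2 * s n) * u = q \<longleftrightarrow> eps * (v + th * u) + (al + s n) / 2 * u = s n * q"
proof -
  have "eps * (v + th * u) + (al + s n) / 2 * u = s n * (eps / s n * v + (1 + s n) / (2 * s n) * u)"
    using s(3)[OF assms] unfolding th(1) by (simp add: field_simps)
  thus ?thesis using s(3)[OF assms] by auto
qed

lemma bc_projection:
  assumes p: "p \<in> range (spectral_proj e N)"
  shows "hat_proj lam e N eps v + cal_proj lam e N eps u = p \<longleftrightarrow>
    (\<forall>n<N. eps / s n * (v \<bullet> b n) + (1 + s n) / (2 * s n) * (u \<bullet> b n) = p \<bullet> b n)"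
proof -
  have "hat_proj lam e N eps v + cal_proj lam e N eps u
     = (\<Sum>n<N. (eps / s n * (v \<bullet> b n) + (1 + s n) / (2 * s n) * (u \<bullet> b n)) *\<^sub>R b n)"
    by (simp add: hat_proj_def cal_proj_def sum.atLeast1_atMost_eq b_def l_def s_def scaleR_add_left sum.distrib)
  hence "(hat_proj lam e N eps v + cal_proj lam e N eps u) \<bullet> b n
     = (if n < N then eps / s n * (v \<bullet> b n) + (1 + s n) / (2 * s n) * (u \<bullet> b n) else 0)" for n
    by (simp only: inner_partial)
  thus ?thesis using low_projection[OF p] eqI by (metis not_le)
qed

lemma solves_hyperbolic_modal:
  assumes p: "p \<in> range (spectral_proj e N)" and u: "solves_hyperbolic D A lam e F N eps p u"
  obtains v where "hyp_modal p u v" "\<And>t. t \<le> 0 \<Longrightarrow> (u has_vector_derivative v t) (at t within {..0})"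
    "u 0 \<in> Hs_space lam e 1"
proof -
  obtain v where H: "\<And>t. t \<le> 0 \<Longrightarrow> u t \<in> Hs_space lam e 1" and vc: "continuous_on {..0} v"
    and Du: "\<And>t. t \<le> 0 \<Longrightarrow> (u has_vector_derivative v t) (at t within {..0})"
    and Dv: "\<And>t \<phi>. t \<le> 0 \<Longrightarrow> \<phi> \<in> D \<Longrightarrow> ((\<lambda>s. eps * (v s \<bullet> \<phi>)) has_real_derivative
                            F (u t) \<bullet> \<phi> - v t \<bullet> \<phi> - u t \<bullet> A \<phi>) (at t within {..0})"
    and bc: "hat_proj lam e N eps (v 0) + cal_proj lam e N eps (u 0) = p"
    and L2: "in_weighted_L2 (theta_eps lam N eps) u"
    using u by (auto simp: solves_hyperbolic_def)
  have uc: "continuous_on {..0} u" by (rule continuous_on_half_of_vderiv[OF Du])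
  have "hyp_modal p u v"
    unfolding hyp_modal_def
  proof (intro conjI allI impI uc vc)
    show "half_L2 (\<lambda>t. exp (th * t) *\<^sub>R u t)" using L2 in_weighted_L2_iff[OF uc] by (simp add: theta_eps_eq)
    fix n and t :: real assume t: "t \<le> 0"
    show "((\<lambda>r. u r \<bullet> b n) has_real_derivative v t \<bullet> b n) (at t within {..0})"
      unfolding has_real_derivative_iff_has_vector_derivative
      by (rule bounded_linear.has_vector_derivative[OF bounded_linear_inner_left Du[OF t]])
    show "((\<lambda>r. v r \<bullet> b n) has_real_derivative (F (u t) \<bullet> b n - v t \<bullet> b n - l n * (u t \<bullet> b n)) / eps)
           (at t within {..0})"
      using DERIV_cdivide[OF Dv[OF t eigen(1)[of n]], of eps] eps by (simp add: eigen(2))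
  next
    show "eps / s n * (v 0 \<bullet> b n) + (1 + s n) / (2 * s n) * (u 0 \<bullet> b n) = p \<bullet> b n" if "n < N" for n
      using bc that unfolding bc_projection[OF p] by simp
  qed
  with that[OF this Du H] show ?thesis by simp
qed

lemma hyp_modal_fixed_point:
  assumes "hyp_modal p u v"
  shows "hsol p n (\<lambda>t. (exp (th * t) *\<^sub>R u t) \<bullet> b n) (\<lambda>t. Fw th t (exp (th * t) *\<^sub>R u t) \<bullet> b n)"
  unfolding hsol_def
proof (intro exI conjI)
  have "mode_eq eps al (l n - mu) (\<lambda>t. exp (th * t) * (F (u t) \<bullet> b n)) (\<lambda>t. exp (th * t) * (u t \<bullet> b n))
      (\<lambda>t. exp (th * t) * (v t \<bullet> b n + th * (u t \<bullet> b n)))"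
    by (rule weighted_mode) (use assms in \<open>auto simp: hyp_modal_def\<close>)
  thus "mode_eq eps al (d n) (\<lambda>t. Fw th t (exp (th * t) *\<^sub>R u t) \<bullet> b n) (\<lambda>t. (exp (th * t) *\<^sub>R u t) \<bullet> b n)
      (\<lambda>t. exp (th * t) * (v t \<bullet> b n + th * (u t \<bullet> b n)))"
    by (simp add: d_def Fw_def exp_minus)
  show "bc n (p \<bullet> b n) (\<lambda>t. (exp (th * t) *\<^sub>R u t) \<bullet> b n) (\<lambda>t. exp (th * t) * (v t \<bullet> b n + th * (u t \<bullet> b n)))"
    using assms bc_iff[of n] by (auto simp: hyp_modal_def bc_def)
qed

lemma hyp_modal_unique:
  assumes "hyp_modal p u v" "hyp_modal p u' v'" "t \<le> 0"
  shows "u t = u' t"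
proof -
  interpret mp: modal_problem b "hsol p" dl "KH / l 0" L N "Fw th"
    by (rule hsol_modal_problem)
  have "exp (th * t) *\<^sub>R u t = exp (th * t) *\<^sub>R u' t"
  proof (rule mp.fixed_point_unique[OF _ _ _ _ assms(3), of "\<lambda>t. exp (th * t) *\<^sub>R u t" "\<lambda>t. exp (th * t) *\<^sub>R u' t"])
    show "mp.Sol (\<lambda>t. exp (th * t) *\<^sub>R u t) (\<lambda>t. Fw th t (exp (th * t) *\<^sub>R u t))"
      unfolding mp.Sol_def using hyp_modal_fixed_point[OF assms(1)] by blast
    show "mp.Sol (\<lambda>t. exp (th * t) *\<^sub>R u' t) (\<lambda>t. Fw th t (exp (th * t) *\<^sub>R u' t))"
      unfolding mp.Sol_def using hyp_modal_fixed_point[OF assms(2)] by blast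
  qed (use assms in \<open>auto simp: hyp_modal_def\<close>)
  thus ?thesis by simp
qed

text \<open>
  The fixed point lies in the energy class because the modal energies \<open>eps x\<^sub>n\<^sup>2 + \<lambda>\<^sub>n y\<^sub>n\<^sup>2\<close> are
  bounded, uniformly in time, by a summable sequence \<open>\<beta>\<close>.  Hence the derivative \<open>X\<close> and the lift \<open>Z\<close> with coefficients
  \<open>\<lambda>\<^sub>n\<^bsup>1/2\<^esup> y\<^sub>n\<close> are continuous with values in \<open>H\<close>.
\<close>

lemma hyperbolic_solution_exists:
  assumes p: "p \<in> range (spectral_proj e N)"
  shows "\<exists>u. solves_hyperbolic D A lam e F N eps p u"
proof -
  interpret mp: modal_problem b "hsol p" dl "KH / l 0" L N "Fw th"
    by (rule hsol_modal_problem)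
  obtain Y where Y: "half_L2 Y" and SY: "mp.Sol Y (\<lambda>t. Fw th t (Y t))"
    by (rule mp.fixed_point_exists)
  have g: "half_L2 (\<lambda>t. Fw th t (Y t))" by (rule mp.G_L2[OF Y])
  have "\<forall>n. \<exists>x. mode_eq eps al (d n) (\<lambda>t. Fw th t (Y t) \<bullet> b n) (\<lambda>t. Y t \<bullet> b n) x \<and> bc n (p \<bullet> b n) (\<lambda>t. Y t \<bullet> b n) x"
    using SY unfolding mp.Sol_def hsol_def by blast
  then obtain x where x: "\<And>n. mode_eq eps al (d n) (\<lambda>t. Fw th t (Y t) \<bullet> b n) (\<lambda>t. Y t \<bullet> b n) (x n)"
    and bcx: "\<And>n. bc n (p \<bullet> b n) (\<lambda>t. Y t \<bullet> b n) (x n)" by metis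
  define \<beta> where "\<beta> n = KH * (sqn (\<lambda>t. Fw th t (Y t) \<bullet> b n) + (p \<bullet> b n)\<^sup>2)" for n
  have \<beta>0: "0 \<le> \<beta> n" for n
    unfolding \<beta>_def using KH_bounds(3) by (intro mult_nonneg_nonneg add_nonneg_nonneg half_integral_nonneg) auto
  have "(\<Sum>n<k. \<beta> n) \<le> KH * (sqn (\<lambda>t. Fw th t (Y t)) + (norm p)\<^sup>2)" for k
    unfolding \<beta>_def sum_distrib_left[symmetric] sum.distrib
    by (intro mult_left_mono add_mono sqn_partial[OF g] bessel) (use KH_bounds(3) in simp)
  hence \<beta>s: "summable \<beta>" by (rule summableI_nonneg_bounded[OF \<beta>0])
  have energy: "eps * (x n t)\<^sup>2 + l n * (Y t \<bullet> b n)\<^sup>2 \<le> \<beta> n" if "t \<le> 0" for n t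
    unfolding \<beta>_def
    by (rule mode_bounds(2)[OF x half_L2_inner[OF Y] half_L2_inner[OF g] bcx low_projection[OF p] that])
  have tail: "(\<lambda>m. c * (\<Sum>n. \<beta> (n + m))) \<longlonglongrightarrow> 0" for c
    using tendsto_mult_right_zero[OF suminf_exist_split2[OF \<beta>s]] by simp
  obtain X where X: "continuous_on {..0} X" "\<And>t n. t \<in> {..0} \<Longrightarrow> X t \<bullet> b n = x n t"
  proof (rule continuous_from_coefficients[of "{..0}" x "\<lambda>m. 1 / eps * (\<Sum>n. \<beta> (n + m))"])
    show "continuous_on {..0} (x n)" for n
      by (rule continuous_on_half_of_deriv) (use x[of n] in \<open>auto simp: mode_eq_def\<close>)
    show "(\<Sum>n\<in>{m..<k}. (x n t)\<^sup>2) \<le> 1 / eps * (\<Sum>n. \<beta> (n + m))" if "t \<in> {..0}" for t m k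
    proof -
      have "(x n t)\<^sup>2 \<le> 1 / eps * \<beta> n" for n
      proof -
        have "0 \<le> l n * (Y t \<bullet> b n)\<^sup>2" using l_pos[of n] by simp
        hence "eps * (x n t)\<^sup>2 \<le> \<beta> n" using energy[of t n] that by simp
        thus ?thesis using eps by (simp add: field_simps)
      qed
      hence "(\<Sum>n\<in>{m..<k}. (x n t)\<^sup>2) \<le> 1 / eps * (\<Sum>n\<in>{m..<k}. \<beta> n)"
        unfolding sum_distrib_left by (intro sum_mono)
      also have "\<dots> \<le> 1 / eps * (\<Sum>n. \<beta> (n + m))"
        by (intro mult_left_mono sum_Ico_le_tail \<beta>s \<beta>0) (use eps in simp)
      finally show ?thesis .
    qed
  qed (rule tail, rule that)
  obtain Z where Z: "continuous_on {..0} Z" "\<And>t n. t \<in> {..0} \<Longrightarrow> Z t \<bullet> b n = sqrt (l n) * (Y t \<bullet> b n)"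
  proof (rule continuous_from_coefficients[of "{..0}" "\<lambda>n t. sqrt (l n) * (Y t \<bullet> b n)" "\<lambda>m. 1 * (\<Sum>n. \<beta> (n + m))"])
    show "continuous_on {..0} (\<lambda>t. sqrt (l n) * (Y t \<bullet> b n))" for n
      by (intro continuous_intros half_L2_cont[OF Y])
    show "(\<Sum>n\<in>{m..<k}. (sqrt (l n) * (Y t \<bullet> b n))\<^sup>2) \<le> 1 * (\<Sum>n. \<beta> (n + m))" if "t \<in> {..0}" for t m k
    proof -
      have "(sqrt (l n) * (Y t \<bullet> b n))\<^sup>2 \<le> \<beta> n" for n
      proof -
        have "0 \<le> eps * (x n t)\<^sup>2" using eps by simp
        thus ?thesis using energy[of t n] that l_pos[of n] by (simp add: power_mult_distrib less_imp_le)
      qed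
      hence "(\<Sum>n\<in>{m..<k}. (sqrt (l n) * (Y t \<bullet> b n))\<^sup>2) \<le> (\<Sum>n\<in>{m..<k}. \<beta> n)"
        by (intro sum_mono)
      also have "\<dots> \<le> (\<Sum>n. \<beta> (n + m))" by (rule sum_Ico_le_tail[OF \<beta>s \<beta>0])
      finally show ?thesis by simp
    qed
  qed (rule tail, rule that)
  define u where "u t = exp (- (th * t)) *\<^sub>R Y t" for t
  define v where "v t = exp (- (th * t)) *\<^sub>R (X t - th *\<^sub>R Y t)" for t
  define ur where "ur = restrict u {..0}"
  have ur: "ur t = u t" if "t \<le> 0" for t using that by (simp add: ur_def)
  have uc: "continuous_on {..0} u" unfolding u_def by (intro continuous_intros half_L2_cont[OF Y])
  have vc: "continuous_on {..0} v" unfolding v_def by (intro continuous_intros half_L2_cont[OF Y] X)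
  have vn: "v t \<bullet> b n = exp (- (th * t)) * (x n t - th * (Y t \<bullet> b n))" if "t \<le> 0" for t n
    using X(2)[of t n] that by (simp add: v_def inner_diff_left)
  have un: "u t \<bullet> b n = exp (- (th * t)) * (Y t \<bullet> b n)" for t n by (simp add: u_def)
  have Fn: "exp (- (th * t)) * (Fw th t (Y t) \<bullet> b n) = F (u t) \<bullet> b n" for t n
    by (simp add: Fw_def u_def exp_minus)
  have xm: "mode_eq eps al (l n - mu) (\<lambda>t. Fw th t (Y t) \<bullet> b n) (\<lambda>t. Y t \<bullet> b n) (x n)" for n
    using x[of n] by (simp add: d_def)
  have Dun: "((\<lambda>r. u r \<bullet> b n) has_real_derivative v t \<bullet> b n) (at t within {..0})" if t: "t \<le> 0" for n t
    using unweighted_mode(1)[OF xm t, of n] by (simp add: un vn[OF t])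
  have Dvn: "((\<lambda>r. v r \<bullet> b n) has_real_derivative (F (u t) \<bullet> b n - v t \<bullet> b n - l n * (u t \<bullet> b n)) / eps)
      (at t within {..0})" if t: "t \<le> 0" for n t
  proof -
    have "((\<lambda>t. exp (- (th * t)) * (x n t - th * (Y t \<bullet> b n))) has_real_derivative
       (F (u t) \<bullet> b n - v t \<bullet> b n - l n * (u t \<bullet> b n)) / eps) (at t within {..0})"
      using unweighted_mode(2)[OF xm t, of n] by (simp only: Fn un[symmetric] vn[OF t, symmetric])
    thus ?thesis by (rule half_derivative_cong[OF _ t]) (simp add: vn)
  qed
  have Du: "(ur has_vector_derivative v t) (at t within {..0})" if t: "t \<le> 0" for t
    by (rule has_vector_derivative_transform[OF _ _ vector_derivative_from_modes[OF vc Dun t]]) (use t ur in auto)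
  have weak: "((\<lambda>s. eps * (v s \<bullet> \<phi>)) has_real_derivative F (u t) \<bullet> \<phi> - v t \<bullet> \<phi> - u t \<bullet> A \<phi>) (at t within {..0})"
    if t: "t \<le> 0" and \<phi>: "\<phi> \<in> D" for t \<phi>
  proof -
    \<comment> \<open>applying the inverse of \<open>A\<close> turns the weak equation into a differential equation in \<open>H\<close>\<close>
    define W where "W t = (1 / eps) *\<^sub>R (Ainv (F (u t) - v t) - u t)" for t
    have Wc: "continuous_on {..0} W"
      unfolding W_def
      by (intro continuous_intros continuous_on_compose2[OF Ainv_continuous[of UNIV]]
          continuous_on_compose2[OF F_continuous[of UNIV]] uc vc) auto
    have "((\<lambda>t. Ainv (v t)) has_vector_derivative W t) (at t within {..0})"
    proof (rule vector_derivative_from_modes[OF Wc _ t])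
      fix n and t :: real assume t: "t \<le> 0"
      have "((\<lambda>r. (v r \<bullet> b n) / l n) has_real_derivative
         ((F (u t) \<bullet> b n - v t \<bullet> b n - l n * (u t \<bullet> b n)) / eps) / l n) (at t within {..0})"
        by (rule DERIV_cdivide[OF Dvn[OF t]])
      also have "((F (u t) \<bullet> b n - v t \<bullet> b n - l n * (u t \<bullet> b n)) / eps) / l n = W t \<bullet> b n"
        using l_pos[of n] eps by (simp add: W_def Ainv_coefficient inner_diff_left field_simps)
      finally show "((\<lambda>r. Ainv (v r) \<bullet> b n) has_real_derivative W t \<bullet> b n) (at t within {..0})"
        by (simp add: Ainv_coefficient)
    qed
    hence "((\<lambda>t. Ainv (v t) \<bullet> A \<phi>) has_real_derivative W t \<bullet> A \<phi>) (at t within {..0})"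
      unfolding has_real_derivative_iff_has_vector_derivative
      by (rule bounded_linear.has_vector_derivative[OF bounded_linear_inner_left])
    hence "((\<lambda>t. eps * (Ainv (v t) \<bullet> A \<phi>)) has_real_derivative eps * (W t \<bullet> A \<phi>)) (at t within {..0})"
      by (rule DERIV_cmult)
    moreover have "Ainv y \<bullet> A \<phi> = y \<bullet> \<phi>" for y using Ainv(3)[OF \<phi>] by (simp add: Ainv_symmetric)
    ultimately show ?thesis using eps by (simp add: W_def inner_diff_left)
  qed
  have H1: "u t \<in> Hs_space lam e 1" if "t \<le> 0" for t
    by (rule Hs_norm_one(1)[of "exp (- (th * t)) *\<^sub>R Z t"]) (use Z(2) that in \<open>simp add: un\<close>)
  have H1c: "((\<lambda>r. Hs_norm lam e 1 (ur r - ur t)) \<longlongrightarrow> 0) (at t within {..0})" if t: "t \<le> 0" for t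
  proof -
    define z where "z t = exp (- (th * t)) *\<^sub>R Z t" for t
    have zc: "continuous_on {..0} z" unfolding z_def by (intro continuous_intros Z)
    have "Hs_norm lam e 1 (ur r - ur t) = norm (z r - z t)" if "r \<le> 0" for r
      by (rule Hs_norm_one(2)) (use Z(2) that t in \<open>simp add: ur un z_def inner_diff_left algebra_simps\<close>)
    moreover have "((\<lambda>r. norm (z r - z t)) \<longlongrightarrow> 0) (at t within {..0})"
      using zc t by (auto simp: continuous_on_def intro!: tendsto_norm_zero LIM_zero)
    ultimately show ?thesis
      by (auto elim!: Lim_transform_eventually simp: eventually_at_filter)
  qed
  have bc0: "hat_proj lam e N eps (v 0) + cal_proj lam e N eps (ur 0) = p"
    unfolding bc_projection[OF p]
  proof (intro allI impI)
    fix n assume n: "n < N"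
    show "eps / s n * (v 0 \<bullet> b n) + (1 + s n) / (2 * s n) * (ur 0 \<bullet> b n) = p \<bullet> b n"
      unfolding bc_iff[OF n] using bcx[of n] n vn[of 0 n] by (simp add: bc_def ur un)
  qed
  have "half_L2 (\<lambda>t. exp (th * t) *\<^sub>R u t)" using Y by (simp add: u_def exp_minus)
  hence "in_weighted_L2 th u" using in_weighted_L2_iff[OF uc] by simp
  hence w: "in_weighted_L2 th ur"
    unfolding in_weighted_L2_def by (subst set_integrable_cong[OF refl refl, where f' = "\<lambda>t. exp (2 * th * t) * (norm (u t))\<^sup>2"]) (auto simp: ur)
  have "solves_hyperbolic D A lam e F N eps p ur"
    unfolding solves_hyperbolic_def theta_eps_eq
  proof (intro conjI exI[of _ v] allI impI ballI w vc bc0 Du H1c)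
    show "ur \<in> extensional {..0}" by (simp add: ur_def)
    show "ur t \<in> Hs_space lam e 1" if "t \<le> 0" for t using H1 that by (simp add: ur)
    show "((\<lambda>s. eps * (v s \<bullet> \<phi>)) has_real_derivative F (ur t) \<bullet> \<phi> - v t \<bullet> \<phi> - ur t \<bullet> A \<phi>) (at t within {..0})"
      if "t \<le> 0" "\<phi> \<in> D" for t \<phi> using weak[OF that] that by (simp add: ur)
  qed
  thus ?thesis by blast
qed

lemma M_eps_modal:
  assumes p: "p \<in> range (spectral_proj e N)"
  obtains u v where "hyp_modal p u v" "M_eps D A lam e F N eps p = (u 0, v 0)" "u 0 \<in> Hs_space lam e 1"
proof -
  define u where "u = U_eps D A lam e F N eps p"
  have uniq: "x = y" if x: "solves_hyperbolic D A lam e F N eps p x" and y: "solves_hyperbolic D A lam e F N eps p y" for x y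
  proof -
    obtain v where v: "hyp_modal p x v" using solves_hyperbolic_modal[OF p x] by metis
    obtain w where w: "hyp_modal p y w" using solves_hyperbolic_modal[OF p y] by metis
    show ?thesis
    proof (rule extensionalityI)
      show "x \<in> extensional {..0}" "y \<in> extensional {..0}" using x y by (simp_all add: solves_hyperbolic_def)
    qed (use hyp_modal_unique[OF v w] in simp)
  qed
  obtain u' where u': "solves_hyperbolic D A lam e F N eps p u'" using hyperbolic_solution_exists[OF p] by blast
  have "solves_hyperbolic D A lam e F N eps p u"
    unfolding u_def U_eps_def by (rule theI[where P = "solves_hyperbolic D A lam e F N eps p", OF u' uniq[OF _ u']])
  then obtain v where v: "hyp_modal p u v" "\<And>t. t \<le> 0 \<Longrightarrow> (u has_vector_derivative v t) (at t within {..0})"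
    "u 0 \<in> Hs_space lam e 1" using solves_hyperbolic_modal[OF p] by metis
  have nt: "at 0 within {..0::real} \<noteq> bot"
  proof
    assume "at 0 within {..0::real} = bot"
    moreover have "{..<0::real} \<subseteq> {..0}" by auto
    ultimately have "at_left (0::real) \<le> bot" by (metis at_le)
    hence "at_left (0::real) = bot" by (rule le_bot)
    thus False by simp
  qed
  have "vector_derivative u (at 0 within {..0}) = v 0"
    by (rule vector_derivative_within[OF nt v(2)]) simp
  thus ?thesis using that[OF v(1) _ v(3)] by (simp add: M_eps_def u_def Let_def)
qed

end

section \<open>The parabolic equation\<close>

context inertial_setting
begin

definition KP where "KP = l N / dl + l N * (1 / dl\<^sup>2 + 4) * (1 + mu)"

lemma KP_bounds: "l N / dl \<le> KP" "l N * (1 / dl\<^sup>2 + 4) * (1 + mu) \<le> KP" "0 < KP"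
proof -
  have "0 < l N / dl" using l_pos dl by simp
  moreover have "0 < l N * (1 / dl\<^sup>2 + 4) * (1 + mu)"
    using l_pos[of N] dl mu_pos by (intro mult_pos_pos add_pos_pos) auto
  ultimately show "l N / dl \<le> KP" "l N * (1 / dl\<^sup>2 + 4) * (1 + mu) \<le> KP" "0 < KP" by (auto simp: KP_def)
qed

lemma par_mode_bounds:
  fixes y g :: "real \<Rightarrow> real"
  assumes Dy: "\<And>t. t \<le> 0 \<Longrightarrow> (y has_real_derivative g t - d n * y t) (at t within {..0})"
    and y: "half_L2 y" and g: "half_L2 g"
    and q: "n < N \<Longrightarrow> y 0 = q"
  shows "dl\<^sup>2 * sqn y \<le> sqn g + mu * q\<^sup>2"
    "\<And>t. t \<le> 0 \<Longrightarrow> l n * (y t)\<^sup>2 \<le> KP * (sqn g + q\<^sup>2)"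
proof -
  have g0: "0 \<le> sqn g" and y0: "0 \<le> sqn y" by (rule half_integral_nonneg; simp)+
  have b: "d n * (y 0)\<^sup>2 + (d n)\<^sup>2 * sqn y \<le> sqn g" by (rule first_order_mode_L2[OF Dy y g])
  have mq: "0 \<le> mu * q\<^sup>2" using mu_pos by simp
  have "dl\<^sup>2 * sqn y \<le> sqn g + mu * q\<^sup>2 \<and> (\<forall>t\<le>0. l n * (y t)\<^sup>2 \<le> KP * (sqn g + q\<^sup>2))"
  proof (cases "n < N")
    case False
    hence dn: "dl \<le> d n" using d_high by simp
    have "dl\<^sup>2 * sqn y \<le> (d n)\<^sup>2 * sqn y" using dn dl y0 by (intro mult_right_mono power_mono) auto
    moreover have "0 \<le> d n * (y 0)\<^sup>2" using dn dl by simp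
    ultimately have 1: "dl\<^sup>2 * sqn y \<le> sqn g" using b by linarith
    have "l n * (y t)\<^sup>2 \<le> KP * (sqn g + q\<^sup>2)" if t: "t \<le> 0" for t
    proof -
      have "l n * (y t)\<^sup>2 \<le> l N / dl * d n * (y t)\<^sup>2" by (rule mult_right_mono[OF l_le_d]) (use False in auto)
      also have "\<dots> = l N / dl * (d n * (y t)\<^sup>2)" by simp
      also have "\<dots> \<le> KP * (sqn g + q\<^sup>2)"
      proof (rule mult_mono[OF KP_bounds(1)])
        show "d n * (y t)\<^sup>2 \<le> sqn g + q\<^sup>2" using first_order_mode_at[OF Dy y g t] zero_le_power2[of q] by linarith
      qed (use KP_bounds(3) dn dl in auto)
      finally show ?thesis .
    qed
    thus ?thesis using 1 mq by simp
  next
    case True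
    define R where "R = sqn g + mu * q\<^sup>2"
    define Dn where "Dn = - d n"
    have Dn: "d n = - Dn" "0 < Dn" "dl \<le> Dn" "Dn \<le> mu"
      using d_low[OF True] d_low'[OF True] dl by (auto simp: Dn_def)
    have R0: "0 \<le> R" and gR: "sqn g \<le> R" using g0 mq by (auto simp: R_def)
    have "Dn * q\<^sup>2 \<le> mu * q\<^sup>2" using Dn by (intro mult_right_mono) auto
    hence 1: "Dn\<^sup>2 * sqn y \<le> R" using b q[OF True] by (simp add: Dn(1) R_def)
    have "dl\<^sup>2 * sqn y \<le> Dn\<^sup>2 * sqn y" using Dn dl y0 by (intro mult_right_mono power_mono) auto
    hence 2: "dl\<^sup>2 * sqn y \<le> R" using 1 by linarith
    define x where "x t = g t + Dn *\<^sub>R y t" for t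
    have x: "half_L2 x" unfolding x_def[abs_def] by (rule half_L2_add[OF g half_L2_scale(1)[OF y]])
    have "sqn x \<le> 2 * sqn g + 2 * sqn (\<lambda>t. Dn *\<^sub>R y t)"
      unfolding x_def by (rule half_L2_add(2)[OF g half_L2_scale(1)[OF y]])
    also have "sqn (\<lambda>t. Dn *\<^sub>R y t) = Dn\<^sup>2 * sqn y" by (rule half_L2_scale(2)[OF y])
    finally have sx: "sqn x \<le> 4 * R" using 1 gR by linarith
    have "l n * (y t)\<^sup>2 \<le> KP * (sqn g + q\<^sup>2)" if t: "t \<le> 0" for t
    proof -
      have "(y t)\<^sup>2 \<le> sqn y + sqn x"
        by (rule sq_le_sqn_derivative[OF _ y x t]) (use Dy in \<open>simp add: x_def Dn(1)\<close>)
      also have "\<dots> \<le> R / dl\<^sup>2 + 4 * R" using 2 sx dl by (intro add_mono) (auto simp: field_simps)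
      also have "\<dots> = (1 / dl\<^sup>2 + 4) * R" by (simp add: field_simps)
      finally have yk: "(y t)\<^sup>2 \<le> (1 / dl\<^sup>2 + 4) * R" .
      have "l n * (y t)\<^sup>2 \<le> l N * ((1 / dl\<^sup>2 + 4) * R)"
        using l_mono[of n N] True l_pos[of N] yk by (intro mult_mono) auto
      also have "\<dots> \<le> l N * ((1 / dl\<^sup>2 + 4) * ((1 + mu) * (sqn g + q\<^sup>2)))"
      proof (intro mult_left_mono)
        show "R \<le> (1 + mu) * (sqn g + q\<^sup>2)" using g0 mu_pos by (simp add: R_def algebra_simps)
      qed (use l_pos[of N] in auto)
      also have "\<dots> = l N * (1 / dl\<^sup>2 + 4) * (1 + mu) * (sqn g + q\<^sup>2)" by (simp only: mult.assoc)
      also have "\<dots> \<le> KP * (sqn g + q\<^sup>2)" by (rule mult_right_mono[OF KP_bounds(2)]) (use g0 in simp)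
      finally show ?thesis .
    qed
    thus ?thesis using 2 by (simp add: R_def)
  qed
  thus "dl\<^sup>2 * sqn y \<le> sqn g + mu * q\<^sup>2"
    "\<And>t. t \<le> 0 \<Longrightarrow> l n * (y t)\<^sup>2 \<le> KP * (sqn g + q\<^sup>2)" by auto
qed

definition psol :: "'a \<Rightarrow> nat \<Rightarrow> (real \<Rightarrow> real) \<Rightarrow> (real \<Rightarrow> real) \<Rightarrow> bool" where
  "psol p n y g \<longleftrightarrow> (\<forall>t\<le>0. (y has_real_derivative g t - d n * y t) (at t within {..0})) \<and>
     (n < N \<longrightarrow> y 0 = p \<bullet> b n)"

lemma psol_exists:
  assumes g: "half_L2 g"
  shows "\<exists>y. half_L2 y \<and> psol p n y g"
proof (cases "n < N")
  case True
  have "d n < 0" using d_low[OF True] dl by simp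
  from first_order_unstable_mode_solvable[OF this g, of "p \<bullet> b n"] show ?thesis by (metis psol_def)
next
  case False
  have "d n > 0" using d_high[of n] dl False by simp
  from first_order_stable_mode_solvable[OF this g] show ?thesis using False by (metis psol_def)
qed

lemma psol_diff:
  assumes "psol p n y g" "psol p n y' g'" and h: "half_L2 y" "half_L2 y'" "half_L2 g" "half_L2 g'"
  shows "dl\<^sup>2 * sqn (\<lambda>t. y t - y' t) \<le> sqn (\<lambda>t. g t - g' t)"
    "t \<le> 0 \<Longrightarrow> (y t - y' t)\<^sup>2 \<le> KP / l 0 * sqn (\<lambda>t. g t - g' t)"
proof -
  have D: "((\<lambda>t. y t - y' t) has_real_derivative (g t - g' t) - d n * (y t - y' t)) (at t within {..0})" if "t \<le> 0" for t
  proof -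
    have "((\<lambda>t. y t - y' t) has_real_derivative (g t - d n * y t) - (g' t - d n * y' t)) (at t within {..0})"
      using assms(1,2) that by (intro DERIV_diff) (auto simp: psol_def)
    thus ?thesis by (simp add: algebra_simps)
  qed
  have z: "n < N \<Longrightarrow> y 0 - y' 0 = 0" using assms(1,2) by (simp add: psol_def)
  have "dl\<^sup>2 * sqn (\<lambda>t. y t - y' t) \<le> sqn (\<lambda>t. g t - g' t) + mu * 0\<^sup>2"
    by (rule par_mode_bounds(1)[OF D half_L2_diff[OF h(1,2)] half_L2_diff[OF h(3,4)] z])
  thus "dl\<^sup>2 * sqn (\<lambda>t. y t - y' t) \<le> sqn (\<lambda>t. g t - g' t)" by simp
  assume t: "t \<le> 0"
  have "l 0 * (y t - y' t)\<^sup>2 \<le> l n * (y t - y' t)\<^sup>2"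
    using l_mono[of 0 n] by (intro mult_right_mono) auto
  also have "l n * (y t - y' t)\<^sup>2 \<le> KP * (sqn (\<lambda>t. g t - g' t) + 0\<^sup>2)"
    by (rule par_mode_bounds(2)[OF D half_L2_diff[OF h(1,2)] half_L2_diff[OF h(3,4)] z t])
  also have "\<dots> = KP * sqn (\<lambda>t. g t - g' t)" by simp
  finally show "(y t - y' t)\<^sup>2 \<le> KP / l 0 * sqn (\<lambda>t. g t - g' t)"
    using l_pos[of 0] by (simp add: field_simps)
qed

lemma psol_modal_problem: "modal_problem b (psol p) dl (KP / l 0) L N (Fw mu)"
proof
  show "psol p n (\<lambda>t. 0) (\<lambda>t. 0)" if "N \<le> n" for n using that by (simp add: psol_def)
  show "half_L2 g \<Longrightarrow> \<exists>y. half_L2 y \<and> psol p n y g" for g n by (rule psol_exists)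
  fix n y g y' g' assume h: "psol p n y g" "\<And>t. t \<le> 0 \<Longrightarrow> y t = y' t" "\<And>t. t \<le> 0 \<Longrightarrow> g t = g' t"
  show "psol p n y' g'"
    unfolding psol_def
  proof (intro conjI allI impI)
    fix t :: real assume t: "t \<le> 0"
    have "(y has_real_derivative g' t - d n * y' t) (at t within {..0})"
      using h t by (auto simp: psol_def)
    thus "(y' has_real_derivative g' t - d n * y' t) (at t within {..0})"
      by (rule half_derivative_cong[OF _ t h(2)])
  qed (use h(1) h(2)[of 0] in \<open>simp add: psol_def\<close>)
next
  show "0 \<le> KP / l 0" using KP_bounds(3) l_pos[of 0] by simp
qed (fact dl(1) L_nonneg psol_diff | rule Fw_lip | rule Fw_zero | erule Fw_cont)+

definition par_modal :: "'a \<Rightarrow> (real \<Rightarrow> 'a) \<Rightarrow> bool" where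
  "par_modal p u \<longleftrightarrow> continuous_on {..0} u \<and> half_L2 (\<lambda>t. exp (mu * t) *\<^sub>R u t) \<and>
     (\<forall>n. \<forall>t\<le>0. ((\<lambda>r. u r \<bullet> b n) has_real_derivative F (u t) \<bullet> b n - l n * (u t \<bullet> b n)) (at t within {..0})) \<and>
     (\<forall>n<N. u 0 \<bullet> b n = p \<bullet> b n)"

lemma weighted_first_order:
  fixes w :: "real \<Rightarrow> real" and h :: real
  assumes "(w has_real_derivative h - c * w t) (at t within {..0})"
  shows "((\<lambda>t. exp (mu * t) * w t) has_real_derivative exp (mu * t) * h - (c - mu) * (exp (mu * t) * w t)) (at t within {..0})"
  using assms by (auto intro!: derivative_eq_intros simp: algebra_simps)

lemma par_modal_fixed_point:
  assumes "par_modal p u"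
  shows "psol p n (\<lambda>t. (exp (mu * t) *\<^sub>R u t) \<bullet> b n) (\<lambda>t. Fw mu t (exp (mu * t) *\<^sub>R u t) \<bullet> b n)"
  unfolding psol_def
proof (intro conjI allI impI)
  fix t :: real assume t: "t \<le> 0"
  have "((\<lambda>t. exp (mu * t) * (u t \<bullet> b n)) has_real_derivative
      exp (mu * t) * (F (u t) \<bullet> b n) - (l n - mu) * (exp (mu * t) * (u t \<bullet> b n))) (at t within {..0})"
    by (rule weighted_first_order) (use assms t in \<open>auto simp: par_modal_def\<close>)
  thus "((\<lambda>t. (exp (mu * t) *\<^sub>R u t) \<bullet> b n) has_real_derivative
      Fw mu t (exp (mu * t) *\<^sub>R u t) \<bullet> b n - d n * ((exp (mu * t) *\<^sub>R u t) \<bullet> b n)) (at t within {..0})"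
    by (simp add: d_def Fw_def exp_minus)
qed (use assms in \<open>simp add: par_modal_def\<close>)

lemma par_modal_unique:
  assumes "par_modal p u" "par_modal p u'" "t \<le> 0"
  shows "u t = u' t"
proof -
  interpret mp: modal_problem b "psol p" dl "KP / l 0" L N "Fw mu"
    by (rule psol_modal_problem)
  have "exp (mu * t) *\<^sub>R u t = exp (mu * t) *\<^sub>R u' t"
  proof (rule mp.fixed_point_unique[OF _ _ _ _ assms(3), of "\<lambda>t. exp (mu * t) *\<^sub>R u t" "\<lambda>t. exp (mu * t) *\<^sub>R u' t"])
    show "mp.Sol (\<lambda>t. exp (mu * t) *\<^sub>R u t) (\<lambda>t. Fw mu t (exp (mu * t) *\<^sub>R u t))"
      unfolding mp.Sol_def using par_modal_fixed_point[OF assms(1)] by blast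
    show "mp.Sol (\<lambda>t. exp (mu * t) *\<^sub>R u' t) (\<lambda>t. Fw mu t (exp (mu * t) *\<^sub>R u' t))"
      unfolding mp.Sol_def using par_modal_fixed_point[OF assms(2)] by blast
  qed (use assms in \<open>auto simp: par_modal_def\<close>)
  thus ?thesis by simp
qed

lemma par_modal_exists: "\<exists>u. par_modal p u"
proof -
  interpret mp: modal_problem b "psol p" dl "KP / l 0" L N "Fw mu"
    by (rule psol_modal_problem)
  obtain Y where Y: "half_L2 Y" and SY: "mp.Sol Y (\<lambda>t. Fw mu t (Y t))" by (rule mp.fixed_point_exists)
  define u where "u t = exp (- (mu * t)) *\<^sub>R Y t" for t
  have "par_modal p u"
    unfolding par_modal_def
  proof (intro conjI allI impI)
    show "continuous_on {..0} u" unfolding u_def by (intro continuous_intros half_L2_cont[OF Y])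
    show "half_L2 (\<lambda>t. exp (mu * t) *\<^sub>R u t)" using Y by (simp add: u_def exp_minus)
    fix n and t :: real assume t: "t \<le> 0"
    have y: "((\<lambda>t. Y t \<bullet> b n) has_real_derivative Fw mu t (Y t) \<bullet> b n - (l n - mu) * (Y t \<bullet> b n)) (at t within {..0})"
      using SY t by (auto simp: mp.Sol_def psol_def d_def)
    have "((\<lambda>t. exp (- (mu * t)) * (Y t \<bullet> b n)) has_real_derivative
       exp (- (mu * t)) * (Fw mu t (Y t) \<bullet> b n) - l n * (exp (- (mu * t)) * (Y t \<bullet> b n))) (at t within {..0})"
      using y by (auto intro!: derivative_eq_intros simp: algebra_simps)
    moreover have "exp (- (mu * r)) * (Y r \<bullet> b n) = u r \<bullet> b n" for r by (simp add: u_def)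
    moreover have "exp (- (mu * t)) * (Fw mu t (Y t) \<bullet> b n) = F (u t) \<bullet> b n" by (simp add: u_def Fw_def exp_minus)
    ultimately show "((\<lambda>r. u r \<bullet> b n) has_real_derivative F (u t) \<bullet> b n - l n * (u t \<bullet> b n)) (at t within {..0})"
      by (simp only:)
  next
    show "u 0 \<bullet> b n = p \<bullet> b n" if "n < N" for n
      using SY that by (auto simp: mp.Sol_def psol_def u_def)
  qed
  thus ?thesis by blast
qed

text \<open>
  Bounds for \<open>L\<^sup>2\<close> norms (\<open>c1\<close>) and for energies (\<open>c2\<close>) of solutions in terms of their low modes at \<open>0\<close>, and for
  the low modes of difference quotients at \<open>0\<close> (\<open>c3\<close>).
\<close>

definition c1 where "c1 = mu / (dl\<^sup>2 - L\<^sup>2)"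
definition c2 where "c2 = KP * (L\<^sup>2 * c1 + 1)"
definition c3 where "c3 = real N * ((L + l N) * exp mu)\<^sup>2 * (c2 / l 0)"

lemma gap_sq: "0 < dl\<^sup>2 - L\<^sup>2" using dl L_nonneg by (simp add: power_strict_mono)

lemma c_nonneg: "0 \<le> c1" "0 \<le> c2" "0 \<le> c3"
proof -
  show 1: "0 \<le> c1" using gap_sq mu_pos by (simp add: c1_def)
  show 2: "0 \<le> c2" unfolding c2_def using 1 KP_bounds(3) by (intro mult_nonneg_nonneg add_nonneg_nonneg) auto
  show "0 \<le> c3" unfolding c3_def using 2 l_pos[of 0] by (intro mult_nonneg_nonneg) auto
qed

text \<open>
  A priori bounds for the parabolic equation when the right-hand side is dominated by the solution itself.
  The factor \<open>L < dl\<close> allows absorbing it, so that only the low modes at \<open>0\<close> remain.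
\<close>

lemma par_vector_bounds:
  fixes Y G :: "real \<Rightarrow> 'a"
  assumes ode: "\<And>n t. t \<le> 0 \<Longrightarrow> ((\<lambda>r. Y r \<bullet> b n) has_real_derivative G t \<bullet> b n - d n * (Y t \<bullet> b n)) (at t within {..0})"
    and Y: "half_L2 Y" and Gc: "continuous_on {..0} G" and GY: "\<And>t. t \<le> 0 \<Longrightarrow> norm (G t) \<le> L * norm (Y t)"
    and Q: "\<And>n. n < N \<Longrightarrow> Y 0 \<bullet> b n = Q \<bullet> b n"
  shows "sqn Y \<le> c1 * (norm Q)\<^sup>2" "half_L2 G" "sqn G \<le> L\<^sup>2 * c1 * (norm Q)\<^sup>2"
    "\<And>t k. t \<le> 0 \<Longrightarrow> (\<Sum>n<k. l n * (Y t \<bullet> b n)\<^sup>2) \<le> c2 * (norm Q)\<^sup>2"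
proof -
  have iL: "half_integrable (\<lambda>t. L\<^sup>2 * (norm (Y t))\<^sup>2)" using half_L2_int[OF Y] by simp
  have pw: "(norm (G t))\<^sup>2 \<le> L\<^sup>2 * (norm (Y t))\<^sup>2" if "t \<le> 0" for t
    using power_mono[OF GY[OF that], of 2] by (simp add: power_mult_distrib)
  show G: "half_L2 G" by (rule half_L2_bound(1)[OF Gc iL pw])
  have GL: "sqn G \<le> L\<^sup>2 * sqn Y" using half_L2_bound(2)[OF Gc iL pw] by simp
  have mb: "dl\<^sup>2 * sqn (\<lambda>t. Y t \<bullet> b n) \<le> sqn (\<lambda>t. G t \<bullet> b n) + mu * (Q \<bullet> b n)\<^sup>2"
    "\<And>t. t \<le> 0 \<Longrightarrow> l n * (Y t \<bullet> b n)\<^sup>2 \<le> KP * (sqn (\<lambda>t. G t \<bullet> b n) + (Q \<bullet> b n)\<^sup>2)" for n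
    by (rule par_mode_bounds[OF ode half_L2_inner[OF Y] half_L2_inner[OF G] Q]; assumption)+
  have "sqn Y \<le> (sqn G + mu * (norm Q)\<^sup>2) / dl\<^sup>2"
  proof (rule sqn_le_partial(2)[OF half_L2_cont[OF Y] half_L2_inner[OF Y]])
    fix k
    have "dl\<^sup>2 * (\<Sum>n<k. sqn (\<lambda>t. Y t \<bullet> b n)) \<le> (\<Sum>n<k. sqn (\<lambda>t. G t \<bullet> b n) + mu * (Q \<bullet> b n)\<^sup>2)"
      unfolding sum_distrib_left by (intro sum_mono mb(1))
    also have "\<dots> \<le> sqn G + mu * (norm Q)\<^sup>2"
      unfolding sum.distrib sum_distrib_left[symmetric]
      by (intro add_mono sqn_partial[OF G] mult_left_mono bessel) (use mu_pos in simp)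
    finally show "(\<Sum>n<k. sqn (\<lambda>t. Y t \<bullet> b n)) \<le> (sqn G + mu * (norm Q)\<^sup>2) / dl\<^sup>2"
      using dl by (simp add: field_simps)
  qed
  hence "dl\<^sup>2 * sqn Y \<le> sqn G + mu * (norm Q)\<^sup>2" using dl by (simp add: field_simps)
  hence "(dl\<^sup>2 - L\<^sup>2) * sqn Y \<le> mu * (norm Q)\<^sup>2" using GL by (simp add: left_diff_distrib)
  thus 1: "sqn Y \<le> c1 * (norm Q)\<^sup>2" unfolding c1_def using gap_sq by (simp add: field_simps)
  show 2: "sqn G \<le> L\<^sup>2 * c1 * (norm Q)\<^sup>2"
    using order_trans[OF GL mult_left_mono[OF 1, of "L\<^sup>2"]] by (simp add: mult.assoc)
  show "(\<Sum>n<k. l n * (Y t \<bullet> b n)\<^sup>2) \<le> c2 * (norm Q)\<^sup>2" if t: "t \<le> 0" for t k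
  proof -
    have "(\<Sum>n<k. l n * (Y t \<bullet> b n)\<^sup>2) \<le> KP * (\<Sum>n<k. sqn (\<lambda>t. G t \<bullet> b n) + (Q \<bullet> b n)\<^sup>2)"
      unfolding sum_distrib_left by (intro sum_mono mb(2) t)
    also have "\<dots> \<le> KP * (sqn G + (norm Q)\<^sup>2)"
      unfolding sum.distrib by (intro mult_left_mono add_mono sqn_partial[OF G] bessel) (use KP_bounds in simp)
    also have "\<dots> \<le> KP * (L\<^sup>2 * c1 * (norm Q)\<^sup>2 + (norm Q)\<^sup>2)"
      by (intro mult_left_mono add_mono 2) (use KP_bounds in simp_all)
    finally show ?thesis by (simp add: c2_def algebra_simps)
  qed
qed

lemma norm_sq_le_energy:
  assumes "\<And>k. (\<Sum>n<k. l n * (x \<bullet> b n)\<^sup>2) \<le> B"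
  shows "(norm x)\<^sup>2 \<le> B / l 0"
proof (rule norm_le_partial)
  fix k
  have "l 0 * (\<Sum>n<k. (x \<bullet> b n)\<^sup>2) \<le> (\<Sum>n<k. l n * (x \<bullet> b n)\<^sup>2)"
    unfolding sum_distrib_left using l_mono[of 0] by (intro sum_mono mult_right_mono) auto
  also note assms
  finally show "(\<Sum>n<k. (x \<bullet> b n)\<^sup>2) \<le> B / l 0" using l_pos[of 0] by (simp add: field_simps)
qed

lemma par_modal_bounds:
  assumes u: "par_modal p u" and t: "t \<le> 0"
  shows "(\<Sum>n<k. l n * (exp (mu * t) * (u t \<bullet> b n))\<^sup>2) \<le> c2 * (norm p)\<^sup>2"
    "(exp (mu * t) * norm (u t))\<^sup>2 \<le> c2 / l 0 * (norm p)\<^sup>2"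
proof -
  define Y where "Y t = exp (mu * t) *\<^sub>R u t" for t
  have ode: "((\<lambda>r. Y r \<bullet> b n) has_real_derivative Fw mu t (Y t) \<bullet> b n - d n * (Y t \<bullet> b n)) (at t within {..0})"
    if "t \<le> 0" for n t
    using par_modal_fixed_point[OF u, of n] that by (simp add: psol_def Y_def)
  have Y: "half_L2 Y" unfolding Y_def[abs_def] using u by (simp add: par_modal_def)
  have b: "(\<Sum>n<k. l n * (Y t \<bullet> b n)\<^sup>2) \<le> c2 * (norm p)\<^sup>2" for k
  proof (rule par_vector_bounds(4)[OF ode Y _ _ _ t])
    show "continuous_on {..0} (\<lambda>t. Fw mu t (Y t))" by (rule Fw_cont[OF half_L2_cont[OF Y]])
    show "norm (Fw mu t (Y t)) \<le> L * norm (Y t)" for t using Fw_lip[of mu t "Y t" 0] by (simp add: Fw_zero)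
    show "Y 0 \<bullet> b n = p \<bullet> b n" if "n < N" for n using u that by (simp add: Y_def par_modal_def)
  qed
  from b[of k] show "(\<Sum>n<k. l n * (exp (mu * t) * (u t \<bullet> b n))\<^sup>2) \<le> c2 * (norm p)\<^sup>2" by (simp add: Y_def)
  from norm_sq_le_energy[OF b] show "(exp (mu * t) * norm (u t))\<^sup>2 \<le> c2 / l 0 * (norm p)\<^sup>2" by (simp add: Y_def)
qed

text \<open>
  The difference quotient \<open>q\<close> solves the linear parabolic equation with right-hand side \<open>g\<close>, and
  \<open>|g| \<le> L |q|\<close> by the Lipschitz condition, so \<open>par_vector_bounds\<close> applies.  The low modes of \<open>q\<close> at \<open>0\<close> are,
  by the mean value theorem, low modes of \<open>F(u) - Au\<close> at intermediate times, and hence bounded.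
\<close>

lemma difference_quotient_bounds:
  assumes u: "par_modal p u" and h: "0 < h" "h \<le> 1"
  defines "q \<equiv> \<lambda>t. (1 / h) *\<^sub>R (u t - u (t - h))"
    and "g \<equiv> \<lambda>t. (1 / h) *\<^sub>R (F (u t) - F (u (t - h)))"
  shows "half_L2 (\<lambda>t. exp (mu * t) *\<^sub>R q t)" "sqn (\<lambda>t. exp (mu * t) *\<^sub>R q t) \<le> c1 * c3 * (norm p)\<^sup>2"
    "half_L2 (\<lambda>t. exp (mu * t) *\<^sub>R g t)" "sqn (\<lambda>t. exp (mu * t) *\<^sub>R g t) \<le> L\<^sup>2 * c1 * c3 * (norm p)\<^sup>2"
    "\<And>t k. t \<le> 0 \<Longrightarrow> (\<Sum>n<k. l n * (exp (mu * t) * (q t \<bullet> b n))\<^sup>2) \<le> c2 * c3 * (norm p)\<^sup>2"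
    "\<And>t. norm (g t) \<le> L * norm (q t)"
    "\<And>n t. t \<le> 0 \<Longrightarrow> ((\<lambda>r. q r \<bullet> b n) has_real_derivative g t \<bullet> b n - l n * (q t \<bullet> b n)) (at t within {..0})"
proof -
  define Y where "Y t = exp (mu * t) *\<^sub>R u t" for t
  define Q where "Q t = exp (mu * t) *\<^sub>R q t" for t
  define Gq where "Gq t = exp (mu * t) *\<^sub>R g t" for t
  have uc: "continuous_on {..0} u" and Y: "half_L2 Y" using u by (auto simp: par_modal_def Y_def[abs_def])
  have Du: "((\<lambda>r. u r \<bullet> b n) has_real_derivative F (u t) \<bullet> b n - l n * (u t \<bullet> b n)) (at t within {..0})"
    if "t \<le> 0" for n t using u that by (simp add: par_modal_def)
  have Dsh: "((\<lambda>r. u (r - h) \<bullet> b n) has_real_derivative F (u (t - h)) \<bullet> b n - l n * (u (t - h) \<bullet> b n)) (at t within {..0})"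
    if "t \<le> 0" for n t
    using has_real_derivative_shift[where y = "\<lambda>r. u r \<bullet> b n" and x = "\<lambda>t. F (u t) \<bullet> b n - l n * (u t \<bullet> b n)"
        and a = "- h" and t = t] Du h that by simp
  show Dq: "((\<lambda>r. q r \<bullet> b n) has_real_derivative g t \<bullet> b n - l n * (q t \<bullet> b n)) (at t within {..0})"
    if "t \<le> 0" for n t
  proof -
    have "((\<lambda>r. 1 / h * (u r \<bullet> b n - u (r - h) \<bullet> b n)) has_real_derivative
      1 / h * ((F (u t) \<bullet> b n - l n * (u t \<bullet> b n)) - (F (u (t - h)) \<bullet> b n - l n * (u (t - h) \<bullet> b n)))) (at t within {..0})"
      by (intro DERIV_cmult DERIV_diff Du Dsh that)
    thus ?thesis by (simp add: q_def g_def inner_diff_left algebra_simps diff_divide_distrib)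
  qed
  have Qeq: "Q t = (1 / h) *\<^sub>R Y t - (exp (mu * h) / h) *\<^sub>R Y (t + - h)" for t
    by (simp add: Q_def q_def Y_def scaleR_diff_right algebra_simps flip: exp_add)
  have Q: "half_L2 Q"
    unfolding Qeq[abs_def]
    by (intro half_L2_diff half_L2_scale(1) Y half_L2_shift(1)) (use h in simp)
  show gq: "norm (g t) \<le> L * norm (q t)" for t
    using F_lip[of "u t" "u (t - h)"] h by (simp add: g_def q_def divide_right_mono)
  have GQ: "norm (Gq t) \<le> L * norm (Q t)" for t
    using mult_left_mono[OF gq[of t], of "exp (mu * t)"] by (simp add: Gq_def Q_def mult_ac)
  have shc: "continuous_on {..0} (\<lambda>t. u (t - h))"
    by (rule continuous_on_compose2[OF uc]) (use h in \<open>auto intro!: continuous_intros\<close>)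
  have Gc: "continuous_on {..0} Gq"
    unfolding Gq_def g_def
    by (intro continuous_intros continuous_on_compose2[OF F_continuous[of UNIV]] uc shc) auto
  have DQ: "((\<lambda>r. Q r \<bullet> b n) has_real_derivative Gq t \<bullet> b n - d n * (Q t \<bullet> b n)) (at t within {..0})"
    if "t \<le> 0" for n t
    using weighted_first_order[OF Dq[OF that]] by (simp add: Q_def Gq_def d_def)
  define P where "P = spectral_proj e N (q 0)"
  have QP: "Q 0 \<bullet> b n = P \<bullet> b n" if "n < N" for n
    using that by (simp add: Q_def P_def spectral_proj_coefficient)
  have P3: "(norm P)\<^sup>2 \<le> c3 * (norm p)\<^sup>2"
  proof -
    define B where "B = ((L + l N) * exp mu)\<^sup>2 * (c2 / l 0 * (norm p)\<^sup>2)"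
    have q0: "(q 0 \<bullet> b n)\<^sup>2 \<le> B" if n: "n < N" for n
    proof -
      have "\<exists>r\<in>{-h<..<0}. u 0 \<bullet> b n - u (- h) \<bullet> b n = (F (u r) \<bullet> b n - l n * (u r \<bullet> b n)) * (0 - - h)"
      proof (rule mvt_simple[of "- h" 0 "\<lambda>r. u r \<bullet> b n" "\<lambda>r x. (F (u r) \<bullet> b n - l n * (u r \<bullet> b n)) * x"])
        fix r assume r: "- h \<le> r" "r \<le> 0"
        show "((\<lambda>r. u r \<bullet> b n) has_derivative (\<lambda>x. (F (u r) \<bullet> b n - l n * (u r \<bullet> b n)) * x)) (at r within {- h..0})"
          unfolding has_field_derivative_def[symmetric] by (rule DERIV_subset[OF Du]) (use r in auto)
      qed (use h in simp)
      then obtain r where r: "- h < r" "r < 0"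
        and eq: "u 0 \<bullet> b n - u (- h) \<bullet> b n = (F (u r) \<bullet> b n - l n * (u r \<bullet> b n)) * h" by auto
      have qr: "q 0 \<bullet> b n = F (u r) \<bullet> b n - l n * (u r \<bullet> b n)"
        using eq h by (simp add: q_def inner_diff_left field_simps)
      have "\<bar>F (u r) \<bullet> b n\<bar> \<le> L * norm (u r)"
        using Cauchy_Schwarz_ineq2[of "F (u r)" "b n"] F_bound[of "u r"] by (simp add: norm_b)
      moreover have "\<bar>l n * (u r \<bullet> b n)\<bar> \<le> l N * norm (u r)"
        unfolding abs_mult using Cauchy_Schwarz_ineq2[of "u r" "b n"] l_mono[of n N] n l_pos[of n]
        by (intro mult_mono) (auto simp: norm_b)
      ultimately have "\<bar>q 0 \<bullet> b n\<bar> \<le> (L + l N) * norm (u r)" unfolding qr by (simp add: algebra_simps)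
      also have "\<dots> \<le> (L + l N) * (exp mu * (exp (mu * r) * norm (u r)))"
      proof (rule mult_left_mono)
        have "1 \<le> exp mu * exp (mu * r)"
        proof -
          have "0 \<le> mu * (1 + r)" using r h mu_pos by (intro mult_nonneg_nonneg) auto
          thus ?thesis by (simp add: algebra_simps flip: exp_add)
        qed
        thus "norm (u r) \<le> exp mu * (exp (mu * r) * norm (u r))"
          using mult_right_mono[of 1 "exp mu * exp (mu * r)" "norm (u r)"] by (simp add: mult.assoc)
      qed (use L_nonneg l_pos[of N] in simp)
      finally have "\<bar>q 0 \<bullet> b n\<bar>\<^sup>2 \<le> ((L + l N) * exp mu * (exp (mu * r) * norm (u r)))\<^sup>2"
        by (intro power_mono) (simp_all add: mult.assoc)
      also have "\<dots> = ((L + l N) * exp mu)\<^sup>2 * (exp (mu * r) * norm (u r))\<^sup>2"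
        by (rule power_mult_distrib)
      also have "\<dots> \<le> B"
        unfolding B_def using par_modal_bounds(2)[OF u, of r] r by (intro mult_left_mono) auto
      finally show ?thesis by simp
    qed
    have "(norm P)\<^sup>2 = (\<Sum>n<N. (q 0 \<bullet> b n)\<^sup>2)"
      by (simp add: P_def spectral_proj_def sum.atLeast1_atMost_eq b_def[symmetric] norm_partial)
    also have "\<dots> \<le> real N * B" using sum_bounded_above[of "{..<N}" "\<lambda>n. (q 0 \<bullet> b n)\<^sup>2" B] q0 by simp
    also have "\<dots> = c3 * (norm p)\<^sup>2" by (simp add: B_def c3_def)
    finally show ?thesis .
  qed
  have pv: "sqn Q \<le> c1 * (norm P)\<^sup>2" "half_L2 Gq" "sqn Gq \<le> L\<^sup>2 * c1 * (norm P)\<^sup>2"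
    "\<And>t k. t \<le> 0 \<Longrightarrow> (\<Sum>n<k. l n * (Q t \<bullet> b n)\<^sup>2) \<le> c2 * (norm P)\<^sup>2"
    by (rule par_vector_bounds[where Y = Q and G = Gq and Q = P, OF DQ Q Gc GQ QP]; assumption)+
  show "half_L2 (\<lambda>t. exp (mu * t) *\<^sub>R q t)" using Q by (simp add: Q_def[abs_def])
  show "half_L2 (\<lambda>t. exp (mu * t) *\<^sub>R g t)" using pv(2) by (simp add: Gq_def[abs_def])
  show "sqn (\<lambda>t. exp (mu * t) *\<^sub>R q t) \<le> c1 * c3 * (norm p)\<^sup>2"
    using order_trans[OF pv(1) mult_left_mono[OF P3 c_nonneg(1)]] by (simp add: Q_def[abs_def] mult.assoc)
  show "sqn (\<lambda>t. exp (mu * t) *\<^sub>R g t) \<le> L\<^sup>2 * c1 * c3 * (norm p)\<^sup>2"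
    using order_trans[OF pv(3) mult_left_mono[OF P3, of "L\<^sup>2 * c1"]] c_nonneg(1) by (simp add: Gq_def[abs_def] mult.assoc)
  show "(\<Sum>n<k. l n * (exp (mu * t) * (q t \<bullet> b n))\<^sup>2) \<le> c2 * c3 * (norm p)\<^sup>2" if "t \<le> 0" for t k
    using order_trans[OF pv(4)[OF that] mult_left_mono[OF P3 c_nonneg(2)]] by (simp add: Q_def mult.assoc)
qed

text \<open>
  The bounds for difference quotients pass to the limit \<open>h \<rightarrow> 0\<close> in finitely many modes.  This gives a
  bound for \<open>F(u) - Au\<close> in \<open>H\<^sup>1\<close>, locally uniformly in time; as \<open>\<lambda>\<^sub>n \<rightarrow> \<infinity>\<close>, the tails in \<open>H\<close> are
  uniformly small and \<open>F(u) - Au\<close> is continuous.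
\<close>

lemma par_modal_regularity:
  assumes u: "par_modal p u"
  obtains v where "continuous_on {..0} v" "\<And>t n. t \<le> 0 \<Longrightarrow> v t \<bullet> b n = F (u t) \<bullet> b n - l n * (u t \<bullet> b n)"
    "\<And>t. t \<le> 0 \<Longrightarrow> (exp (mu * t) * norm (v t))\<^sup>2 \<le> c2 * c3 / l 0 * (norm p)\<^sup>2"
proof -
  define c where "c n t = F (u t) \<bullet> b n - l n * (u t \<bullet> b n)" for n t
  define B where "B = c2 * c3 * (norm p)\<^sup>2"
  have uc: "continuous_on {..0} u" using u by (simp add: par_modal_def)
  have cb: "(\<Sum>n<k. l n * (exp (mu * t) * c n t)\<^sup>2) \<le> B" if t: "t \<le> 0" for t k
  proof (rule LIMSEQ_le_const2)
    define h where "h j = inverse (real (Suc j))" for j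
    have h: "0 < h j" "h j \<le> 1" for j by (auto simp: h_def field_simps)
    define q where "q j n = (u t \<bullet> b n - u (t - h j) \<bullet> b n) / h j" for j n
    have "(\<lambda>j. q j n) \<longlonglongrightarrow> c n t" for n
      unfolding q_def h_def c_def by (rule left_quotient_limit[OF _ t]) (use u t in \<open>simp add: par_modal_def\<close>)
    thus "(\<lambda>j. \<Sum>n<k. l n * (exp (mu * t) * q j n)\<^sup>2) \<longlonglongrightarrow> (\<Sum>n<k. l n * (exp (mu * t) * c n t)\<^sup>2)"
      by (intro tendsto_intros)
    have "(\<Sum>n<k. l n * (exp (mu * t) * q j n)\<^sup>2) \<le> B" for j
      using difference_quotient_bounds(5)[OF u h t, of j k] by (simp add: q_def B_def inner_diff_left)
    thus "\<exists>j0. \<forall>j\<ge>j0. (\<Sum>n<k. l n * (exp (mu * t) * q j n)\<^sup>2) \<le> B" by blast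
  qed
  have B0: "0 \<le> B" using cb[of 0 0] by simp
  obtain V where V: "continuous_on {..0} V" "\<And>t n. t \<in> {..0} \<Longrightarrow> V t \<bullet> b n = exp (mu * t) * c n t"
  proof (rule continuous_from_coefficients[of "{..0}" "\<lambda>n t. exp (mu * t) * c n t" "\<lambda>m. B / l m"])
    show "continuous_on {..0} (\<lambda>t. exp (mu * t) * c n t)" for n
      unfolding c_def by (intro continuous_intros continuous_on_compose2[OF F_continuous[of UNIV]] uc) auto
    show "(\<lambda>m. B / l m) \<longlonglongrightarrow> 0" using l_at_top by (rule tendsto_divide_0[OF tendsto_const filterlim_at_top_imp_at_infinity])
    show "(\<Sum>n\<in>{m..<k}. (exp (mu * t) * c n t)\<^sup>2) \<le> B / l m" if "t \<in> {..0}" for t m k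
    proof -
      have "l m * (\<Sum>n\<in>{m..<k}. (exp (mu * t) * c n t)\<^sup>2) \<le> (\<Sum>n\<in>{m..<k}. l n * (exp (mu * t) * c n t)\<^sup>2)"
        unfolding sum_distrib_left by (intro sum_mono mult_right_mono l_mono) auto
      also have "\<dots> \<le> (\<Sum>n<k. l n * (exp (mu * t) * c n t)\<^sup>2)"
        by (rule sum_mono2) (use l_pos in \<open>auto simp: less_imp_le\<close>)
      also have "\<dots> \<le> B" using cb that by simp
      finally show ?thesis using l_pos[of m] by (simp add: field_simps)
    qed
  qed (rule that)
  define v where "v t = exp (- (mu * t)) *\<^sub>R V t" for t
  have vn: "v t \<bullet> b n = c n t" if "t \<le> 0" for t n
    using V(2)[of t n] that by (simp add: v_def exp_minus)
  show ?thesis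
  proof (rule that)
    show "continuous_on {..0} v" unfolding v_def by (intro continuous_intros V)
    show "v t \<bullet> b n = F (u t) \<bullet> b n - l n * (u t \<bullet> b n)" if "t \<le> 0" for t n using vn[OF that] by (simp add: c_def)
    show "(exp (mu * t) * norm (v t))\<^sup>2 \<le> c2 * c3 / l 0 * (norm p)\<^sup>2" if t: "t \<le> 0" for t
    proof -
      have "(norm (exp (mu * t) *\<^sub>R v t))\<^sup>2 \<le> B / l 0"
        by (rule norm_sq_le_energy) (use cb[OF t] vn[OF t] in simp)
      thus ?thesis by (simp add: B_def)
    qed
  qed
qed

lemma theta_zero_eq: "theta_zero lam N = mu"
  unfolding theta_zero_def lam_N mu_def by simp

lemma solves_parabolic_iff:
  assumes p: "p \<in> range (spectral_proj e N)"
  shows "solves_parabolic D A lam e F N p u \<longleftrightarrow> u \<in> extensional {..0} \<and> par_modal p u"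
proof
  assume s: "solves_parabolic D A lam e F N p u"
  hence uD: "\<And>t. t \<le> 0 \<Longrightarrow> u t \<in> D"
    and Du: "\<And>t. t \<le> 0 \<Longrightarrow> (u has_vector_derivative F (u t) - A (u t)) (at t within {..0})"
    and w: "in_weighted_L2 mu u" and P: "spectral_proj e N (u 0) = p"
    by (auto simp: solves_parabolic_def theta_zero_eq)
  have uc: "continuous_on {..0} u" by (rule continuous_on_half_of_vderiv[OF Du])
  have "par_modal p u"
    unfolding par_modal_def
  proof (intro conjI allI impI uc)
    show "half_L2 (\<lambda>t. exp (mu * t) *\<^sub>R u t)" using w in_weighted_L2_iff[OF uc] by simp
    show "((\<lambda>r. u r \<bullet> b n) has_real_derivative F (u t) \<bullet> b n - l n * (u t \<bullet> b n)) (at t within {..0})"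
      if t: "t \<le> 0" for n t
      using bounded_linear.has_vector_derivative[OF bounded_linear_inner_left Du[OF t], of "b n"]
      by (simp add: has_real_derivative_iff_has_vector_derivative inner_diff_left A_coefficient uD[OF t])
    show "u 0 \<bullet> b n = p \<bullet> b n" if "n < N" for n using P that spectral_proj_eq_iff[OF p] by blast
  qed
  thus "u \<in> extensional {..0} \<and> par_modal p u" using s by (simp add: solves_parabolic_def)
next
  assume u: "u \<in> extensional {..0} \<and> par_modal p u"
  obtain v where vc: "continuous_on {..0} v"
    and v: "\<And>t n. t \<le> 0 \<Longrightarrow> v t \<bullet> b n = F (u t) \<bullet> b n - l n * (u t \<bullet> b n)"
    using par_modal_regularity[of p u] u by metis
  have uc: "continuous_on {..0} u" using u by (simp add: par_modal_def)
  have Au: "u t \<in> D \<and> A (u t) = F (u t) - v t" if "t \<le> 0" for t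
    using domainI[of "F (u t) - v t" "u t"] v[OF that] by (simp add: inner_diff_left)
  have Du: "(u has_vector_derivative v t) (at t within {..0})" if "t \<le> 0" for t
    by (rule vector_derivative_from_modes[OF vc _ that]) (use u v in \<open>simp add: par_modal_def\<close>)
  have "in_weighted_L2 mu u" using in_weighted_L2_iff[OF uc] u by (simp add: par_modal_def)
  moreover have "spectral_proj e N (u 0) = p" using u spectral_proj_eq_iff[OF p] by (simp add: par_modal_def)
  ultimately show "solves_parabolic D A lam e F N p u"
    unfolding solves_parabolic_def theta_zero_eq using u Au Du by auto
qed

lemma M_zero_modal:
  assumes p: "p \<in> range (spectral_proj e N)"
  obtains u where "par_modal p u" "M_zero D A lam e F N p = (u 0, F (u 0) - A (u 0))" "u 0 \<in> D"
proof -
  define u where "u = U_zero D A lam e F N p"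
  obtain u' where u': "par_modal p u'" using par_modal_exists by blast
  have "par_modal p (restrict u' {..0})"
  proof -
    have "half_L2 (\<lambda>t. exp (mu * t) *\<^sub>R restrict u' {..0} t)"
      by (rule half_L2_cong[of "\<lambda>t. exp (mu * t) *\<^sub>R u' t"]) (use u' in \<open>auto simp: par_modal_def\<close>)
    moreover have "((\<lambda>r. restrict u' {..0} r \<bullet> b n) has_real_derivative
        F (restrict u' {..0} t) \<bullet> b n - l n * (restrict u' {..0} t \<bullet> b n)) (at t within {..0})" if t: "t \<le> 0" for n t
      by (rule half_derivative_cong[of "\<lambda>r. u' r \<bullet> b n"]) (use u' t in \<open>auto simp: par_modal_def\<close>)
    moreover have "continuous_on {..0} (restrict u' {..0})"
      by (rule continuous_on_eq[of "{..0}" u']) (use u' in \<open>auto simp: par_modal_def\<close>)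
    ultimately show ?thesis using u' by (simp add: par_modal_def)
  qed
  hence s: "solves_parabolic D A lam e F N p (restrict u' {..0})"
    unfolding solves_parabolic_iff[OF p] by simp
  have uniq: "x = restrict u' {..0}" if "solves_parabolic D A lam e F N p x" for x
  proof (rule extensionalityI[of _ "{..0}"])
    show "x \<in> extensional {..0}" using that by (simp add: solves_parabolic_def)
    show "x t = restrict u' {..0} t" if "t \<in> {..0}" for t
      using par_modal_unique[of p x u' t] that \<open>solves_parabolic D A lam e F N p x\<close> u'
      by (simp add: solves_parabolic_iff[OF p])
  qed simp
  have "solves_parabolic D A lam e F N p u"
    unfolding u_def U_zero_def by (rule theI[where P = "solves_parabolic D A lam e F N p", OF s uniq])
  thus ?thesis
    using that[of u] solves_parabolic_iff[OF p] by (simp add: M_zero_def u_def Let_def solves_parabolic_def)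
qed

end

section \<open>Comparison of the two solutions\<close>

context inertial_setting
begin

text \<open>
  The constants of the comparison; none of them involves \<open>eps\<close>, \<open>h\<close> or \<open>p\<close>.  In the locale \<open>comparison\<close>, \<open>kq\<close>
  bounds \<open>V\<close> and the difference quotient \<open>q\<close>, \<open>k2\<close> the averaging errors, \<open>c4\<close> and \<open>c5\<close> the derivative of \<open>q\<close>, \<open>kr\<close>
  the consistency error, \<open>kp\<close> the defect in the boundary condition, \<open>kw\<close> and \<open>kz\<close> the difference \<open>W\<close>, \<open>kg\<close> the
  right-hand side \<open>G\<close>, \<open>ke\<close> the energy and \<open>kgam\<close> the residual; \<open>et\<close> is a weight in Young's inequality.
\<close>

definition kq where "kq = c2 * c3 / l 0"
definition k2 where "k2 = kq * (exp mu)\<^sup>2"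
definition c4 where "c4 = 6 * (L\<^sup>2 * c1 * c3) + 8 * mu\<^sup>2 * (c1 * c3)"
definition kr where "kr = 2 * L\<^sup>2 * k2 + 2 * c4"
definition kp where "kp = 3 * (k2 + kq / a0\<^sup>2 + (2 * l N / a0)\<^sup>2 * (2 * (c2 / l 0) + 2 * k2))"
definition et where "et = (dl\<^sup>2 - L\<^sup>2) / (6 * dl\<^sup>2)"
definition kw where "kw = 2 / (dl\<^sup>2 - L\<^sup>2) *
  ((1 + et) * ((1 + 1 / et) * kr + 2 * mu * kp) + dl\<^sup>2 * ((1 + 1 / et) * k2))"
definition kg where "kg = 2 * L\<^sup>2 * kw + 2 * kr"
definition ke where "ke = KH * (kg + kp)"
definition kz where "kz = 2 * ke / l 0 + 2 * k2"
definition c5 where "c5 = 2 / l 0 * (L\<^sup>2 * kq) + 2 * (c2 * c3)"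
definition kgam where "kgam = 2 / l 0 * (2 * L\<^sup>2 * kz + 4 * L\<^sup>2 * k2) + 8 * c5 + 2 * ke"
definition kfin where "kfin = 3 * ke + 2 * mu * (ke / l 0) + kgam / a0"

lemma k_nonneg: "0 \<le> kq" "0 \<le> k2" "0 \<le> c4" "0 \<le> kr" "0 \<le> kp"
proof -
  show 1: "0 \<le> kq" unfolding kq_def using c_nonneg l_pos[of 0] by simp
  show 2: "0 \<le> k2" unfolding k2_def using 1 by simp
  show 3: "0 \<le> c4" unfolding c4_def using c_nonneg by simp
  show "0 \<le> kr" unfolding kr_def using 2 3 by simp
  show "0 \<le> kp" unfolding kp_def using 1 2 c_nonneg l_pos[of 0]
    by (intro mult_nonneg_nonneg add_nonneg_nonneg) auto
qed

lemma et: "0 < et" "(1 + et)\<^sup>2 * L\<^sup>2 \<le> (dl\<^sup>2 + L\<^sup>2) / 2"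
proof -
  have dp: "0 < dl\<^sup>2" using dl by simp
  show p: "0 < et" using gap_sq dp by (simp add: et_def)
  have e: "6 * (et * dl\<^sup>2) = dl\<^sup>2 - L\<^sup>2" using dl by (simp add: et_def)
  have "6 * (et * dl\<^sup>2) \<le> 1 * dl\<^sup>2" unfolding e by simp
  hence "6 * et \<le> 1" using dp by (metis mult.assoc mult_le_cancel_right_pos)
  hence "et * et \<le> 1 * et" using p by (intro mult_right_mono) auto
  hence "(1 + et)\<^sup>2 \<le> 1 + 3 * et" by (simp add: power2_eq_square algebra_simps)
  hence "(1 + et)\<^sup>2 * L\<^sup>2 \<le> (1 + 3 * et) * L\<^sup>2" by (intro mult_right_mono) auto
  also have "\<dots> \<le> L\<^sup>2 + 3 * (et * dl\<^sup>2)"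
  proof -
    have "et * L\<^sup>2 \<le> et * dl\<^sup>2" using gap_sq p by (intro mult_left_mono) auto
    thus ?thesis by (simp add: algebra_simps)
  qed
  also have "\<dots> = (dl\<^sup>2 + L\<^sup>2) / 2" using e by (simp add: field_simps)
  finally show "(1 + et)\<^sup>2 * L\<^sup>2 \<le> (dl\<^sup>2 + L\<^sup>2) / 2" .
qed

lemma k_nonneg': "0 \<le> kw" "0 \<le> kg" "0 \<le> ke" "0 \<le> kz" "0 \<le> c5" "0 \<le> kgam" "0 \<le> kfin"
proof -
  show 1: "0 \<le> kw" unfolding kw_def
    using gap_sq et(1) k_nonneg mu_pos by (intro mult_nonneg_nonneg add_nonneg_nonneg) auto
  show 2: "0 \<le> kg" unfolding kg_def using 1 k_nonneg by simp
  show 3: "0 \<le> ke" unfolding ke_def using 2 k_nonneg KH_bounds(3) by simp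
  show 4: "0 \<le> kz" unfolding kz_def using 3 k_nonneg l_pos[of 0] by simp
  show 5: "0 \<le> c5" unfolding c5_def using k_nonneg c_nonneg l_pos[of 0] by simp
  show 6: "0 \<le> kgam" unfolding kgam_def using 3 4 5 k_nonneg l_pos[of 0]
    by (intro mult_nonneg_nonneg add_nonneg_nonneg) auto
  show "0 \<le> kfin" unfolding kfin_def using 3 6 l_pos[of 0] mu_pos a0_pos by simp
qed

end

text \<open>
  Here \<open>u\<close> is the solution of the wave equation with derivative \<open>v\<close>, \<open>U\<close> is the solution of the parabolic
  equation with derivative \<open>V\<close>, and \<open>h\<close> is the length of the averaging interval.
\<close>

locale comparison = hyperbolic_setting +
  fixes p :: 'a and u v U V :: "real \<Rightarrow> 'a" and h :: real
  assumes u: "hyp_modal p u v" and U: "par_modal p U"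
    and Vc: "continuous_on {..0} V"
    and Vn: "\<And>t n. t \<le> 0 \<Longrightarrow> V t \<bullet> b n = F (U t) \<bullet> b n - l n * (U t \<bullet> b n)"
    and Vb: "\<And>t. t \<le> 0 \<Longrightarrow> (exp (mu * t) * norm (V t))\<^sup>2 \<le> kq * (norm p)\<^sup>2"
    and p_low: "\<And>n. N \<le> n \<Longrightarrow> p \<bullet> b n = 0"
    and h: "0 < h" "h \<le> 1"
begin

text \<open>
  The squared error.  The wave equation uses the larger weight exponent \<open>th > mu\<close>; integrating
  \<open>e\<^bsup>2(th - mu)t\<^esup>\<close> costs the factor \<open>1/(th - mu)\<close>, which depends on \<open>eps\<close> but is harmless because it comes with
  \<open>h\<^sup>2\<close>, and \<open>h\<close> tends to \<open>0\<close> for fixed \<open>eps\<close>.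
\<close>

definition E where "E = (norm p)\<^sup>2 * (eps\<^sup>2 + h\<^sup>2 * (1 + 1 / (th - mu)))"

lemma E: "0 \<le> E" "eps\<^sup>2 * (norm p)\<^sup>2 \<le> E" "h\<^sup>2 * (norm p)\<^sup>2 \<le> E" "h\<^sup>2 * (norm p)\<^sup>2 / (th - mu) \<le> E"
proof -
  have "0 < th - mu" using th(3) by simp
  hence nn: "0 \<le> eps\<^sup>2 * (norm p)\<^sup>2" "0 \<le> h\<^sup>2 * (norm p)\<^sup>2" "0 \<le> h\<^sup>2 * (norm p)\<^sup>2 / (th - mu)" by auto
  have "E = eps\<^sup>2 * (norm p)\<^sup>2 + h\<^sup>2 * (norm p)\<^sup>2 + h\<^sup>2 * (norm p)\<^sup>2 / (th - mu)"
    by (simp add: E_def algebra_simps)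
  thus "0 \<le> E" "eps\<^sup>2 * (norm p)\<^sup>2 \<le> E" "h\<^sup>2 * (norm p)\<^sup>2 \<le> E" "h\<^sup>2 * (norm p)\<^sup>2 / (th - mu) \<le> E"
    using nn by linarith+
qed

text \<open>
  The average \<open>z\<close> of \<open>U\<close> has the derivative \<open>q\<close>, and \<open>q' = qp\<close>; \<open>f\<close> is the average of \<open>F(U)\<close>.  Averages are formed
  mode by mode.
\<close>

definition q where "q t = (1 / h) *\<^sub>R (U t - U (t - h))"
definition g where "g t = (1 / h) *\<^sub>R (F (U t) - F (U (t - h)))"
definition C where "C n t = - integral {t..0} (\<lambda>r. U r \<bullet> b n)"
definition B where "B n t = - integral {t..0} (\<lambda>r. F (U r) \<bullet> b n)"
definition z where "z n t = (C n t - C n (t - h)) / h"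
definition f where "f n t = (B n t - B n (t - h)) / h"
definition qp where "qp n t = g t \<bullet> b n - l n * (q t \<bullet> b n)"

lemma Uc: "continuous_on {..0} U" and uc: "continuous_on {..0} u"
  and U2: "half_L2 (\<lambda>t. exp (mu * t) *\<^sub>R U t)" and u2: "half_L2 (\<lambda>t. exp (th * t) *\<^sub>R u t)"
  using u U by (auto simp: hyp_modal_def par_modal_def)

lemma FUc: "continuous_on {..0} (\<lambda>t. F (U t))" and Fuc: "continuous_on {..0} (\<lambda>t. F (u t))"
  by (intro continuous_on_compose2[OF F_continuous[of UNIV]] Uc uc; simp)+

lemma DC: "t \<le> 0 \<Longrightarrow> (C n has_real_derivative U t \<bullet> b n) (at t within {..0})"
proof -
  assume t: "t \<le> 0"
  have "continuous_on {..0} (\<lambda>r. U r \<bullet> b n)" by (intro continuous_intros Uc)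
  from antiderivative_half[OF this] obtain c where "c = C n"
    "\<And>t. t \<le> 0 \<Longrightarrow> (c has_vector_derivative U t \<bullet> b n) (at t within {..0})" unfolding C_def[abs_def] by metis
  thus ?thesis using t by (simp add: has_real_derivative_iff_has_vector_derivative)
qed

lemma DB: "t \<le> 0 \<Longrightarrow> (B n has_real_derivative F (U t) \<bullet> b n) (at t within {..0})"
proof -
  assume t: "t \<le> 0"
  have "continuous_on {..0} (\<lambda>r. F (U r) \<bullet> b n)" by (intro continuous_intros FUc)
  from antiderivative_half[OF this] obtain c where "c = B n"
    "\<And>t. t \<le> 0 \<Longrightarrow> (c has_vector_derivative F (U t) \<bullet> b n) (at t within {..0})" unfolding B_def[abs_def] by metis
  thus ?thesis using t by (simp add: has_real_derivative_iff_has_vector_derivative)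
qed

lemma difference_derivative:
  assumes D: "\<And>t. t \<le> 0 \<Longrightarrow> (y has_real_derivative x t) (at t within {..0})" and t: "t \<le> 0"
  shows "((\<lambda>t. (y t - y (t - h)) / h) has_real_derivative (x t - x (t - h)) / h) (at t within {..0})"
  using has_real_derivative_shift[where a = "- h", OF D _ t] h
  by (intro DERIV_cdivide DERIV_diff D t) simp

lemma Dz: "t \<le> 0 \<Longrightarrow> (z n has_real_derivative q t \<bullet> b n) (at t within {..0})"
  using difference_derivative[OF DC[of _ n], of t] by (simp add: z_def[abs_def] q_def inner_diff_left)

lemma Df: "t \<le> 0 \<Longrightarrow> (f n has_real_derivative g t \<bullet> b n) (at t within {..0})"
  using difference_derivative[OF DB[of _ n], of t] by (simp add: f_def[abs_def] g_def inner_diff_left)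

lemmas dq = difference_quotient_bounds[OF U h, folded q_def g_def]

lemma Dq: "t \<le> 0 \<Longrightarrow> ((\<lambda>r. q r \<bullet> b n) has_real_derivative qp n t) (at t within {..0})"
  unfolding qp_def by (rule dq(7))

text \<open>
  Averaging commutes with the linear part of the equation: \<open>U + \<lambda>\<^sub>n C - B\<close> does not depend on time.
\<close>

lemma q_eq: assumes t: "t \<le> 0" shows "q t \<bullet> b n + l n * z n t = f n t"
proof -
  define \<phi> where "\<phi> t = U t \<bullet> b n + l n * C n t - B n t" for t
  have D: "(\<phi> has_real_derivative 0) (at r within {..0})" if "r \<le> 0" for r
  proof -
    have "((\<lambda>t. U t \<bullet> b n) has_real_derivative F (U r) \<bullet> b n - l n * (U r \<bullet> b n)) (at r within {..0})"
      using U that by (simp add: par_modal_def)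
    from DERIV_diff[OF DERIV_add[OF this DERIV_cmult[OF DC[OF that, of n], of "l n"]] DB[OF that, of n]]
    show ?thesis by (simp add: \<phi>_def[abs_def])
  qed
  have "\<phi> (t - h) \<le> \<phi> t" by (rule half_mono[where T = 0, OF D]) (use t h in auto)
  moreover have "- \<phi> (t - h) \<le> - \<phi> t"
    by (rule half_mono[where T = 0 and \<phi> = "\<lambda>_. 0"]) (use t h DERIV_minus[OF D] in auto)
  ultimately have "\<phi> t = \<phi> (t - h)" by simp
  moreover have "q t \<bullet> b n + l n * z n t - f n t = (\<phi> t - \<phi> (t - h)) / h"
    by (simp add: \<phi>_def q_def z_def f_def inner_diff_left diff_divide_distrib add_divide_distrib algebra_simps)
  ultimately show ?thesis by simp
qed

text \<open>
  \<open>U\<close> is Lipschitz in time with the constant from the bound for \<open>V\<close>, up to the exponential weight.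
\<close>

lemma averaging_bounds:
  assumes t: "t \<le> 0"
  shows "(\<Sum>n<k. (exp (mu * t) * (z n t - U t \<bullet> b n))\<^sup>2) \<le> k2 * (h\<^sup>2 * (norm p)\<^sup>2)"
    "(\<Sum>n<k. (exp (mu * t) * (F (U t) \<bullet> b n - f n t))\<^sup>2) \<le> L\<^sup>2 * k2 * (h\<^sup>2 * (norm p)\<^sup>2)"
proof -
  define \<kappa> where "\<kappa> = sqrt kq * norm p * exp (- (mu * (t - h)))"
  have \<kappa>0: "0 \<le> \<kappa>" unfolding \<kappa>_def using k_nonneg by simp
  have V\<kappa>: "norm (V r) \<le> \<kappa>" if "t - h \<le> r" "r \<le> t" for r
  proof -
    have r0: "r \<le> 0" using that t by simp
    have "(exp (mu * r) * norm (V r))\<^sup>2 \<le> (sqrt kq * norm p)\<^sup>2"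
      using Vb[OF r0] k_nonneg(1) by (simp add: power_mult_distrib)
    hence "exp (mu * r) * norm (V r) \<le> sqrt kq * norm p"
      by (rule power2_le_imp_le) (use k_nonneg(1) in simp)
    hence "exp (- (mu * r)) * (exp (mu * r) * norm (V r)) \<le> exp (- (mu * r)) * (sqrt kq * norm p)"
      by (rule mult_left_mono) simp
    also have "exp (- (mu * r)) * (exp (mu * r) * norm (V r)) = norm (V r)"
      by (simp add: mult.assoc[symmetric] flip: exp_add)
    also have "exp (- (mu * r)) * (sqrt kq * norm p) \<le> exp (- (mu * (t - h))) * (sqrt kq * norm p)"
      using that mu_pos k_nonneg(1) by (intro mult_right_mono) auto
    finally show ?thesis by (simp add: \<kappa>_def mult_ac)
  qed
  have Ud: "norm (U r - U t) \<le> \<kappa> * h" if r: "t - h \<le> r" "r \<le> t" for r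
  proof -
    have "norm (U t - U r - (t - r) *\<^sub>R 0) \<le> \<kappa> * (t - r)"
    proof (rule norm_mean_value[where c = V])
      show "((\<lambda>r. U r \<bullet> b n) has_real_derivative V r' \<bullet> b n) (at r' within {..0})" if "r \<le> r'" "r' \<le> t" for n r'
        using U that t by (simp add: par_modal_def Vn)
    qed (use r t V\<kappa> in auto)
    also have "\<dots> \<le> \<kappa> * h" using r \<kappa>0 by (intro mult_left_mono) auto
    finally show ?thesis by (simp add: norm_minus_commute)
  qed
  have FUd: "norm (F (U r) - F (U t)) \<le> L * (\<kappa> * h)" if r: "t - h \<le> r" "r \<le> t" for r
    using order_trans[OF F_lip mult_left_mono[OF Ud[OF r] L_nonneg]] .
  have \<kappa>2: "(exp (mu * t) * (\<kappa> * h))\<^sup>2 \<le> k2 * (h\<^sup>2 * (norm p)\<^sup>2)"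
  proof -
    have "exp (mu * t) * \<kappa> = sqrt kq * norm p * exp (mu * h)"
      by (simp add: \<kappa>_def right_diff_distrib flip: exp_add) 
    also have "\<dots> \<le> sqrt kq * norm p * exp mu"
      using h mu_pos k_nonneg(1) by (intro mult_left_mono) auto
    finally have "(exp (mu * t) * \<kappa>)\<^sup>2 \<le> (sqrt kq * norm p * exp mu)\<^sup>2"
      using \<kappa>0 by (intro power_mono) auto
    hence "(exp (mu * t) * \<kappa>)\<^sup>2 * h\<^sup>2 \<le> (sqrt kq * norm p * exp mu)\<^sup>2 * h\<^sup>2" by (intro mult_right_mono) auto
    thus ?thesis using k_nonneg(1) by (simp add: power_mult_distrib k2_def mult_ac)
  qed
  have zC: "z n t - U t \<bullet> b n = (C n t - C n (t - h) - (t - (t - h)) * (U t \<bullet> b n)) / h" for n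
    using h by (simp add: z_def field_simps)
  have fB: "F (U t) \<bullet> b n - f n t = - ((B n t - B n (t - h) - (t - (t - h)) * (F (U t) \<bullet> b n)) / h)" for n
    using h by (simp add: f_def field_simps)
  have "(\<Sum>n<k. (C n t - C n (t - h) - (t - (t - h)) * (U t \<bullet> b n))\<^sup>2) \<le> (\<kappa> * h * (t - (t - h)))\<^sup>2"
    by (rule modes_mean_value[where c = U]) (use DC Ud t h in auto)
  hence "(\<Sum>n<k. (z n t - U t \<bullet> b n)\<^sup>2) \<le> (\<kappa> * h)\<^sup>2"
    unfolding zC power_divide sum_divide_distrib[symmetric] using h by (simp add: power_mult_distrib field_simps)
  hence "(exp (mu * t))\<^sup>2 * (\<Sum>n<k. (z n t - U t \<bullet> b n)\<^sup>2) \<le> (exp (mu * t))\<^sup>2 * (\<kappa> * h)\<^sup>2"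
    by (rule mult_left_mono) simp
  thus "(\<Sum>n<k. (exp (mu * t) * (z n t - U t \<bullet> b n))\<^sup>2) \<le> k2 * (h\<^sup>2 * (norm p)\<^sup>2)"
    using \<kappa>2 unfolding power_mult_distrib[of "exp (mu * t)"] sum_distrib_left[symmetric] by linarith
  have "(\<Sum>n<k. (B n t - B n (t - h) - (t - (t - h)) * (F (U t) \<bullet> b n))\<^sup>2) \<le> (L * (\<kappa> * h) * (t - (t - h)))\<^sup>2"
    by (rule modes_mean_value[where c = "\<lambda>r. F (U r)"]) (use DB FUd t h in auto)
  hence "(\<Sum>n<k. (F (U t) \<bullet> b n - f n t)\<^sup>2) \<le> (L * (\<kappa> * h))\<^sup>2"
    unfolding fB power2_minus power_divide sum_divide_distrib[symmetric] using h by (simp add: power_mult_distrib field_simps)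
  hence "(exp (mu * t))\<^sup>2 * (\<Sum>n<k. (F (U t) \<bullet> b n - f n t)\<^sup>2) \<le> (exp (mu * t))\<^sup>2 * (L * (\<kappa> * h))\<^sup>2"
    by (rule mult_left_mono) simp
  also have "\<dots> = L\<^sup>2 * (exp (mu * t) * (\<kappa> * h))\<^sup>2" by (simp add: power_mult_distrib)
  also have "\<dots> \<le> L\<^sup>2 * (k2 * (h\<^sup>2 * (norm p)\<^sup>2))" by (rule mult_left_mono[OF \<kappa>2]) simp
  finally show "(\<Sum>n<k. (exp (mu * t) * (F (U t) \<bullet> b n - f n t))\<^sup>2) \<le> L\<^sup>2 * k2 * (h\<^sup>2 * (norm p)\<^sup>2)"
    unfolding power_mult_distrib[of "exp (mu * t)"] sum_distrib_left[symmetric] by (simp add: mult.assoc)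
qed

lemma weight_mono: "t \<le> 0 \<Longrightarrow> (exp (th * t) * x)\<^sup>2 \<le> (exp (mu * t) * x)\<^sup>2"
proof -
  assume "t \<le> 0"
  hence "exp (th * t) \<le> exp (mu * t)" using th(3) by (simp add: mult_right_mono_neg)
  hence "(exp (th * t))\<^sup>2 \<le> (exp (mu * t))\<^sup>2" by (intro power_mono) auto
  thus ?thesis unfolding power_mult_distrib by (rule mult_right_mono) simp
qed

text \<open>
  A pointwise bound in the weight \<open>mu\<close> becomes an \<open>L\<^sup>2\<close> bound in the weight \<open>th\<close>.
\<close>

lemma weighted_tail:
  fixes y :: "nat \<Rightarrow> real \<Rightarrow> real"
  assumes c: "\<And>n. continuous_on {..0} (y n)"
    and le: "\<And>t. t \<le> 0 \<Longrightarrow> (\<Sum>n<k. (exp (mu * t) * y n t)\<^sup>2) \<le> K * (h\<^sup>2 * (norm p)\<^sup>2)"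
    and K: "0 \<le> K"
  shows "n < k \<Longrightarrow> half_L2 (\<lambda>t. exp (th * t) * y n t)"
    "(\<Sum>n<k. sqn (\<lambda>t. exp (th * t) * y n t)) \<le> K * E"
proof -
  define \<delta> where "\<delta> = 2 * (th - mu)"
  have \<delta>: "0 < \<delta>" using th(3) by (simp add: \<delta>_def)
  define X where "X = K * (h\<^sup>2 * (norm p)\<^sup>2)"
  have ie: "half_integrable (\<lambda>t. X * exp (\<delta> * t))"
    using half_integrable_exp(1)[OF \<delta>] by (rule set_integrable_mult_right)
  have pw: "(\<Sum>n<k. (exp (th * t) * y n t)\<^sup>2) \<le> X * exp (\<delta> * t)" if "t \<le> 0" for t
  proof -
    have e: "exp (th * t) = exp ((th - mu) * t) * exp (mu * t)" by (simp add: algebra_simps flip: exp_add)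
    have e2: "(exp ((th - mu) * t))\<^sup>2 = exp (\<delta> * t)" by (simp add: \<delta>_def mult.assoc flip: exp_double)
    have "(\<Sum>n<k. (exp (th * t) * y n t)\<^sup>2) = exp (\<delta> * t) * (\<Sum>n<k. (exp (mu * t) * y n t)\<^sup>2)"
      unfolding e sum_distrib_left by (simp add: power_mult_distrib e2 mult.assoc)
    also have "\<dots> \<le> exp (\<delta> * t) * X" unfolding X_def by (rule mult_left_mono[OF le[OF that]]) simp
    finally show ?thesis by (simp add: mult.commute)
  qed
  have L2: "half_L2 (\<lambda>t. exp (th * t) * y n t)" if "n < k" for n
  proof (rule half_L2_bound(1)[OF _ ie])
    show "continuous_on {..0} (\<lambda>t. exp (th * t) * y n t)" by (intro continuous_intros c)
    fix t :: real assume t: "t \<le> 0"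
    have "(exp (th * t) * y n t)\<^sup>2 \<le> (\<Sum>n<k. (exp (th * t) * y n t)\<^sup>2)"
      by (rule member_le_sum) (use that in auto)
    thus "(norm (exp (th * t) * y n t))\<^sup>2 \<le> X * exp (\<delta> * t)" using pw[OF t] by simp
  qed
  thus "n < k \<Longrightarrow> half_L2 (\<lambda>t. exp (th * t) * y n t)" .
  have i: "half_integrable (\<lambda>t. (norm (exp (th * t) * y n t))\<^sup>2)" if "n \<in> {..<k}" for n
    by (rule half_L2_int[OF L2]) (use that in simp)
  have "(\<Sum>n<k. sqn (\<lambda>t. exp (th * t) * y n t)) = half_integral (\<lambda>t. \<Sum>n<k. (norm (exp (th * t) * y n t))\<^sup>2)"
    by (rule half_integral_sum(2)[OF i, symmetric])
  also have "\<dots> \<le> half_integral (\<lambda>t. X * exp (\<delta> * t))"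
    by (rule half_integral_mono[OF half_integral_sum(1)[OF i] ie]) (use pw in simp_all)
  also have "\<dots> \<le> X * (1 / \<delta>)"
  proof -
    have "0 \<le> X" unfolding X_def using K by simp
    thus ?thesis using half_integrable_exp(2)[OF \<delta>] by (simp only: set_integral_mult_right mult_left_mono)
  qed
  also have "\<dots> \<le> X * (1 / (th - mu))"
    using th(3) K by (intro mult_left_mono divide_left_mono) (auto simp: \<delta>_def X_def)
  also have "\<dots> = K * (h\<^sup>2 * (norm p)\<^sup>2 / (th - mu))" by (simp add: X_def)
  also have "\<dots> \<le> K * E" by (rule mult_left_mono[OF E(4) K])
  finally show "(\<Sum>n<k. sqn (\<lambda>t. exp (th * t) * y n t)) \<le> K * E" .
qed

text \<open>
  The difference \<open>w = u - z\<close> solves the wave equation with right-hand side \<open>H\<close>, and \<open>y\<close>, \<open>x\<close>, \<open>G\<close> are the weighted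
  versions.  The right-hand side \<open>G\<close> is the sum of \<open>Ph\<close>, which comes from \<open>F(u) - F(U)\<close>, and of the
  consistency error \<open>r\<close>; \<open>defect\<close> is the error in the boundary condition.
\<close>

definition w where "w n t = u t \<bullet> b n - z n t"
definition om where "om n t = v t \<bullet> b n - q t \<bullet> b n"
definition H where "H n t = F (u t) \<bullet> b n - f n t - eps * qp n t"
definition y where "y n t = exp (th * t) * w n t"
definition x where "x n t = exp (th * t) * (om n t + th * w n t)"
definition G where "G n t = exp (th * t) * H n t"
definition W where "W t = exp (th * t) *\<^sub>R (u t - U t)"
definition Ph where "Ph t = exp (th * t) *\<^sub>R (F (u t) - F (U t))"
definition ze where "ze n t = exp (th * t) * (z n t - U t \<bullet> b n)"
definition r1 where "r1 n t = exp (th * t) * (F (U t) \<bullet> b n - f n t)"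
definition r2 where "r2 n t = exp (th * t) * qp n t"
definition r where "r n t = r1 n t - eps * r2 n t"
definition defect where "defect n = (if n < N then p \<bullet> b n - (eps / s n * (q 0 \<bullet> b n) + (1 + s n) / (2 * s n) * z n 0) else 0)"

lemma mode: "mode_eq eps al (d n) (G n) (y n) (x n)"
proof -
  have D1: "(w n has_real_derivative om n t) (at t within {..0})" if "t \<le> 0" for t
    unfolding w_def[abs_def] om_def using u that by (intro DERIV_diff Dz that) (simp add: hyp_modal_def)
  have D2: "(om n has_real_derivative (H n t - om n t - l n * w n t) / eps) (at t within {..0})" if t: "t \<le> 0" for t
  proof -
    have "(om n has_real_derivative (F (u t) \<bullet> b n - v t \<bullet> b n - l n * (u t \<bullet> b n)) / eps - qp n t) (at t within {..0})"
      unfolding om_def[abs_def] using u t by (intro DERIV_diff Dq t) (simp add: hyp_modal_def)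
    also have "(F (u t) \<bullet> b n - v t \<bullet> b n - l n * (u t \<bullet> b n)) / eps - qp n t
       = (F (u t) \<bullet> b n - v t \<bullet> b n - l n * (u t \<bullet> b n) - eps * qp n t) / eps"
      using eps by (simp add: diff_divide_distrib)
    also have "F (u t) \<bullet> b n - v t \<bullet> b n - l n * (u t \<bullet> b n) - eps * qp n t = H n t - om n t - l n * w n t"
      using q_eq[OF t, of n] by (simp add: H_def om_def w_def algebra_simps)
    finally show ?thesis .
  qed
  show ?thesis using weighted_mode[OF D1 D2] by (simp add: G_def[abs_def] y_def[abs_def] x_def[abs_def] d_def)
qed

lemma z_cont: "continuous_on {..0} (z n)" and f_cont: "continuous_on {..0} (f n)"
  by (rule continuous_on_half_of_deriv[OF Dz] continuous_on_half_of_deriv[OF Df]; assumption)+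

lemma W2: "half_L2 W"
proof -
  have "half_L2 (\<lambda>t. exp (th * t) *\<^sub>R U t)"
  proof (rule half_L2_bound(1)[OF _ half_L2_int[OF U2]])
    show "continuous_on {..0} (\<lambda>t. exp (th * t) *\<^sub>R U t)" by (intro continuous_intros Uc)
    show "(norm (exp (th * t) *\<^sub>R U t))\<^sup>2 \<le> (norm (exp (mu * t) *\<^sub>R U t))\<^sup>2" if "t \<le> 0" for t
      using weight_mono[OF that, of "norm (U t)"] by simp
  qed
  from half_L2_diff[OF u2 this] show ?thesis by (simp add: W_def[abs_def] scaleR_diff_right)
qed

lemma Ph_le: "norm (Ph t) \<le> L * norm (W t)"
  using mult_left_mono[OF F_lip[of "u t" "U t"], of "exp (th * t)"] by (simp add: Ph_def W_def mult_ac)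

lemma Ph_sq: "(norm (Ph t))\<^sup>2 \<le> L\<^sup>2 * (norm (W t))\<^sup>2"
  using power_mono[OF Ph_le, of t 2] by (simp add: power_mult_distrib)

lemma Ph2: "half_L2 Ph" and Ph_sqn: "sqn Ph \<le> L\<^sup>2 * sqn W"
proof -
  have c: "continuous_on {..0} Ph" unfolding Ph_def by (intro continuous_intros Fuc FUc)
  have i: "half_integrable (\<lambda>t. L\<^sup>2 * (norm (W t))\<^sup>2)" using half_L2_int[OF W2] by simp
  show "half_L2 Ph" by (rule half_L2_bound(1)[OF c i Ph_sq])
  show "sqn Ph \<le> L\<^sup>2 * sqn W" using half_L2_bound(2)[OF c i Ph_sq] by simp
qed

lemma ze2: "half_L2 (ze n)" and ze_sum: "(\<Sum>n<k. sqn (ze n)) \<le> k2 * E"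
  and ze_at: "t \<le> 0 \<Longrightarrow> (\<Sum>n<k. (ze n t)\<^sup>2) \<le> k2 * E"
proof -
  have c: "continuous_on {..0} (\<lambda>t. z n t - U t \<bullet> b n)" for n by (intro continuous_intros Uc z_cont)
  show "half_L2 (ze n)" unfolding ze_def[abs_def]
    by (rule weighted_tail(1)[where k = "Suc n" and y = "\<lambda>n t. z n t - U t \<bullet> b n", OF c averaging_bounds(1) k_nonneg(2)]) auto
  show "(\<Sum>n<k. sqn (ze n)) \<le> k2 * E" unfolding ze_def
    by (rule weighted_tail(2)[where y = "\<lambda>n t. z n t - U t \<bullet> b n", OF c averaging_bounds(1) k_nonneg(2)]) auto
  show "(\<Sum>n<k. (ze n t)\<^sup>2) \<le> k2 * E" if t: "t \<le> 0"
  proof -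
    have "(\<Sum>n<k. (ze n t)\<^sup>2) \<le> (\<Sum>n<k. (exp (mu * t) * (z n t - U t \<bullet> b n))\<^sup>2)"
      unfolding ze_def by (intro sum_mono weight_mono t)
    also have "\<dots> \<le> k2 * (h\<^sup>2 * (norm p)\<^sup>2)" by (rule averaging_bounds(1)[OF t])
    also have "\<dots> \<le> k2 * E" by (rule mult_left_mono[OF E(3) k_nonneg(2)])
    finally show ?thesis .
  qed
qed

lemma r1_L2: "half_L2 (r1 n)" and r1_sum: "(\<Sum>n<k. sqn (r1 n)) \<le> L\<^sup>2 * k2 * E"
  and r1_at: "t \<le> 0 \<Longrightarrow> (\<Sum>n<k. (r1 n t)\<^sup>2) \<le> L\<^sup>2 * k2 * E"
proof -
  have c: "continuous_on {..0} (\<lambda>t. F (U t) \<bullet> b n - f n t)" for n by (intro continuous_intros FUc f_cont)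
  have K: "0 \<le> L\<^sup>2 * k2" using k_nonneg(2) by simp
  show "half_L2 (r1 n)" unfolding r1_def[abs_def]
    by (rule weighted_tail(1)[where k = "Suc n" and y = "\<lambda>n t. F (U t) \<bullet> b n - f n t", OF c averaging_bounds(2) K]) auto
  show "(\<Sum>n<k. sqn (r1 n)) \<le> L\<^sup>2 * k2 * E" unfolding r1_def
    by (rule weighted_tail(2)[where y = "\<lambda>n t. F (U t) \<bullet> b n - f n t", OF c averaging_bounds(2) K]) auto
  show "(\<Sum>n<k. (r1 n t)\<^sup>2) \<le> L\<^sup>2 * k2 * E" if t: "t \<le> 0"
  proof -
    have "(\<Sum>n<k. (r1 n t)\<^sup>2) \<le> (\<Sum>n<k. (exp (mu * t) * (F (U t) \<bullet> b n - f n t))\<^sup>2)"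
      unfolding r1_def by (intro sum_mono weight_mono t)
    also have "\<dots> \<le> L\<^sup>2 * k2 * (h\<^sup>2 * (norm p)\<^sup>2)" by (rule averaging_bounds(2)[OF t])
    also have "\<dots> \<le> L\<^sup>2 * k2 * E" by (rule mult_left_mono[OF E(3) K])
    finally show ?thesis .
  qed
qed

text \<open>
  Maximal regularity.  In the weight \<open>mu\<close>, mode \<open>n\<close> of \<open>q'\<close> is \<open>Gq - \<lambda>\<^sub>n Q\<close>, and \<open>first_order_mode_L2\<close> bounds
  \<open>(\<lambda>\<^sub>n - mu) Q\<close> by \<open>Gq\<close> above the gap; below it \<open>\<lambda>\<^sub>n\<close> is bounded.
\<close>

lemma r2_L2: "half_L2 (r2 n)" and r2_sum: "(\<Sum>n<k. sqn (r2 n)) \<le> c4 * (norm p)\<^sup>2"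
proof -
  define Q Gq where "Q t = exp (mu * t) *\<^sub>R q t" and "Gq t = exp (mu * t) *\<^sub>R g t" for t
  have Q: "half_L2 Q" and Qs: "sqn Q \<le> c1 * c3 * (norm p)\<^sup>2"
    and Gq: "half_L2 Gq" and Gs: "sqn Gq \<le> L\<^sup>2 * c1 * c3 * (norm p)\<^sup>2"
    using dq(1-4) by (simp_all add: Q_def[abs_def] Gq_def[abs_def])
  have R: "exp (mu * t) * qp n t = Gq t \<bullet> b n + (- l n) *\<^sub>R (Q t \<bullet> b n)" for n t
    by (simp add: qp_def Q_def Gq_def algebra_simps)
  have R2: "half_L2 (\<lambda>t. exp (mu * t) * qp n t)" for n
    unfolding R by (intro half_L2_add(1) half_L2_scale(1) half_L2_inner Q Gq)
  have le: "(norm (r2 n t))\<^sup>2 \<le> (norm (exp (mu * t) * qp n t))\<^sup>2" if "t \<le> 0" for n t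
    using weight_mono[OF that, of "qp n t"] by (simp add: r2_def)
  have c: "continuous_on {..0} (r2 n)" for n
  proof -
    have "continuous_on {..0} (\<lambda>t. exp ((th - mu) * t) * (exp (mu * t) * qp n t))"
      by (intro continuous_on_mult half_L2_cont[OF R2] continuous_intros)
    moreover have "exp ((th - mu) * t) * (exp (mu * t) * qp n t) = r2 n t" for t
      by (simp add: r2_def mult.assoc[symmetric] algebra_simps flip: exp_add)
    ultimately show ?thesis by simp
  qed
  show "half_L2 (r2 n)" by (rule half_L2_bound(1)[OF c half_L2_int[OF R2] le])
  have one: "sqn (r2 n) \<le> 6 * sqn (\<lambda>t. Gq t \<bullet> b n) + 8 * mu\<^sup>2 * sqn (\<lambda>t. Q t \<bullet> b n)" for n
  proof -
    define a where "a = sqn (\<lambda>t. Gq t \<bullet> b n)"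
    define c where "c = sqn (\<lambda>t. Q t \<bullet> b n)"
    have c0: "0 \<le> c" and a0: "0 \<le> a" unfolding c_def a_def by (rule half_integral_nonneg; simp)+
    have "sqn (r2 n) \<le> sqn (\<lambda>t. exp (mu * t) * qp n t)"
      by (rule half_L2_bound(2)[OF \<open>continuous_on {..0} (r2 n)\<close> half_L2_int[OF R2] le])
    also have "\<dots> \<le> 2 * a + 2 * sqn (\<lambda>t. (- l n) *\<^sub>R (Q t \<bullet> b n))"
      unfolding R a_def by (intro half_L2_add(2) half_L2_scale(1) half_L2_inner Q Gq)
    also have "sqn (\<lambda>t. (- l n) *\<^sub>R (Q t \<bullet> b n)) = (l n)\<^sup>2 * c"
      unfolding c_def using half_L2_scale(2)[OF half_L2_inner[OF Q], of "- l n"] by simp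
    also have "(l n)\<^sup>2 * c \<le> 2 * (d n)\<^sup>2 * c + 2 * mu\<^sup>2 * c"
    proof -
      have "(l n)\<^sup>2 \<le> 2 * (d n)\<^sup>2 + 2 * mu\<^sup>2" using two_squares[of "d n" mu] by (simp add: d_def)
      hence "(l n)\<^sup>2 * c \<le> (2 * (d n)\<^sup>2 + 2 * mu\<^sup>2) * c" using c0 by (intro mult_right_mono)
      thus ?thesis by (simp add: algebra_simps)
    qed
    finally have 1: "sqn (r2 n) \<le> 2 * a + 2 * (2 * (d n)\<^sup>2 * c + 2 * mu\<^sup>2 * c)" by simp
    \<comment> \<open>above the gap this is the maximal regularity estimate for the parabolic equation\<close>
    have 2: "(d n)\<^sup>2 * c \<le> a + mu\<^sup>2 * c"
    proof (cases "n < N")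
      case True
      have "\<bar>d n\<bar> \<le> mu" using d_low[OF True] d_low'[OF True] dl by simp
      hence "(d n)\<^sup>2 \<le> mu\<^sup>2" by (metis abs_ge_zero power2_abs power_mono)
      thus ?thesis using mult_right_mono[of "(d n)\<^sup>2" "mu\<^sup>2" c] c0 a0 by linarith
    next
      case False
      have D: "((\<lambda>t. Q t \<bullet> b n) has_real_derivative Gq t \<bullet> b n - d n * (Q t \<bullet> b n)) (at t within {..0})" if "t \<le> 0" for t
        using weighted_first_order[OF dq(7)[OF that, of n]] by (simp add: Q_def Gq_def d_def)
      have "d n * (Q 0 \<bullet> b n)\<^sup>2 + (d n)\<^sup>2 * c \<le> a"
        unfolding a_def c_def by (rule first_order_mode_L2[OF D half_L2_inner[OF Q] half_L2_inner[OF Gq]])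
      moreover have "0 \<le> d n * (Q 0 \<bullet> b n)\<^sup>2" using d_high[of n] False dl by simp
      moreover have "0 \<le> mu\<^sup>2 * c" using c0 by simp
      ultimately show ?thesis by linarith
    qed
    have "sqn (r2 n) \<le> 6 * a + 8 * mu\<^sup>2 * c" using 1 2 by (simp add: mult.assoc)
    thus ?thesis unfolding a_def c_def .
  qed
  have "(\<Sum>n<k. sqn (r2 n)) \<le> (\<Sum>n<k. 6 * sqn (\<lambda>t. Gq t \<bullet> b n) + 8 * mu\<^sup>2 * sqn (\<lambda>t. Q t \<bullet> b n))"
    by (rule sum_mono) (rule one)
  also have "\<dots> = 6 * (\<Sum>n<k. sqn (\<lambda>t. Gq t \<bullet> b n)) + 8 * mu\<^sup>2 * (\<Sum>n<k. sqn (\<lambda>t. Q t \<bullet> b n))"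
    by (simp add: sum.distrib sum_distrib_left)
  also have "\<dots> \<le> 6 * (L\<^sup>2 * c1 * c3 * (norm p)\<^sup>2) + 8 * mu\<^sup>2 * (c1 * c3 * (norm p)\<^sup>2)"
    by (intro add_mono mult_left_mono order_trans[OF sqn_partial[OF Gq] Gs] order_trans[OF sqn_partial[OF Q] Qs]) auto
  finally show "(\<Sum>n<k. sqn (r2 n)) \<le> c4 * (norm p)\<^sup>2" by (simp add: c4_def algebra_simps)
qed

lemma r_L2: "half_L2 (r n)" and r_sum: "(\<Sum>n<k. sqn (r n)) \<le> kr * E"
proof -
  have req: "r n t = r1 n t + (- eps) *\<^sub>R r2 n t" for n t by (simp add: r_def)
  show "half_L2 (r n)" unfolding req[abs_def] by (intro half_L2_add(1) half_L2_scale(1) r1_L2 r2_L2)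
  have "sqn (r n) \<le> 2 * sqn (r1 n) + 2 * (eps\<^sup>2 * sqn (r2 n))" for n
    using half_L2_add(2)[OF r1_L2 half_L2_scale(1)[OF r2_L2], of n "- eps" n] half_L2_scale(2)[OF r2_L2, of "- eps" n]
    by (simp add: req[abs_def])
  hence "(\<Sum>n<k. sqn (r n)) \<le> (\<Sum>n<k. 2 * sqn (r1 n) + 2 * (eps\<^sup>2 * sqn (r2 n)))" by (rule sum_mono)
  also have "\<dots> = 2 * (\<Sum>n<k. sqn (r1 n)) + 2 * (eps\<^sup>2 * (\<Sum>n<k. sqn (r2 n)))"
    by (simp add: sum.distrib sum_distrib_left)
  also have "\<dots> \<le> 2 * (L\<^sup>2 * k2 * E) + 2 * (c4 * E)"
  proof (intro add_mono mult_left_mono r1_sum)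
    have "eps\<^sup>2 * (\<Sum>n<k. sqn (r2 n)) \<le> eps\<^sup>2 * (c4 * (norm p)\<^sup>2)" by (intro mult_left_mono r2_sum) simp
    also have "\<dots> = c4 * (eps\<^sup>2 * (norm p)\<^sup>2)" by simp
    also have "\<dots> \<le> c4 * E" by (rule mult_left_mono[OF E(2) k_nonneg(3)])
    finally show "eps\<^sup>2 * (\<Sum>n<k. sqn (r2 n)) \<le> c4 * E" .
  qed auto
  finally show "(\<Sum>n<k. sqn (r n)) \<le> kr * E" by (simp add: kr_def algebra_simps)
qed

lemma q_at: assumes t: "t \<le> 0" shows "(exp (mu * t) * norm (q t))\<^sup>2 \<le> kq * (norm p)\<^sup>2"
proof -
  have "(norm (exp (mu * t) *\<^sub>R q t))\<^sup>2 \<le> c2 * c3 * (norm p)\<^sup>2 / l 0"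
    by (rule norm_sq_le_energy) (use dq(5)[OF t] in simp)
  thus ?thesis by (simp add: kq_def)
qed

lemma bc: "bc n (defect n) (y n) (x n)"
  unfolding bc_def
proof
  assume n: "n < N"
  have "eps / s n * (v 0 \<bullet> b n) + (1 + s n) / (2 * s n) * (u 0 \<bullet> b n) = p \<bullet> b n"
    using u n by (simp add: hyp_modal_def)
  hence "eps / s n * om n 0 + (1 + s n) / (2 * s n) * w n 0 = defect n"
    using n by (simp add: defect_def om_def w_def right_diff_distrib)
  thus "eps * x n 0 + (al + s n) / 2 * y n 0 = s n * defect n"
    unfolding bc_iff[OF n] by (simp add: x_def y_def)
qed

lemma defect_sum: "(\<Sum>n<k. (defect n)\<^sup>2) \<le> kp * E"
proof -
  define A1 where "A1 = 2 * l N / a0"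
  have one: "(defect n)\<^sup>2 \<le> 3 * ((z n 0 - U 0 \<bullet> b n)\<^sup>2 + eps\<^sup>2 / a0\<^sup>2 * (q 0 \<bullet> b n)\<^sup>2
     + eps\<^sup>2 * A1\<^sup>2 * (2 * (U 0 \<bullet> b n)\<^sup>2 + 2 * (z n 0 - U 0 \<bullet> b n)\<^sup>2))" for n
  proof (cases "n < N")
    case False thus ?thesis by (simp add: defect_def)
  next
    case n: True
    note sn = s[OF n]
    have as: "a0 \<le> s n" using sn(2) al(1) by linarith
    have pU: "p \<bullet> b n = U 0 \<bullet> b n" using U n by (simp add: par_modal_def)
    define c where "c = (1 - s n) / (2 * s n)"
    have c0: "0 \<le> c" using sn by (simp add: c_def)
    have "1 - s n \<le> (1 - s n) * (1 + s n)" using sn mult_left_mono[of 1 "1 + s n" "1 - s n"] by simp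
    also have "\<dots> = 4 * eps * l n" using sn(1) by (simp add: power2_eq_square algebra_simps)
    also have "\<dots> \<le> 4 * eps * l N" using l_mono[of n N] n eps by simp
    finally have "c \<le> 4 * eps * l N / (2 * a0)"
      unfolding c_def using as a0_pos eps l_pos[of N] by (intro frac_le) auto
    also have "4 * eps * l N / (2 * a0) = eps * A1" by (simp add: A1_def)
    finally have "c \<le> eps * A1" .
    hence cA: "c\<^sup>2 \<le> eps\<^sup>2 * A1\<^sup>2" using power_mono[OF _ c0, of "eps * A1" 2] by (simp add: power_mult_distrib)
    have eA: "(eps / s n)\<^sup>2 \<le> eps\<^sup>2 / a0\<^sup>2"
      unfolding power_divide using as a0_pos by (intro divide_left_mono power_mono) auto
    have half: "(1 + s n) / (2 * s n) = 1 + c" using sn(3) by (simp add: c_def field_simps)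
    have "defect n = - (z n 0 - U 0 \<bullet> b n) + - (eps / s n * (q 0 \<bullet> b n)) + - (c * z n 0)"
      using n unfolding defect_def pU half by (simp add: algebra_simps)
    hence "(defect n)\<^sup>2 \<le> 3 * ((- (z n 0 - U 0 \<bullet> b n))\<^sup>2 + (- (eps / s n * (q 0 \<bullet> b n)))\<^sup>2 + (- (c * z n 0))\<^sup>2)"
      using three_squares by metis
    also have "\<dots> = 3 * ((z n 0 - U 0 \<bullet> b n)\<^sup>2 + (eps / s n)\<^sup>2 * (q 0 \<bullet> b n)\<^sup>2 + c\<^sup>2 * (z n 0)\<^sup>2)"
      by (simp only: power2_minus power_mult_distrib)
    also have "\<dots> \<le> 3 * ((z n 0 - U 0 \<bullet> b n)\<^sup>2 + eps\<^sup>2 / a0\<^sup>2 * (q 0 \<bullet> b n)\<^sup>2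
     + eps\<^sup>2 * A1\<^sup>2 * (2 * (U 0 \<bullet> b n)\<^sup>2 + 2 * (z n 0 - U 0 \<bullet> b n)\<^sup>2))"
    proof (intro mult_left_mono add_mono order_refl)
      show "(eps / s n)\<^sup>2 * (q 0 \<bullet> b n)\<^sup>2 \<le> eps\<^sup>2 / a0\<^sup>2 * (q 0 \<bullet> b n)\<^sup>2" by (rule mult_right_mono[OF eA]) simp
      have "(z n 0)\<^sup>2 \<le> 2 * (U 0 \<bullet> b n)\<^sup>2 + 2 * (z n 0 - U 0 \<bullet> b n)\<^sup>2"
        using two_squares[of "U 0 \<bullet> b n" "z n 0 - U 0 \<bullet> b n"] by simp
      thus "c\<^sup>2 * (z n 0)\<^sup>2 \<le> eps\<^sup>2 * A1\<^sup>2 * (2 * (U 0 \<bullet> b n)\<^sup>2 + 2 * (z n 0 - U 0 \<bullet> b n)\<^sup>2)"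
        by (intro mult_mono cA) auto
    qed simp
    finally show ?thesis .
  qed
  define P2 where "P2 = (norm p)\<^sup>2"
  have zU: "(\<Sum>n<k. (z n 0 - U 0 \<bullet> b n)\<^sup>2) \<le> k2 * (h\<^sup>2 * P2)"
    using averaging_bounds(1)[of 0 k] by (simp add: P2_def)
  have qq: "(\<Sum>n<k. (q 0 \<bullet> b n)\<^sup>2) \<le> kq * P2"
    using order_trans[OF bessel q_at[of 0, simplified]] by (simp add: P2_def)
  have UU: "(\<Sum>n<k. (U 0 \<bullet> b n)\<^sup>2) \<le> c2 / l 0 * P2"
    using order_trans[OF bessel par_modal_bounds(2)[OF U, of 0, simplified]] by (simp add: P2_def)
  have P20: "0 \<le> P2" by (simp add: P2_def)
  have "(\<Sum>n<k. (defect n)\<^sup>2) \<le> (\<Sum>n<k. 3 * ((z n 0 - U 0 \<bullet> b n)\<^sup>2 + eps\<^sup>2 / a0\<^sup>2 * (q 0 \<bullet> b n)\<^sup>2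
     + eps\<^sup>2 * A1\<^sup>2 * (2 * (U 0 \<bullet> b n)\<^sup>2 + 2 * (z n 0 - U 0 \<bullet> b n)\<^sup>2)))"
    by (rule sum_mono) (rule one)
  also have "\<dots> = 3 * ((\<Sum>n<k. (z n 0 - U 0 \<bullet> b n)\<^sup>2) + eps\<^sup>2 / a0\<^sup>2 * (\<Sum>n<k. (q 0 \<bullet> b n)\<^sup>2)
     + eps\<^sup>2 * A1\<^sup>2 * (2 * (\<Sum>n<k. (U 0 \<bullet> b n)\<^sup>2) + 2 * (\<Sum>n<k. (z n 0 - U 0 \<bullet> b n)\<^sup>2)))"
    by (simp only: sum.distrib sum_distrib_left[symmetric])
  also have "\<dots> \<le> 3 * (k2 * (h\<^sup>2 * P2) + eps\<^sup>2 / a0\<^sup>2 * (kq * P2)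
     + eps\<^sup>2 * A1\<^sup>2 * (2 * (c2 / l 0 * P2) + 2 * (k2 * (1 * P2))))"
  proof (intro mult_left_mono add_mono zU qq UU)
    have "h\<^sup>2 \<le> 1" using h by (simp add: power_le_one)
    hence "k2 * (h\<^sup>2 * P2) \<le> k2 * (1 * P2)" by (intro mult_left_mono mult_right_mono P20 k_nonneg(2))
    thus "(\<Sum>n<k. (z n 0 - U 0 \<bullet> b n)\<^sup>2) \<le> k2 * (1 * P2)" using zU by linarith
  qed auto
  also have "\<dots> = 3 * (k2 * (h\<^sup>2 * P2) + kq / a0\<^sup>2 * (eps\<^sup>2 * P2) + A1\<^sup>2 * (2 * (c2 / l 0) + 2 * k2) * (eps\<^sup>2 * P2))"
    by (simp add: algebra_simps)
  also have "\<dots> \<le> 3 * (k2 * E + kq / a0\<^sup>2 * E + A1\<^sup>2 * (2 * (c2 / l 0) + 2 * k2) * E)"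
    using E(2,3) k_nonneg c_nonneg l_pos[of 0] unfolding P2_def
    by (intro mult_left_mono add_mono) auto
  also have "\<dots> = kp * E" by (simp add: kp_def A1_def algebra_simps)
  finally show ?thesis .
qed

lemma G_eq: "G n t = Ph t \<bullet> b n + r n t"
  by (simp add: G_def H_def Ph_def r_def r1_def r2_def inner_diff_left algebra_simps)

lemma y_eq: "W t \<bullet> b n = y n t + ze n t"
  by (simp add: W_def y_def w_def ze_def inner_diff_left algebra_simps)

lemma G2: "half_L2 (G n)"
  unfolding G_eq[abs_def] by (intro half_L2_add(1) half_L2_inner Ph2 r_L2)

lemma y2: "half_L2 (y n)"
proof -
  have "half_L2 (\<lambda>t. W t \<bullet> b n - ze n t)" by (intro half_L2_diff half_L2_inner W2 ze2)
  thus ?thesis by (simp add: y_eq)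
qed

lemma defect_high: "N \<le> n \<Longrightarrow> defect n = 0" by (simp add: defect_def)

text \<open>
  The contraction estimate for \<open>W = e\<^bsup>th t\<^esup>(u - U)\<close>, with errors.  The weight \<open>et\<close> in Young's inequality is so
  small that \<open>(1 + et)\<^sup>2L\<^sup>2 < dl\<^sup>2\<close>, and the term with \<open>W\<close> on the right can be absorbed.
\<close>

lemma W_bound: "sqn W \<le> kw * E"
proof -
  define R where "R = (1 + et) * ((1 + 1 / et) * kr + 2 * mu * kp) + dl\<^sup>2 * ((1 + 1 / et) * k2)"
  have e1: "0 \<le> 1 + et" "0 \<le> 1 + 1 / et" using et(1) by auto
  have dp: "0 < dl\<^sup>2" using dl by simp
  have "sqn W \<le> ((1 + et)\<^sup>2 * L\<^sup>2 * sqn W + R * E) / dl\<^sup>2"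
  proof (rule sqn_le_partial(2)[OF half_L2_cont[OF W2] half_L2_inner[OF W2]])
    fix k
    have G: "(\<Sum>n<k. sqn (G n)) \<le> (1 + et) * (L\<^sup>2 * sqn W) + (1 + 1 / et) * (kr * E)"
    proof -
      have "(\<Sum>n<k. sqn (G n)) \<le> (\<Sum>n<k. (1 + et) * sqn (\<lambda>t. Ph t \<bullet> b n) + (1 + 1 / et) * sqn (r n))"
        unfolding G_eq by (intro sum_mono half_L2_weighted_add half_L2_inner Ph2 r_L2 et(1))
      also have "\<dots> = (1 + et) * (\<Sum>n<k. sqn (\<lambda>t. Ph t \<bullet> b n)) + (1 + 1 / et) * (\<Sum>n<k. sqn (r n))"
        by (simp only: sum.distrib sum_distrib_left)
      also have "\<dots> \<le> (1 + et) * (L\<^sup>2 * sqn W) + (1 + 1 / et) * (kr * E)"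
        by (intro add_mono mult_left_mono order_trans[OF sqn_partial[OF Ph2] Ph_sqn] r_sum e1)
      finally show ?thesis .
    qed
    have Y: "dl\<^sup>2 * (\<Sum>n<k. sqn (y n)) \<le> (\<Sum>n<k. sqn (G n)) + 2 * mu * (kp * E)"
    proof -
      have "dl\<^sup>2 * (\<Sum>n<k. sqn (y n)) \<le> (\<Sum>n<k. sqn (G n) + 2 * mu * (defect n)\<^sup>2)"
        unfolding sum_distrib_left by (intro sum_mono mode_bounds(1)[OF mode y2 G2 bc defect_high])
      also have "\<dots> = (\<Sum>n<k. sqn (G n)) + 2 * mu * (\<Sum>n<k. (defect n)\<^sup>2)"
        by (simp only: sum.distrib sum_distrib_left)
      also have "\<dots> \<le> (\<Sum>n<k. sqn (G n)) + 2 * mu * (kp * E)"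
        by (intro add_mono mult_left_mono defect_sum) (use mu_pos in auto)
      finally show ?thesis .
    qed
    have "(\<Sum>n<k. sqn (\<lambda>t. W t \<bullet> b n)) \<le> (\<Sum>n<k. (1 + et) * sqn (y n) + (1 + 1 / et) * sqn (ze n))"
      unfolding y_eq by (intro sum_mono half_L2_weighted_add y2 ze2 et(1))
    also have "\<dots> = (1 + et) * (\<Sum>n<k. sqn (y n)) + (1 + 1 / et) * (\<Sum>n<k. sqn (ze n))"
      by (simp only: sum.distrib sum_distrib_left)
    also have "\<dots> \<le> (1 + et) * (\<Sum>n<k. sqn (y n)) + (1 + 1 / et) * (k2 * E)"
      by (intro add_mono mult_left_mono ze_sum e1 order_refl)
    finally have "dl\<^sup>2 * (\<Sum>n<k. sqn (\<lambda>t. W t \<bullet> b n)) \<le> dl\<^sup>2 * ((1 + et) * (\<Sum>n<k. sqn (y n)) + (1 + 1 / et) * (k2 * E))"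
      by (rule mult_left_mono) simp
    also have "\<dots> = (1 + et) * (dl\<^sup>2 * (\<Sum>n<k. sqn (y n))) + dl\<^sup>2 * ((1 + 1 / et) * (k2 * E))"
      by (simp add: algebra_simps)
    also have "\<dots> \<le> (1 + et) * ((1 + et) * (L\<^sup>2 * sqn W) + (1 + 1 / et) * (kr * E) + 2 * mu * (kp * E))
        + dl\<^sup>2 * ((1 + 1 / et) * (k2 * E))"
      using Y G by (intro add_mono mult_left_mono e1 order_refl) linarith
    also have "\<dots> = (1 + et)\<^sup>2 * L\<^sup>2 * sqn W + R * E"
      by (simp only: R_def power2_eq_square distrib_left distrib_right mult_ac add_ac)
    finally show "(\<Sum>n<k. sqn (\<lambda>t. W t \<bullet> b n)) \<le> ((1 + et)\<^sup>2 * L\<^sup>2 * sqn W + R * E) / dl\<^sup>2"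
      using dp by (simp add: field_simps)
  qed
  hence 1: "dl\<^sup>2 * sqn W \<le> (1 + et)\<^sup>2 * L\<^sup>2 * sqn W + R * E" using dp by (simp add: field_simps)
  have "0 \<le> sqn W" by (rule half_integral_nonneg) simp
  hence "(1 + et)\<^sup>2 * L\<^sup>2 * sqn W \<le> (dl\<^sup>2 + L\<^sup>2) / 2 * sqn W" by (rule mult_right_mono[OF et(2)])
  hence "(dl\<^sup>2 - L\<^sup>2) * sqn W \<le> 2 * (R * E)" using 1 by (simp add: field_simps)
  hence "sqn W \<le> 2 * (R * E) / (dl\<^sup>2 - L\<^sup>2)" using gap_sq by (simp add: field_simps)
  moreover have "kw = 2 / (dl\<^sup>2 - L\<^sup>2) * R" by (simp only: kw_def R_def)
  ultimately show ?thesis by simp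
qed

lemma G_bound: "(\<Sum>n<k. sqn (G n)) \<le> kg * E"
proof -
  have "(\<Sum>n<k. sqn (G n)) \<le> (\<Sum>n<k. 2 * sqn (\<lambda>t. Ph t \<bullet> b n) + 2 * sqn (r n))"
    unfolding G_eq by (intro sum_mono half_L2_add(2) half_L2_inner Ph2 r_L2)
  also have "\<dots> = 2 * (\<Sum>n<k. sqn (\<lambda>t. Ph t \<bullet> b n)) + 2 * (\<Sum>n<k. sqn (r n))"
    by (simp only: sum.distrib sum_distrib_left)
  also have "\<dots> \<le> 2 * (L\<^sup>2 * (kw * E)) + 2 * (kr * E)"
    by (intro add_mono mult_left_mono r_sum order_trans[OF sqn_partial[OF Ph2]]
        order_trans[OF Ph_sqn] W_bound) auto
  finally show ?thesis by (simp add: kg_def algebra_simps)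
qed

lemma energy_bound: assumes t: "t \<le> 0" shows "(\<Sum>n<k. eps * (x n t)\<^sup>2 + l n * (y n t)\<^sup>2) \<le> ke * E"
proof -
  have "(\<Sum>n<k. eps * (x n t)\<^sup>2 + l n * (y n t)\<^sup>2) \<le> (\<Sum>n<k. KH * (sqn (G n) + (defect n)\<^sup>2))"
    by (intro sum_mono mode_bounds(2)[OF mode y2 G2 bc defect_high t])
  also have "\<dots> = KH * ((\<Sum>n<k. sqn (G n)) + (\<Sum>n<k. (defect n)\<^sup>2))"
    by (simp only: sum.distrib sum_distrib_left distrib_left)
  also have "\<dots> \<le> KH * (kg * E + kp * E)"
    by (intro mult_left_mono add_mono G_bound defect_sum) (use KH_bounds(3) in simp)
  finally show ?thesis by (simp add: ke_def algebra_simps)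
qed

lemma W_at: assumes t: "t \<le> 0" shows "(norm (W t))\<^sup>2 \<le> kz * E"
proof (rule norm_le_partial)
  fix k
  have "l 0 * (\<Sum>n<k. (y n t)\<^sup>2) \<le> ke * E"
  proof -
    have "l 0 * (\<Sum>n<k. (y n t)\<^sup>2) \<le> (\<Sum>n<k. eps * (x n t)\<^sup>2 + l n * (y n t)\<^sup>2)"
      unfolding sum_distrib_left
    proof (rule sum_mono)
      fix n
      have "l 0 * (y n t)\<^sup>2 \<le> l n * (y n t)\<^sup>2" by (intro mult_right_mono l_mono) auto
      moreover have "0 \<le> eps * (x n t)\<^sup>2" using eps by simp
      ultimately show "l 0 * (y n t)\<^sup>2 \<le> eps * (x n t)\<^sup>2 + l n * (y n t)\<^sup>2" by linarith
    qed
    also have "\<dots> \<le> ke * E" by (rule energy_bound[OF t])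
    finally show ?thesis .
  qed
  hence Y: "(\<Sum>n<k. (y n t)\<^sup>2) \<le> ke * E / l 0" using l_pos[of 0] by (simp add: field_simps)
  have "(\<Sum>n<k. (W t \<bullet> b n)\<^sup>2) \<le> (\<Sum>n<k. 2 * (y n t)\<^sup>2 + 2 * (ze n t)\<^sup>2)"
    unfolding y_eq by (intro sum_mono two_squares)
  also have "\<dots> = 2 * (\<Sum>n<k. (y n t)\<^sup>2) + 2 * (\<Sum>n<k. (ze n t)\<^sup>2)"
    by (simp only: sum.distrib sum_distrib_left)
  also have "\<dots> \<le> 2 * (ke * E / l 0) + 2 * (k2 * E)"
    by (intro add_mono mult_left_mono Y ze_at[OF t]) auto
  also have "\<dots> = kz * E" by (simp add: kz_def algebra_simps)
  finally show "(\<Sum>n<k. (W t \<bullet> b n)\<^sup>2) \<le> kz * E" .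
qed

lemma r2_at: assumes t: "t \<le> 0" shows "(\<Sum>n<k. (r2 n t)\<^sup>2 / l n) \<le> c5 * (norm p)\<^sup>2"
proof -
  define e where "e = exp (mu * t)"
  have one: "(r2 n t)\<^sup>2 / l n \<le> 2 / l 0 * ((e *\<^sub>R g t) \<bullet> b n)\<^sup>2 + 2 * (l n * (e * (q t \<bullet> b n))\<^sup>2)" for n
  proof -
    define a c where "a = (e *\<^sub>R g t) \<bullet> b n" and "c = e * (q t \<bullet> b n)"
    have "(r2 n t)\<^sup>2 \<le> (e * qp n t)\<^sup>2" unfolding r2_def e_def by (rule weight_mono[OF t])
    also have "e * qp n t = a + - (l n * c)" by (simp add: qp_def a_def c_def algebra_simps)
    also have "(a + - (l n * c))\<^sup>2 \<le> 2 * a\<^sup>2 + 2 * (- (l n * c))\<^sup>2" by (rule two_squares)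
    finally have "(r2 n t)\<^sup>2 / l n \<le> (2 * a\<^sup>2 + 2 * (l n * c)\<^sup>2) / l n"
      using l_pos[of n] by (intro divide_right_mono) auto
    also have "\<dots> = 2 * a\<^sup>2 / l n + 2 * (l n * c\<^sup>2)"
      using l_pos[of n] by (simp add: power2_eq_square field_simps)
    also have "\<dots> \<le> 2 * a\<^sup>2 / l 0 + 2 * (l n * c\<^sup>2)"
      using l_mono[of 0 n] l_pos by (intro add_mono divide_left_mono) auto
    finally show ?thesis by (simp add: a_def c_def)
  qed
  have "(norm (e *\<^sub>R g t))\<^sup>2 \<le> L\<^sup>2 * (kq * (norm p)\<^sup>2)"
  proof -
    have "norm (e *\<^sub>R g t) \<le> L * (e * norm (q t))"
      using mult_left_mono[OF dq(6)[of t], of e] by (simp add: e_def mult_ac)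
    hence "(norm (e *\<^sub>R g t))\<^sup>2 \<le> (L * (e * norm (q t)))\<^sup>2" by (intro power_mono) auto
    also have "\<dots> = L\<^sup>2 * (e * norm (q t))\<^sup>2" by (rule power_mult_distrib)
    also have "\<dots> \<le> L\<^sup>2 * (kq * (norm p)\<^sup>2)" unfolding e_def by (intro mult_left_mono q_at[OF t]) simp
    finally show ?thesis .
  qed
  hence G: "(\<Sum>n<k. ((e *\<^sub>R g t) \<bullet> b n)\<^sup>2) \<le> L\<^sup>2 * (kq * (norm p)\<^sup>2)" by (rule order_trans[OF bessel])
  have Q: "(\<Sum>n<k. l n * (e * (q t \<bullet> b n))\<^sup>2) \<le> c2 * c3 * (norm p)\<^sup>2" unfolding e_def by (rule dq(5)[OF t])
  have "(\<Sum>n<k. (r2 n t)\<^sup>2 / l n) \<le> (\<Sum>n<k. 2 / l 0 * ((e *\<^sub>R g t) \<bullet> b n)\<^sup>2 + 2 * (l n * (e * (q t \<bullet> b n))\<^sup>2))"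
    by (rule sum_mono) (rule one)
  also have "\<dots> = 2 / l 0 * (\<Sum>n<k. ((e *\<^sub>R g t) \<bullet> b n)\<^sup>2) + 2 * (\<Sum>n<k. l n * (e * (q t \<bullet> b n))\<^sup>2)"
    by (simp only: sum.distrib sum_distrib_left)
  also have "\<dots> \<le> 2 / l 0 * (L\<^sup>2 * (kq * (norm p)\<^sup>2)) + 2 * (c2 * c3 * (norm p)\<^sup>2)"
    by (intro add_mono mult_left_mono G Q) (use l_pos[of 0] in auto)
  also have "\<dots> = c5 * (norm p)\<^sup>2" by (simp add: c5_def algebra_simps)
  finally show ?thesis .
qed

text \<open>
  The pointwise size in \<open>H\<^bsup>-1\<^esup>\<close> of the right-hand side of \<open>eps om' + om = H - A w\<close>.  The term \<open>eps q'\<close> in it is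
  controlled because \<open>q' = g - Aq\<close> is bounded in \<open>H\<^bsup>-1\<^esup>\<close> by the energy of \<open>q\<close> (\<open>r2_at\<close>).
\<close>

lemma residual_at: assumes t: "t \<le> 0" shows "(\<Sum>n<k. (G n t - l n * y n t)\<^sup>2 / l n) \<le> kgam * E"
proof -
  have one: "(G n t - l n * y n t)\<^sup>2 / l n \<le>
    2 / l 0 * (2 * (Ph t \<bullet> b n)\<^sup>2 + 4 * (r1 n t)\<^sup>2) + 8 * (eps\<^sup>2 * ((r2 n t)\<^sup>2 / l n)) + 2 * (l n * (y n t)\<^sup>2)" for n
  proof -
    define a where "a = 2 * (Ph t \<bullet> b n)\<^sup>2 + 4 * (r1 n t)\<^sup>2"
    have a0: "0 \<le> a" by (simp add: a_def)
    have "(r n t)\<^sup>2 \<le> 2 * (r1 n t)\<^sup>2 + 2 * (eps\<^sup>2 * (r2 n t)\<^sup>2)"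
      using two_squares[of "r1 n t" "- (eps * r2 n t)"] by (simp add: r_def power_mult_distrib)
    hence "(G n t)\<^sup>2 \<le> a + 4 * (eps\<^sup>2 * (r2 n t)\<^sup>2)"
      using two_squares[of "Ph t \<bullet> b n" "r n t"] by (simp add: G_eq a_def)
    moreover have "(G n t - l n * y n t)\<^sup>2 \<le> 2 * (G n t)\<^sup>2 + 2 * (l n * y n t)\<^sup>2"
      using two_squares[of "G n t" "- (l n * y n t)"] by simp
    ultimately have "(G n t - l n * y n t)\<^sup>2 \<le> 2 * a + 8 * (eps\<^sup>2 * (r2 n t)\<^sup>2) + 2 * (l n * y n t)\<^sup>2"
      by linarith
    hence "(G n t - l n * y n t)\<^sup>2 / l n \<le> (2 * a + 8 * (eps\<^sup>2 * (r2 n t)\<^sup>2) + 2 * (l n * y n t)\<^sup>2) / l n"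
      using l_pos[of n] by (intro divide_right_mono) auto
    also have "\<dots> = 2 * a / l n + 8 * (eps\<^sup>2 * ((r2 n t)\<^sup>2 / l n)) + 2 * (l n * (y n t)\<^sup>2)"
      using l_pos[of n] by (simp add: add_divide_distrib power_mult_distrib) (simp add: power2_eq_square)
    also have "2 * a / l n \<le> 2 * a / l 0"
      using l_mono[of 0 n] l_pos a0 by (intro divide_left_mono) auto
    finally show ?thesis by (simp add: a_def)
  qed
  have PhB: "(\<Sum>n<k. (Ph t \<bullet> b n)\<^sup>2) \<le> L\<^sup>2 * (kz * E)"
    by (rule order_trans[OF bessel order_trans[OF Ph_sq mult_left_mono[OF W_at[OF t]]]]) simp
  have R2B: "eps\<^sup>2 * (\<Sum>n<k. (r2 n t)\<^sup>2 / l n) \<le> c5 * E"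
  proof -
    have "eps\<^sup>2 * (\<Sum>n<k. (r2 n t)\<^sup>2 / l n) \<le> eps\<^sup>2 * (c5 * (norm p)\<^sup>2)" by (intro mult_left_mono r2_at[OF t]) simp
    also have "\<dots> = c5 * (eps\<^sup>2 * (norm p)\<^sup>2)" by simp
    also have "\<dots> \<le> c5 * E" by (rule mult_left_mono[OF E(2) k_nonneg'(5)])
    finally show ?thesis .
  qed
  have YB: "(\<Sum>n<k. l n * (y n t)\<^sup>2) \<le> ke * E"
  proof -
    have "(\<Sum>n<k. l n * (y n t)\<^sup>2) \<le> (\<Sum>n<k. eps * (x n t)\<^sup>2 + l n * (y n t)\<^sup>2)"
      using eps by (intro sum_mono) simp
    also have "\<dots> \<le> ke * E" by (rule energy_bound[OF t])
    finally show ?thesis .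
  qed
  have "(\<Sum>n<k. (G n t - l n * y n t)\<^sup>2 / l n) \<le> (\<Sum>n<k. 2 / l 0 * (2 * (Ph t \<bullet> b n)\<^sup>2 + 4 * (r1 n t)\<^sup>2)
      + 8 * (eps\<^sup>2 * ((r2 n t)\<^sup>2 / l n)) + 2 * (l n * (y n t)\<^sup>2))"
    by (rule sum_mono) (rule one)
  also have "\<dots> = 2 / l 0 * (2 * (\<Sum>n<k. (Ph t \<bullet> b n)\<^sup>2) + 4 * (\<Sum>n<k. (r1 n t)\<^sup>2))
      + 8 * (eps\<^sup>2 * (\<Sum>n<k. (r2 n t)\<^sup>2 / l n)) + 2 * (\<Sum>n<k. l n * (y n t)\<^sup>2)"
    by (simp only: sum.distrib sum_distrib_left distrib_left)
  also have "\<dots> \<le> 2 / l 0 * (2 * (L\<^sup>2 * (kz * E)) + 4 * (L\<^sup>2 * k2 * E)) + 8 * (c5 * E) + 2 * (ke * E)"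
    by (intro add_mono mult_left_mono PhB r1_at[OF t] R2B YB) (use l_pos[of 0] in auto)
  also have "\<dots> = kgam * E" by (simp add: kgam_def algebra_simps)
  finally show ?thesis .
qed

text \<open>
  The squared \<open>H\<^bsup>-1\<^esup>\<close> norm of the weighted velocity difference \<open>o1 = e\<^bsup>th t\<^esup>om\<close> satisfies
  \<open>eps \<xi>' \<le> kgam E - al \<xi>\<close>.  A direct use of the energy would lose a factor \<open>eps\<^bsup>1/2\<^esup>\<close> here.
\<close>

lemma velocity_bound: "(\<Sum>n<k. (om n 0)\<^sup>2 / l n) \<le> kgam * E / al"
proof -
  define o1 where "o1 n t = x n t - th * y n t" for n t
  define xp where "xp n t = (G n t - al * x n t - d n * y n t) / eps" for n t
  have Dy: "(y n has_real_derivative x n t) (at t within {..0})"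
    and Dx: "(x n has_real_derivative xp n t) (at t within {..0})" if "t \<le> 0" for n t
    using mode[of n] that by (auto simp: mode_eq_def xp_def)
  have D: "((\<lambda>t. \<Sum>n<k. (o1 n t)\<^sup>2 / l n) has_real_derivative
      (\<Sum>n<k. 2 * o1 n t * (xp n t - th * x n t) / l n)) (at t within {..0})" if t: "t \<le> 0" for t
    unfolding o1_def
    by (intro DERIV_sum DERIV_cdivide) (auto intro!: derivative_eq_intros Dy Dx t simp: algebra_simps)
  have eo: "eps * (xp n t - th * x n t) = (G n t - l n * y n t) - (1 - eps * th) * o1 n t" for n t
  proof -
    have "eps * (xp n t - th * x n t) = G n t - al * x n t - d n * y n t - eps * th * x n t"
    proof -
      have "eps * xp n t = G n t - al * x n t - d n * y n t" using eps by (simp add: xp_def)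
      thus ?thesis by (simp add: right_diff_distrib mult.assoc)
    qed
    also have "\<dots> = (G n t - l n * y n t) - (1 - eps * th) * o1 n t"
      unfolding th(1) d_def th(2) o1_def by (simp add: power2_eq_square algebra_simps)
    finally show ?thesis .
  qed
  have "(\<Sum>n<k. (o1 n 0)\<^sup>2 / l n) \<le> kgam * E / al"
  proof (rule decay_comparison[OF D _ _ eps al(2)])
    fix t :: real assume t: "t \<le> 0"
    have "eps * (2 * o1 n t * (xp n t - th * x n t) / l n)
        \<le> (G n t - l n * y n t)\<^sup>2 / l n - al * ((o1 n t)\<^sup>2 / l n)" for n
    proof -
      define a c where "a = G n t - l n * y n t" and "c = o1 n t"
      have "eps * (2 * o1 n t * (xp n t - th * x n t)) = 2 * c * (a - (1 - eps * th) * c)"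
        using eo[of n t] by (simp add: a_def c_def mult_ac)
      also have "\<dots> = a\<^sup>2 - al * c\<^sup>2 - (a - c)\<^sup>2"
        unfolding th(1) by (simp add: power2_eq_square algebra_simps)
      also have "\<dots> \<le> a\<^sup>2 - al * c\<^sup>2" by simp
      finally have "eps * (2 * o1 n t * (xp n t - th * x n t)) / l n \<le> (a\<^sup>2 - al * c\<^sup>2) / l n"
        using l_pos[of n] by (intro divide_right_mono) auto
      thus ?thesis by (simp add: a_def c_def diff_divide_distrib)
    qed
    hence "eps * (\<Sum>n<k. 2 * o1 n t * (xp n t - th * x n t) / l n)
        \<le> (\<Sum>n<k. (G n t - l n * y n t)\<^sup>2 / l n - al * ((o1 n t)\<^sup>2 / l n))"
      unfolding sum_distrib_left by (intro sum_mono)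
    also have "\<dots> = (\<Sum>n<k. (G n t - l n * y n t)\<^sup>2 / l n) - al * (\<Sum>n<k. (o1 n t)\<^sup>2 / l n)"
      by (simp only: sum_subtractf sum_distrib_left)
    finally show "eps * (\<Sum>n<k. 2 * o1 n t * (xp n t - th * x n t) / l n)
        \<le> kgam * E - al * (\<Sum>n<k. (o1 n t)\<^sup>2 / l n)"
      using residual_at[OF t, of k] by linarith
    define M where "M = max (2 / eps) (2 * th\<^sup>2 / l 0) / l 0"
    have "(o1 n t)\<^sup>2 / l n \<le> M * (eps * (x n t)\<^sup>2 + l n * (y n t)\<^sup>2)" for n
    proof -
      define m where "m = max (2 / eps) (2 * th\<^sup>2 / l 0)"
      have "(o1 n t)\<^sup>2 \<le> 2 * (x n t)\<^sup>2 + 2 * th\<^sup>2 * (y n t)\<^sup>2"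
        using two_squares[of "x n t" "- (th * y n t)"] by (simp add: o1_def power_mult_distrib)
      also have "\<dots> \<le> m * (eps * (x n t)\<^sup>2) + m * (l n * (y n t)\<^sup>2)"
      proof (rule add_mono)
        have "2 / eps * (eps * (x n t)\<^sup>2) \<le> m * (eps * (x n t)\<^sup>2)"
          unfolding m_def using eps by (intro mult_right_mono) auto
        thus "2 * (x n t)\<^sup>2 \<le> m * (eps * (x n t)\<^sup>2)" using eps by simp
        have "2 * th\<^sup>2 / l 0 * (l 0 * (y n t)\<^sup>2) \<le> m * (l n * (y n t)\<^sup>2)"
          unfolding m_def using l_pos l_mono[of 0 n]
          by (intro mult_mono mult_right_mono) (auto simp: less_imp_le le_max_iff_disj)
        thus "2 * th\<^sup>2 * (y n t)\<^sup>2 \<le> m * (l n * (y n t)\<^sup>2)" using l_pos[of 0] by simp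
      qed
      finally have o: "(o1 n t)\<^sup>2 \<le> m * (eps * (x n t)\<^sup>2 + l n * (y n t)\<^sup>2)" by (simp add: algebra_simps)
      have "(o1 n t)\<^sup>2 / l n \<le> (o1 n t)\<^sup>2 / l 0"
        using l_mono[of 0 n] l_pos by (intro divide_left_mono) auto
      also have "\<dots> \<le> m * (eps * (x n t)\<^sup>2 + l n * (y n t)\<^sup>2) / l 0"
        using o l_pos[of 0] by (intro divide_right_mono) auto
      finally show ?thesis by (simp add: M_def m_def)
    qed
    hence "(\<Sum>n<k. (o1 n t)\<^sup>2 / l n) \<le> M * (\<Sum>n<k. eps * (x n t)\<^sup>2 + l n * (y n t)\<^sup>2)"
      unfolding sum_distrib_left by (intro sum_mono)
    also have "\<dots> \<le> M * (ke * E)"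
    proof (rule mult_left_mono[OF energy_bound[OF t]])
      have "0 \<le> max (2 / eps) (2 * th\<^sup>2 / l 0)" using eps by (simp add: le_max_iff_disj)
      thus "0 \<le> M" unfolding M_def using l_pos[of 0] by simp
    qed
    finally show "(\<Sum>n<k. (o1 n t)\<^sup>2 / l n) \<le> max (2 / eps) (2 * th\<^sup>2 / l 0) / l 0 * (ke * E)"
      by (simp only: M_def)
  qed
  moreover have "o1 n 0 = om n 0" for n by (simp add: o1_def x_def y_def)
  ultimately show ?thesis by simp
qed

lemma difference_at_zero: "(\<Sum>n<k. (eps + 1 / l n) * (om n 0)\<^sup>2 + l n * (w n 0)\<^sup>2) \<le> kfin * E"
proof -
  have y0: "y n 0 = w n 0" and x0: "om n 0 = x n 0 + - (th * y n 0)" for n by (simp_all add: y_def x_def)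
  have one: "(eps + 1 / l n) * (om n 0)\<^sup>2 + l n * (w n 0)\<^sup>2
      \<le> (3 + 2 * mu / l 0) * (eps * (x n 0)\<^sup>2 + l n * (y n 0)\<^sup>2) + (om n 0)\<^sup>2 / l n" for n
  proof -
    have "eps * (om n 0)\<^sup>2 \<le> eps * (2 * (x n 0)\<^sup>2 + 2 * (- (th * y n 0))\<^sup>2)"
      unfolding x0 using eps by (intro mult_left_mono two_squares) auto
    also have "\<dots> = 2 * (eps * (x n 0)\<^sup>2) + 2 * (eps * th\<^sup>2) * (y n 0)\<^sup>2"
      by (simp add: power_mult_distrib algebra_simps)
    also have "2 * (eps * th\<^sup>2) * (y n 0)\<^sup>2 \<le> 2 * mu * (y n 0)\<^sup>2"
      using th(2,4) by (intro mult_right_mono) auto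
    also have "2 * mu * (y n 0)\<^sup>2 \<le> 2 * mu / l 0 * (l n * (y n 0)\<^sup>2)"
    proof -
      have "2 * mu / l 0 * (l 0 * (y n 0)\<^sup>2) \<le> 2 * mu / l 0 * (l n * (y n 0)\<^sup>2)"
        using mu_pos l_pos[of 0] l_mono[of 0 n] by (intro mult_left_mono mult_right_mono) auto
      thus ?thesis using l_pos[of 0] by simp
    qed
    finally have 1: "eps * (om n 0)\<^sup>2 \<le> 2 * (eps * (x n 0)\<^sup>2) + 2 * mu / l 0 * (l n * (y n 0)\<^sup>2)" by simp
    define a c m where "a = eps * (x n 0)\<^sup>2" and "c = l n * (y n 0)\<^sup>2" and "m = 2 * mu / l 0"
    have nn: "0 \<le> a" "0 \<le> c" "0 \<le> m * a" "0 \<le> m * c"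
      using eps l_pos[of n] l_pos[of 0] mu_pos by (auto simp: a_def c_def m_def)
    have "(eps + 1 / l n) * (om n 0)\<^sup>2 + l n * (w n 0)\<^sup>2 = eps * (om n 0)\<^sup>2 + (om n 0)\<^sup>2 / l n + c"
      by (simp add: c_def y0 distrib_right)
    also have "\<dots> \<le> (2 * a + m * c) + (om n 0)\<^sup>2 / l n + c" using 1 by (simp add: a_def c_def m_def)
    also have "\<dots> \<le> (3 + m) * (a + c) + (om n 0)\<^sup>2 / l n" using nn by (simp add: algebra_simps)
    finally show ?thesis by (simp add: a_def c_def m_def)
  qed
  have "(\<Sum>n<k. (eps + 1 / l n) * (om n 0)\<^sup>2 + l n * (w n 0)\<^sup>2)
     \<le> (\<Sum>n<k. (3 + 2 * mu / l 0) * (eps * (x n 0)\<^sup>2 + l n * (y n 0)\<^sup>2) + (om n 0)\<^sup>2 / l n)"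
    by (rule sum_mono) (rule one)
  also have "\<dots> = (3 + 2 * mu / l 0) * (\<Sum>n<k. eps * (x n 0)\<^sup>2 + l n * (y n 0)\<^sup>2) + (\<Sum>n<k. (om n 0)\<^sup>2 / l n)"
    unfolding sum_distrib_left by (rule sum.distrib)
  also have "\<dots> \<le> (3 + 2 * mu / l 0) * (ke * E) + kgam * E / a0"
  proof (intro add_mono mult_left_mono energy_bound)
    have "kgam * E / al \<le> kgam * E / a0"
      using al a0_pos k_nonneg'(6) E(1) by (intro divide_left_mono) auto
    thus "(\<Sum>n<k. (om n 0)\<^sup>2 / l n) \<le> kgam * E / a0" using velocity_bound[of k] by linarith
  qed (use mu_pos l_pos[of 0] in auto)
  also have "\<dots> = kfin * E" by (simp add: kfin_def algebra_simps)
  finally show ?thesis .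
qed

lemma difference_at_zero_explicit:
  "(\<Sum>n<k. (eps + 1 / l n) * (v 0 \<bullet> b n - (U 0 \<bullet> b n - U (0 - h) \<bullet> b n) / h)\<^sup>2
      + l n * (u 0 \<bullet> b n - (C n 0 - C n (0 - h)) / h)\<^sup>2) \<le> kfin * E"
  using difference_at_zero[of k] by (simp add: om_def w_def z_def q_def inner_diff_left)

end

section \<open>The distance between the manifolds\<close>

context hyperbolic_setting
begin

text \<open>
  Only finitely many modes are involved, so the averages and difference quotients at \<open>0\<close> converge to \<open>U(0)\<close>
  and \<open>F(U(0)) - AU(0)\<close> as \<open>h \<rightarrow> 0\<close>.
\<close>

lemma difference_limit:
  assumes u: "hyp_modal p u v" and U: "par_modal p U" and p: "\<And>n. N \<le> n \<Longrightarrow> p \<bullet> b n = 0"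
  shows "(\<Sum>n<k. (eps + 1 / l n) * (v 0 \<bullet> b n - (F (U 0) \<bullet> b n - l n * (U 0 \<bullet> b n)))\<^sup>2
      + l n * (u 0 \<bullet> b n - U 0 \<bullet> b n)\<^sup>2) \<le> kfin * ((norm p)\<^sup>2 * eps\<^sup>2)"
proof (rule LIMSEQ_le)
  define h where "h j = inverse (real (Suc j))" for j
  have h: "0 < h j" "h j \<le> 1" for j by (auto simp: h_def field_simps)
  have h0: "h \<longlonglongrightarrow> 0" unfolding h_def[abs_def] by (rule LIMSEQ_inverse_real_of_nat)
  define C where "C n t = - integral {t..0} (\<lambda>r. U r \<bullet> b n)" for n t
  have Uc: "continuous_on {..0} U" using U by (simp add: par_modal_def)
  have DC: "(C n has_real_derivative U 0 \<bullet> b n) (at 0 within {..0})" for n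
  proof -
    have "continuous_on {..0} (\<lambda>r. U r \<bullet> b n)" by (intro continuous_intros Uc)
    from antiderivative_half[OF this] obtain c where "c = C n"
      "\<And>t. t \<le> 0 \<Longrightarrow> (c has_vector_derivative U t \<bullet> b n) (at t within {..0})" unfolding C_def[abs_def] by metis
    thus ?thesis by (simp add: has_real_derivative_iff_has_vector_derivative)
  qed
  have DU: "((\<lambda>r. U r \<bullet> b n) has_real_derivative F (U 0) \<bullet> b n - l n * (U 0 \<bullet> b n)) (at 0 within {..0})" for n
    using U by (simp add: par_modal_def)
  have q: "(\<lambda>j. (U 0 \<bullet> b n - U (0 - h j) \<bullet> b n) / h j) \<longlonglongrightarrow> F (U 0) \<bullet> b n - l n * (U 0 \<bullet> b n)" for n
    using left_quotient_limit[OF DU] by (simp add: h_def)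
  have z: "(\<lambda>j. (C n 0 - C n (0 - h j)) / h j) \<longlonglongrightarrow> U 0 \<bullet> b n" for n
    using left_quotient_limit[OF DC] by (simp add: h_def)
  show "(\<lambda>j. \<Sum>n<k. (eps + 1 / l n) * (v 0 \<bullet> b n - (U 0 \<bullet> b n - U (0 - h j) \<bullet> b n) / h j)\<^sup>2
      + l n * (u 0 \<bullet> b n - (C n 0 - C n (0 - h j)) / h j)\<^sup>2) \<longlonglongrightarrow>
    (\<Sum>n<k. (eps + 1 / l n) * (v 0 \<bullet> b n - (F (U 0) \<bullet> b n - l n * (U 0 \<bullet> b n)))\<^sup>2
      + l n * (u 0 \<bullet> b n - U 0 \<bullet> b n)\<^sup>2)"
    by (intro tendsto_intros q z)
  have "(\<lambda>j. kfin * ((norm p)\<^sup>2 * (eps\<^sup>2 + (h j)\<^sup>2 * (1 + 1 / (th - mu)))))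
      \<longlonglongrightarrow> kfin * ((norm p)\<^sup>2 * (eps\<^sup>2 + 0\<^sup>2 * (1 + 1 / (th - mu))))"
    by (intro tendsto_intros h0)
  thus "(\<lambda>j. kfin * ((norm p)\<^sup>2 * (eps\<^sup>2 + (h j)\<^sup>2 * (1 + 1 / (th - mu))))) \<longlonglongrightarrow> kfin * ((norm p)\<^sup>2 * eps\<^sup>2)" by simp
  obtain V where Vc: "continuous_on {..0} V"
    and Vn: "\<And>t n. t \<le> 0 \<Longrightarrow> V t \<bullet> b n = F (U t) \<bullet> b n - l n * (U t \<bullet> b n)"
    and Vb: "\<And>t. t \<le> 0 \<Longrightarrow> (exp (mu * t) * norm (V t))\<^sup>2 \<le> c2 * c3 / l 0 * (norm p)\<^sup>2"
    using par_modal_regularity[OF U] by metis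
  show "\<exists>M. \<forall>j\<ge>M. (\<Sum>n<k. (eps + 1 / l n) * (v 0 \<bullet> b n - (U 0 \<bullet> b n - U (0 - h j) \<bullet> b n) / h j)\<^sup>2
      + l n * (u 0 \<bullet> b n - (C n 0 - C n (0 - h j)) / h j)\<^sup>2)
     \<le> kfin * ((norm p)\<^sup>2 * (eps\<^sup>2 + (h j)\<^sup>2 * (1 + 1 / (th - mu))))"
  proof (intro exI allI impI)
    fix j
    interpret c: comparison D A lam e F L N eps p u v U V "h j"
      by unfold_locales (use u U Vc Vn Vb p h[of j] in \<open>auto simp: kq_def\<close>)
    show "(\<Sum>n<k. (eps + 1 / l n) * (v 0 \<bullet> b n - (U 0 \<bullet> b n - U (0 - h j) \<bullet> b n) / h j)\<^sup>2
      + l n * (u 0 \<bullet> b n - (C n 0 - C n (0 - h j)) / h j)\<^sup>2)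
     \<le> kfin * ((norm p)\<^sup>2 * (eps\<^sup>2 + (h j)\<^sup>2 * (1 + 1 / (th - mu))))"
      using c.difference_at_zero_explicit[of k] unfolding c.C_def c.E_def C_def .
  qed
qed

lemma energy_norm_le:
  assumes w: "\<And>k. (\<Sum>n<k. (eps + 1 / l n) * (o1 \<bullet> b n)\<^sup>2 + l n * (w1 \<bullet> b n)\<^sup>2) \<le> K\<^sup>2" and K: "0 \<le> K"
  shows "(w1, o1) \<in> energy_space lam e" "energy_norm lam e eps (w1, o1) \<le> K"
proof -
  have nn: "0 \<le> eps * (o1 \<bullet> b n)\<^sup>2" "0 \<le> (o1 \<bullet> b n)\<^sup>2 / l n" "0 \<le> l n * (w1 \<bullet> b n)\<^sup>2" for n
    using eps l_pos[of n] by auto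
  have split: "(eps + 1 / l n) * (o1 \<bullet> b n)\<^sup>2 + l n * (w1 \<bullet> b n)\<^sup>2
     = eps * (o1 \<bullet> b n)\<^sup>2 + (o1 \<bullet> b n)\<^sup>2 / l n + l n * (w1 \<bullet> b n)\<^sup>2" for n by (simp add: distrib_right)
  have part: "(\<Sum>n<k. eps * (o1 \<bullet> b n)\<^sup>2 + (o1 \<bullet> b n)\<^sup>2 / l n + l n * (w1 \<bullet> b n)\<^sup>2) \<le> K\<^sup>2" for k
    using w[of k] by (simp only: split)
  have s: "summable (\<lambda>n. a n)" if "\<And>n. 0 \<le> a n" "\<And>n. a n \<le> eps * (o1 \<bullet> b n)\<^sup>2 + (o1 \<bullet> b n)\<^sup>2 / l n + l n * (w1 \<bullet> b n)\<^sup>2" for a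
    by (rule summableI_nonneg_bounded[OF that(1), of _ "K\<^sup>2"]) (rule order_trans[OF sum_mono[OF that(2)] part])
  have s1: "summable (\<lambda>n. eps * (o1 \<bullet> b n)\<^sup>2)" and s2: "summable (\<lambda>n. (o1 \<bullet> b n)\<^sup>2 / l n)"
    and s3: "summable (\<lambda>n. l n * (w1 \<bullet> b n)\<^sup>2)"
    by (rule s; use nn in \<open>simp add: add_increasing add_increasing2\<close>)+
  have H1: "(\<lambda>n. lam (Suc n) powr 1 * (w1 \<bullet> e (Suc n))\<^sup>2) = (\<lambda>n. l n * (w1 \<bullet> b n)\<^sup>2)"
    using l_pos by (simp add: l_def b_def less_imp_le)
  have Hm: "(\<lambda>n. lam (Suc n) powr (-1) * (o1 \<bullet> e (Suc n))\<^sup>2) = (\<lambda>n. (o1 \<bullet> b n)\<^sup>2 / l n)"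
    using l_pos by (simp add: l_def b_def powr_minus_divide less_imp_le)
  show "(w1, o1) \<in> energy_space lam e"
  proof -
    have "summable (\<lambda>n. lam (Suc n) powr 1 * (w1 \<bullet> e (Suc n))\<^sup>2)" unfolding H1 by (rule s3)
    thus ?thesis by (simp add: energy_space_def Hs_space_def)
  qed
  have "eps * (norm o1)\<^sup>2 = (\<Sum>n. eps * (o1 \<bullet> b n)\<^sup>2)"
    using sums_unique[OF sums_mult[OF parseval_norm, of eps]] by simp
  moreover have "(Hs_norm lam e (-1) o1)\<^sup>2 = (\<Sum>n. (o1 \<bullet> b n)\<^sup>2 / l n)"
    unfolding Hs_norm_def Hm by (rule real_sqrt_pow2[OF suminf_nonneg[OF s2]]) (rule nn)
  moreover have "(Hs_norm lam e 1 w1)\<^sup>2 = (\<Sum>n. l n * (w1 \<bullet> b n)\<^sup>2)"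
    unfolding Hs_norm_def H1 by (rule real_sqrt_pow2[OF suminf_nonneg[OF s3]]) (rule nn)
  moreover have "(\<Sum>n. eps * (o1 \<bullet> b n)\<^sup>2) + (\<Sum>n. (o1 \<bullet> b n)\<^sup>2 / l n) + (\<Sum>n. l n * (w1 \<bullet> b n)\<^sup>2)
      = (\<Sum>n. eps * (o1 \<bullet> b n)\<^sup>2 + (o1 \<bullet> b n)\<^sup>2 / l n + l n * (w1 \<bullet> b n)\<^sup>2)"
    by (simp only: suminf_add[OF s1 s2] suminf_add[OF summable_add[OF s1 s2] s3])
  moreover have "(\<Sum>n. eps * (o1 \<bullet> b n)\<^sup>2 + (o1 \<bullet> b n)\<^sup>2 / l n + l n * (w1 \<bullet> b n)\<^sup>2) \<le> K\<^sup>2"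
    by (rule suminf_le_const[OF _ part]) (intro summable_add s1 s2 s3)
  ultimately have "eps * (norm o1)\<^sup>2 + (Hs_norm lam e (-1) o1)\<^sup>2 + (Hs_norm lam e 1 w1)\<^sup>2 \<le> K\<^sup>2" by linarith
  hence "energy_norm lam e eps (w1, o1) \<le> sqrt (K\<^sup>2)"
    unfolding energy_norm_def fst_conv snd_conv by (rule real_sqrt_le_mono)
  thus "energy_norm lam e eps (w1, o1) \<le> K" using K by simp
qed

lemma manifold_difference:
  assumes p: "p \<in> range (spectral_proj e N)"
  shows "M_eps D A lam e F N eps p - M_zero D A lam e F N p \<in> energy_space lam e"
    "energy_norm lam e eps (M_eps D A lam e F N eps p - M_zero D A lam e F N p) \<le> sqrt kfin * eps * norm p"
proof -
  obtain u v where u: "hyp_modal p u v" and Me: "M_eps D A lam e F N eps p = (u 0, v 0)"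
    using M_eps_modal[OF p] by metis
  obtain U where U: "par_modal p U" and M0: "M_zero D A lam e F N p = (U 0, F (U 0) - A (U 0))" and UD: "U 0 \<in> D"
    using M_zero_modal[OF p] by metis
  have diff: "M_eps D A lam e F N eps p - M_zero D A lam e F N p = (u 0 - U 0, v 0 - (F (U 0) - A (U 0)))"
    by (simp add: Me M0)
  have b: "(\<Sum>n<k. (eps + 1 / l n) * ((v 0 - (F (U 0) - A (U 0))) \<bullet> b n)\<^sup>2 + l n * ((u 0 - U 0) \<bullet> b n)\<^sup>2)
      \<le> (sqrt kfin * eps * norm p)\<^sup>2" for k
    using difference_limit[OF u U low_projection[OF p], of k] k_nonneg'(7)
    by (simp add: inner_diff_left A_coefficient[OF UD] power_mult_distrib mult_ac)
  have K: "0 \<le> sqrt kfin * eps * norm p" using k_nonneg'(7) eps by simp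
  show "M_eps D A lam e F N eps p - M_zero D A lam e F N p \<in> energy_space lam e"
    "energy_norm lam e eps (M_eps D A lam e F N eps p - M_zero D A lam e F N p) \<le> sqrt kfin * eps * norm p"
    unfolding diff by (rule energy_norm_le[OF b K])+
qed

end

theorem theorem3p3:
  fixes D :: "'a::{real_inner, complete_space} set"
    and A :: "'a \<Rightarrow> 'a"
    and lam :: "nat \<Rightarrow> real"
    and e :: "nat \<Rightarrow> 'a"
    and F :: "'a \<Rightarrow> 'a"
    and L :: real
    and N :: nat
  assumes "spectral_setting D A lam e"
    and "\<forall>u1 u2. norm (F u1 - F u2) \<le> L * norm (u1 - u2)"
    and "F 0 = 0"
    and "1 \<le> N"
    and "lam (N + 1) - lam N > 2 * L"
  shows "\<exists>C::real. \<forall>eps>0. 3 * lam (N + 1) + lam N \<le> 1 / eps \<longrightarrow>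
           (\<forall>p \<in> range (spectral_proj e N).
              M_eps D A lam e F N eps p - M_zero D A lam e F N p \<in> energy_space lam e \<and>
              energy_norm lam e eps (M_eps D A lam e F N eps p - M_zero D A lam e F N p)
                \<le> C * eps * norm p)"
proof -
  interpret inertial_setting D A lam e F L N
    by unfold_locales (use assms in auto)
  show ?thesis
  proof (intro exI allI impI ballI)
    fix eps p assume "0 < eps" "3 * lam (N + 1) + lam N \<le> 1 / eps" and p: "p \<in> range (spectral_proj e N)"
    then interpret hyperbolic_setting D A lam e F L N eps by unfold_locales
    show "M_eps D A lam e F N eps p - M_zero D A lam e F N p \<in> energy_space lam e \<and>
        energy_norm lam e eps (M_eps D A lam e F N eps p - M_zero D A lam e F N p) \<le> sqrt kfin * eps * norm p"
      using manifold_difference[OF p] by blast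
  qed
qed

end
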